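(* Consider estimating a unimodal spherically symmetric Lebesgue density $q_Y(\|y-\mu\|^2)$, $y,\mu\in\mathbb{R}^p$, $p\ge4$, under integrated $L_1$ loss and based on $X\sim p_X(\|x-\mu\|^2)$. A plug-in Baranchik density estimator $q_Y(\|y-\hat\mu_{a,r(\cdot)}(X)\|^2)$, with $\hat\mu_{a,r(\cdot)}(X)=\left(1-a\,\frac{r(X'X)}{X'X}\right)X$ (where $X'X=\|X\|^2$), dominates the plug-in $q_Y(\|y-X\|^2)$ provided: (i) $0\le r(\cdot)\le1$ and $r(\cdot)\ne0$; (ii) $r(t)$ is non-decreasing for $t>0$; (iii) $r(t)/t$ is non-increasing for $t>0$; (iv)' $0<E_{p_X}\left(\frac{F'(\|X-\mu\|/2)}{\|X-\mu\|}\right)<\infty$; (v)' $$0<a\le\frac{2(p-2)}{p}\;\frac{\int_{(0,\infty)}u^{\frac{p-3}{2}}\,p_X(u)\,F'\left(\frac{\sqrt u}{2}\right)du}{\int_{(0,\infty)}u^{\frac{p-5}{2}}\,p_X(u)\,F'\left(\frac{\sqrt u}{2}\right)du}\,.$$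
   Context: $F$ is the cdf of $Y_1$ when $Y=(Y_1,\dots,Y_p)'$ has density $q_Y(\|y\|^2)$, and $F'$ is the corresponding univariate marginal density. Densities are with respect to Lebesgue measure. The integrated $L_1$ loss of an estimate $\hat q(\cdot;x)$ is $\int_{\mathbb{R}^p}|q_Y(\|y-\mu\|^2)-\hat q(y;x)|\,dy$; risk is the expectation over $X$. One estimator dominates another if its risk is $\le$ for all $\mu$ with strict inequality for some $\mu$. Unimodal means that $q_Y(\|y\|^2)$ is a non-increasing function of $\|y\|$. *)

theory Defs
  imports "HOL-Probability.Probability"
begin

definition lebesgue_density :: "(real^'n \<Rightarrow> real) \<Rightarrow> bool" where
  "lebesgue_density f \<longleftrightarrow>
     f \<in> borel_measurable borel \<and> (\<forall>y. 0 \<le> f y) \<and> (\<integral>\<^sup>+y. ennreal (f y) \<partial>lborel) = 1"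

definition spherical :: "(real \<Rightarrow> real) \<Rightarrow> real^'n \<Rightarrow> real^'n \<Rightarrow> real" where
  "spherical f \<mu> y = f ((norm (y - \<mu>))\<^sup>2)"

text \<open>The origin is left out, so that a density with a pole at its centre is covered whatever
  real number represents its value there; densities matter only up to null sets.\<close>

definition unimodal :: "(real^'n \<Rightarrow> real) \<Rightarrow> bool" where
  "unimodal f \<longleftrightarrow> (\<forall>y z. 0 < norm y \<and> norm y \<le> norm z \<longrightarrow> f z \<le> f y)"

definition spherical_law :: "(real \<Rightarrow> real) \<Rightarrow> real^'n \<Rightarrow> (real^'n) measure" where
  "spherical_law f \<mu> = density lborel (\<lambda>x. ennreal (spherical f \<mu> x))"

text \<open>The index type \<open>'n\<close> has no distinguished first element, so the coordinate \<open>k\<close> is a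
  parameter. By spherical symmetry the cdf does not depend on it.\<close>

definition coord_cdf :: "(real \<Rightarrow> real) \<Rightarrow> 'n::finite \<Rightarrow> real \<Rightarrow> real" where
  "coord_cdf q k = cdf (distr (spherical_law q (0 :: real^'n)) borel (\<lambda>y. y $ k))"

text \<open>In dimension at least 3 the cdf of a coordinate of a spherically symmetric density is
  differentiable at every nonzero point; the value of \<open>deriv\<close> at 0, where the marginal density
  may have a pole, affects no integral.\<close>

definition marginal_density :: "(real \<Rightarrow> real) \<Rightarrow> 'n::finite \<Rightarrow> real \<Rightarrow> real" where
  "marginal_density q k = deriv (coord_cdf q k)"

text \<open>A density estimator maps an observation \<open>x\<close> to a function of \<open>y\<close>. Loss and risk take values
  in \<open>ennreal\<close>, so they are meaningful without integrability hypotheses.\<close>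

definition l1_loss :: "(real \<Rightarrow> real) \<Rightarrow> real^'n \<Rightarrow> (real^'n \<Rightarrow> real) \<Rightarrow> ennreal" where
  "l1_loss q \<mu> g = (\<integral>\<^sup>+y. ennreal \<bar>spherical q \<mu> y - g y\<bar> \<partial>lborel)"

definition l1_risk ::
  "(real \<Rightarrow> real) \<Rightarrow> (real \<Rightarrow> real) \<Rightarrow> (real^'n \<Rightarrow> real^'n \<Rightarrow> real) \<Rightarrow> real^'n \<Rightarrow> ennreal" where
  "l1_risk p q est \<mu> = (\<integral>\<^sup>+x. l1_loss q \<mu> (est x) \<partial>spherical_law p \<mu>)"

definition dominates ::
  "(real \<Rightarrow> real) \<Rightarrow> (real \<Rightarrow> real) \<Rightarrow>
   (real^'n \<Rightarrow> real^'n \<Rightarrow> real) \<Rightarrow> (real^'n \<Rightarrow> real^'n \<Rightarrow> real) \<Rightarrow> bool" where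
  "dominates p q est1 est2 \<longleftrightarrow>
     (\<forall>\<mu>. l1_risk p q est1 \<mu> \<le> l1_risk p q est2 \<mu>) \<and>
     (\<exists>\<mu>. l1_risk p q est1 \<mu> < l1_risk p q est2 \<mu>)"

definition plug_in ::
  "(real \<Rightarrow> real) \<Rightarrow> (real^'n \<Rightarrow> real^'n) \<Rightarrow> real^'n \<Rightarrow> real^'n \<Rightarrow> real" where
  "plug_in q \<delta> x = spherical q (\<delta> x)"

definition baranchik :: "real \<Rightarrow> (real \<Rightarrow> real) \<Rightarrow> real^'n \<Rightarrow> real^'n" where
  "baranchik a r x = (1 - a * (r ((norm x)\<^sup>2) / (norm x)\<^sup>2)) *\<^sub>R x"

text \<open>The integral of \<open>u\<^sup>e p\<^sub>X(u) F'(\<surd>u / 2)\<close> over \<open>u > 0\<close>, with values in \<open>ennreal\<close> and hence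
  possibly infinite.\<close>

definition radial_moment :: "(real \<Rightarrow> real) \<Rightarrow> (real \<Rightarrow> real) \<Rightarrow> real \<Rightarrow> ennreal" where
  "radial_moment p F' e =
     (\<integral>\<^sup>+u\<in>{0<..}. ennreal (u powr e * p u * F' (sqrt u / 2)) \<partial>lborel)"

end

theory Submission
  imports Defs
begin

text \<open>Notation for this overview: p is the dimension, \<open>t = |X - \<mu>|\<^sup>2\<close>, \<open>T = |X|\<^sup>2\<close>, and u is the
cosine of the angle between \<open>X - \<mu>\<close> and \<open>\<mu>\<close>, so that T is a function of t and u.

Reduction to quadratic loss. Since q is unimodal, \<open>q(|y - \<mu>|\<^sup>2)\<close> is at least \<open>q(|y - d|\<^sup>2)\<close> on
the half-space of points y closer to \<open>\<mu>\<close> than to d, and at most that on the other half-space, so the \<open>L\<^sub>1\<close>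
distance of the two densities is \<open>4 F(|d - \<mu>|/2) - 2\<close> (\<open>l1_loss_eq\<close>). Unimodality also makes F concave on
\<open>[0, \<infinity>)\<close> (\<open>cdf_concave\<close>). The loss is therefore a concave function of \<open>|d - \<mu>|\<^sup>2\<close>, and its tangent
at t bounds the increase of the loss by \<open>F'(\<surd>t/2) / \<surd>t * (|d - \<mu>|\<^sup>2 - t)\<close> (\<open>loss_tangent\<close>). It is
enough to compare quadratic losses when the law of X is reweighted by \<open>F'(\<surd>t/2) / \<surd>t\<close>; the
reweighted law is again spherically symmetric about \<open>\<mu>\<close>.

Quadratic loss. In polar coordinates about \<open>\<mu>\<close> the reweighted law is a product of a law W of t
and the law of u (\<open>polar_decomposition\<close>). Let S(t) be the mean of \<open>r(T)/T\<close> for given t. The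
difference of the quadratic losses is a times \<open>a r(T)\<^sup>2/T - 2 r(T) X\<bullet>(X - \<mu>)/T\<close>. Two facts control
its mean for given t: the mean of \<open>r(T) X\<bullet>(X - \<mu>)/T\<close> is at least \<open>(p-2)/p t S(t)\<close>
(\<open>pull_ge_ratio\<close>), and \<open>t S(t)\<close> is non-decreasing in t (\<open>scaled_ratio_mono\<close>). With \<open>r\<^sup>2 \<le> r\<close> the mean
for given t is at most \<open>(a/t - 2(p-2)/p) t S(t)\<close>. The first factor changes sign once, from plus to
minus, so the integral over t does not decrease when \<open>t S(t)\<close> is frozen at its value at the sign
change; what remains is non-positive exactly by the bound on a (\<open>radial_ratio_le\<close>).

Both facts come down to \<open>J(v)\<close>, the mean of \<open>1/(1 + v\<^sup>2 + 2vu)\<close>, which is the mean of \<open>1/|x|\<^sup>2\<close> over a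
unit sphere whose centre has norm v. This is where \<open>p \<ge> 4\<close> enters, since \<open>1/|x|\<^sup>2\<close> is superharmonic then.
Rotation invariance yields an integration by parts for the law of u (\<open>cosine_law_Basis\<close>), which turns
into a first order linear differential equation for J (\<open>inv_mean_deriv\<close>). Comparison with explicit
rational functions gives \<open>J(v) \<le> 1/(1 + (p-4)/p v\<^sup>2)\<close> and the monotonicity of J on [0,1].

Strictness holds at \<open>\<mu> = 0\<close>: there the mean of \<open>r(T) X\<bullet>(X - \<mu>)/T\<close> equals \<open>t S(t)\<close>, without the
factor \<open>(p-2)/p < 1\<close>, and r is positive on \<open>(0, \<infinity>)\<close> because it is monotone, \<open>r(t)/t\<close> is
non-increasing and r does not vanish identically.\<close>

section \<open>Means of inverse squared distances over a sphere\<close>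

lemma has_real_derivative_integral_bounded:
  fixes f f' :: "real \<Rightarrow> 'a \<Rightarrow> real"
  assumes "finite_measure M" "0 < d"
    and int: "\<And>\<theta>. \<bar>\<theta> - x\<bar> < d \<Longrightarrow> integrable M (f \<theta>)"
    and meas: "f' x \<in> borel_measurable M"
    and deriv: "AE z in M. \<forall>\<theta>. \<bar>\<theta> - x\<bar> < d \<longrightarrow>
      ((\<lambda>\<theta>. f \<theta> z) has_real_derivative f' \<theta> z) (at \<theta>) \<and> \<bar>f' \<theta> z\<bar> \<le> C"
  shows "((\<lambda>\<theta>. \<integral>z. f \<theta> z \<partial>M) has_real_derivative (\<integral>z. f' x z \<partial>M)) (at x)"
proof -
  interpret finite_measure M by fact
  have main: "(\<lambda>i. ((\<integral>z. f (x + X i) z \<partial>M) - (\<integral>z. f x z \<partial>M)) / X i) \<longlonglongrightarrow> (\<integral>z. f' x z \<partial>M)"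
    if X0: "\<And>i. X i \<noteq> 0" and Xd: "\<And>i. \<bar>X i\<bar> < d" and Xlim: "X \<longlonglongrightarrow> 0" for X :: "nat \<Rightarrow> real"
  proof -
    have "(\<lambda>i. \<integral>z. (f (x + X i) z - f x z) / X i \<partial>M) \<longlonglongrightarrow> (\<integral>z. f' x z \<partial>M)"
    proof (rule integral_dominated_convergence[where w="\<lambda>_. C"])
      show "AE z in M. (\<lambda>i. (f (x + X i) z - f x z) / X i) \<longlonglongrightarrow> f' x z"
        using deriv
      proof eventually_elim
        case (elim z)
        then have "((\<lambda>h. (f (x + h) z - f x z) / h) \<longlongrightarrow> f' x z) (at 0)"
          using \<open>0 < d\<close> by (auto simp: DERIV_def)
        then show ?case
          using X0 Xlim by (auto simp: tendsto_at_iff_sequentially o_def)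
      qed
      show "AE z in M. norm ((f (x + X i) z - f x z) / X i) \<le> C" for i
        using deriv
      proof eventually_elim
        case (elim z)
        have "norm (f (x + X i) z - f x z) \<le> C * norm ((x + X i) - x)"
        proof (rule field_differentiable_bound[of "{x-\<bar>X i\<bar>..x+\<bar>X i\<bar>}" "\<lambda>\<theta>. f \<theta> z" "\<lambda>\<theta>. f' \<theta> z"])
          fix \<theta> assume "\<theta> \<in> {x-\<bar>X i\<bar>..x+\<bar>X i\<bar>}"
          then have "\<bar>\<theta> - x\<bar> < d" using Xd[of i] by auto
          then show "((\<lambda>\<theta>. f \<theta> z) has_field_derivative f' \<theta> z) (at \<theta> within {x-\<bar>X i\<bar>..x+\<bar>X i\<bar>})"
            "norm (f' \<theta> z) \<le> C"
            using elim by (auto intro: has_field_derivative_at_within)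
        qed auto
        then show ?case using X0[of i] by (simp add: divide_simps)
      qed
    qed (use int[of "x + X _"] int[of x] Xd \<open>0<d\<close> meas in auto)
    moreover have "(\<integral>z. (f (x + X i) z - f x z) / X i \<partial>M)
        = ((\<integral>z. f (x + X i) z \<partial>M) - (\<integral>z. f x z \<partial>M)) / X i" for i
      using int[of "x + X i"] int[of x] Xd[of i] \<open>0<d\<close> by simp
    ultimately show ?thesis by (simp only:)
  qed
  show ?thesis
    unfolding DERIV_def tendsto_at_iff_sequentially
  proof (intro allI impI)
    fix X :: "nat \<Rightarrow> real"
    assume X: "\<forall>i. X i \<in> UNIV - {0}" "X \<longlonglongrightarrow> 0"
    then obtain N where "\<forall>i\<ge>N. dist (X i) 0 < d"
      using \<open>0<d\<close> unfolding lim_sequentially by blast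
    then have N: "\<And>i. i \<ge> N \<Longrightarrow> \<bar>X i\<bar> < d" by simp
    have "(\<lambda>i. ((\<integral>z. f (x + X (i+N)) z \<partial>M) - (\<integral>z. f x z \<partial>M)) / X (i+N)) \<longlonglongrightarrow> (\<integral>z. f' x z \<partial>M)"
      using X N by (intro main) (auto intro: LIMSEQ_ignore_initial_segment)
    then show "((\<lambda>h. ((\<integral>z. f (x + h) z \<partial>M) - (\<integral>z. f x z \<partial>M)) / h) \<circ> X) \<longlonglongrightarrow> (\<integral>z. f' x z \<partial>M)"
      by (auto simp: o_def dest: LIMSEQ_offset)
  qed
qed

text \<open>The law of the cosine between a fixed unit vector and a uniformly distributed direction in
dimension n. The identity \<open>by_parts\<close> expresses that its density is proportional to
\<open>(1 - u\<^sup>2)\<^bsup>(n-3)/2\<^esup>\<close>, in the form in which rotation invariance delivers it.\<close>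
locale cosine_law = prob_space M for M :: "real measure" +
  fixes n :: nat
  assumes sets_M [measurable_cong]: "sets M = sets borel"
    and AE_bound: "AE u in M. \<bar>u\<bar> \<le> 1"
    and dim: "4 \<le> n"
    and by_parts: "\<And>f f' C. f \<in> borel_measurable borel \<Longrightarrow> f' \<in> borel_measurable borel \<Longrightarrow>
      (\<And>u. \<bar>u\<bar> \<le> 1 \<Longrightarrow> (f has_real_derivative f' u) (at u)) \<Longrightarrow>
      (\<And>u. \<bar>u\<bar> \<le> 1 \<Longrightarrow> \<bar>f u\<bar> \<le> C \<and> \<bar>f' u\<bar> \<le> C) \<Longrightarrow>
      (real n - 1) * (\<integral>u. u * f u \<partial>M) = (\<integral>u. (1 - u\<^sup>2) * f' u \<partial>M)"
begin

text \<open>The mean of \<open>1/|x|\<^sup>2\<close> over a unit sphere whose centre has norm v.\<close>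
definition inv_mean :: "real \<Rightarrow> real" where
  "inv_mean v = (\<integral>u. 1 / (1 + v\<^sup>2 + 2 * v * u) \<partial>M)"

text \<open>Geometrically, a point of the unit sphere about a centre of norm v is at distance at least
\<open>|1 - |v||\<close> from the origin.\<close>
lemma sq_dist_lower: "(1 - \<bar>v\<bar>)\<^sup>2 \<le> 1 + v\<^sup>2 + 2 * v * u" if "\<bar>u\<bar> \<le> 1" for u v :: real
proof -
  have "\<bar>v * u\<bar> \<le> \<bar>v\<bar>" using that by (simp add: abs_mult mult_left_le)
  then have "- \<bar>v\<bar> \<le> v * u" by linarith
  then show ?thesis by (simp add: power2_eq_square algebra_simps)
qed

lemma sq_dist_pos: "0 < 1 + v\<^sup>2 + 2 * v * u" if "\<bar>u\<bar> \<le> 1" "\<bar>v\<bar> < 1" for u v :: real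
  using sq_dist_lower[OF that(1), of v] that(2) 
  by (smt (verit) zero_less_power)

lemma integrable_inv_power: 
  assumes "\<bar>v\<bar> < 1"
  shows "integrable M (\<lambda>u. 1 / (1 + v\<^sup>2 + 2 * v * u) ^ j)"
proof (rule integrable_const_bound[where B="1 / ((1 - \<bar>v\<bar>)\<^sup>2) ^ j"])
  show "AE u in M. norm (1 / (1 + v\<^sup>2 + 2 * v * u) ^ j) \<le> 1 / ((1 - \<bar>v\<bar>)\<^sup>2) ^ j"
    using AE_bound
  proof eventually_elim
    case (elim u)
    have "0 < (1 - \<bar>v\<bar>)\<^sup>2" using assms by simp
    then show ?case using sq_dist_lower[OF elim, of v] sq_dist_pos[OF elim assms]
      by (auto simp: norm_divide norm_power intro!: divide_left_mono power_mono mult_pos_pos)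
  qed
qed simp

text \<open>Let \<open>T = 1 + v\<^sup>2 + 2vu\<close>. The derivative of the mean of 1/T in v is a combination of the means of 1/T
and \<open>1/T\<^sup>2\<close>. Integration by parts against the function 1/T of u gives a second relation between the
same two means, and eliminating the mean of \<open>1/T\<^sup>2\<close> leaves a first order linear equation.\<close>
lemma inv_mean_deriv:
  assumes v: "\<bar>v\<bar> < 1"
  obtains D where "(inv_mean has_real_derivative D) (at v)"
    "v * (1 - v\<^sup>2) * D = (real n - 2) - ((real n - 2) + (real n - 4) * v\<^sup>2) * inv_mean v"
proof -
  define T where "T = (\<lambda>v u. 1 + v\<^sup>2 + 2 * v * u :: real)"
  define d where "d = (1 - \<bar>v\<bar>) / 2"
  have d: "0 < d" using v by (simp add: d_def)
  have near: "\<bar>\<theta>\<bar> < 1 \<and> d \<le> 1 - \<bar>\<theta>\<bar>" if "\<bar>\<theta> - v\<bar> < d" for \<theta>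
  proof -
    have 1: "\<bar>\<theta>\<bar> \<le> \<bar>v\<bar> + \<bar>\<theta> - v\<bar>" by linarith
    have 2: "\<bar>\<theta> - v\<bar> < (1 - \<bar>v\<bar>) / 2" using that by (simp add: d_def)
    have "x < 1 \<and> (1 - p) / 2 \<le> 1 - x" if "x \<le> p + q" "q < (1 - p) / 2" "p < 1" for x p q :: real
      using that by (auto simp: field_simps)
    from this[OF 1 2 v] show ?thesis by (simp add: d_def)
  qed
  have low: "d\<^sup>2 \<le> T \<theta> u" if "\<bar>\<theta> - v\<bar> < d" "\<bar>u\<bar> \<le> 1" for \<theta> u
  proof -
    have "d\<^sup>2 \<le> (1 - \<bar>\<theta>\<bar>)\<^sup>2" using near[OF that(1)] d by (intro power_mono) auto
    then show ?thesis using sq_dist_lower[OF that(2), of \<theta>] by (simp add: T_def)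
  qed
  have M1: "integrable M (\<lambda>u. 1 / T v u)" and M2: "integrable M (\<lambda>u. 1 / (T v u)\<^sup>2)"
    using integrable_inv_power[OF v, of 1] integrable_inv_power[OF v, of 2] by (auto simp: T_def)
  \<comment> \<open>D is the integral of the derivative of 1/T in v; I1 and I2 are the means of 1/T and its square.\<close>
  define D where "D = (\<integral>u. - (2 * v + 2 * u) / (T v u)\<^sup>2 \<partial>M)"
  have Tv: "0 < T v u" if "\<bar>u\<bar> \<le> 1" for u using sq_dist_pos[OF that v] by (simp add: T_def)
  have [measurable]: "T \<theta> \<in> borel_measurable borel" for \<theta> unfolding T_def by measurable
  have 1: "((\<lambda>\<theta>. \<integral>u. 1 / T \<theta> u \<partial>M) has_real_derivative D) (at v)" unfolding D_def
  proof (rule has_real_derivative_integral_bounded[where d=d and C="4 / (d\<^sup>2)\<^sup>2" 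
        and f'="\<lambda>v u. - (2 * v + 2 * u) / (T v u)\<^sup>2"])
    show "integrable M (\<lambda>u. 1 / T \<theta> u)" if "\<bar>\<theta> - v\<bar> < d" for \<theta>
      using integrable_inv_power[of \<theta> 1] near[OF that] by (auto simp: T_def)
    show "AE z in M. \<forall>\<theta>. \<bar>\<theta> - v\<bar> < d \<longrightarrow> ((\<lambda>\<theta>. 1 / T \<theta> z) has_real_derivative - (2 * \<theta> + 2 * z) / (T \<theta> z)\<^sup>2) (at \<theta>) \<and>
               \<bar>- (2 * \<theta> + 2 * z) / (T \<theta> z)\<^sup>2\<bar> \<le> 4 / (d\<^sup>2)\<^sup>2"
      using AE_bound
    proof eventually_elim
      case (elim u)
      show ?case
      proof (intro allI impI conjI)
        fix \<theta> assume \<theta>: "\<bar>\<theta> - v\<bar> < d"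
        have p: "0 < d\<^sup>2" "d\<^sup>2 \<le> T \<theta> u" using low[OF \<theta> elim] d by auto
        then show "((\<lambda>\<theta>. 1 / T \<theta> u) has_real_derivative - (2 * \<theta> + 2 * u) / (T \<theta> u)\<^sup>2) (at \<theta>)"
          unfolding T_def by (auto intro!: derivative_eq_intros simp: power2_eq_square field_simps)
        have "\<bar>- (2 * \<theta> + 2 * u)\<bar> \<le> 4" using near[OF \<theta>] elim by linarith
        moreover have "(d\<^sup>2)\<^sup>2 \<le> (T \<theta> u)\<^sup>2" using p by (intro power_mono) auto
        ultimately show "\<bar>- (2 * \<theta> + 2 * u) / (T \<theta> u)\<^sup>2\<bar> \<le> 4 / (d\<^sup>2)\<^sup>2"
          using p unfolding abs_divide by (intro frac_le) auto
      qed
    qed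
  qed (use d in \<open>auto intro: finite_measure_axioms\<close>)
  have inv: "inv_mean = (\<lambda>\<theta>. \<integral>u. 1 / T \<theta> u \<partial>M)" by (auto simp: inv_mean_def T_def)
  define I1 where "I1 = (\<integral>u. 1 / T v u \<partial>M)"
  define I2 where "I2 = (\<integral>u. 1 / (T v u)\<^sup>2 \<partial>M)"
  have vD: "v * D = (1 - v\<^sup>2) * I2 - I1"
  proof -
    have "v * D = (\<integral>u. (1 - v\<^sup>2) * (1 / (T v u)\<^sup>2) - 1 / T v u \<partial>M)"
      unfolding D_def integral_mult_right_zero[symmetric]
    proof (rule integral_cong_AE, goal_cases)
      case 3
      from AE_bound show ?case
      proof eventually_elim
        case (elim u)
        have eq: "2 * v * u = T v u - 1 - v\<^sup>2" by (simp add: T_def)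
        have "v * (2 * v + 2 * u) = T v u - (1 - v\<^sup>2)" using eq by (simp add: algebra_simps power2_eq_square)
        then have "v * (- (2 * v + 2 * u) / (T v u)\<^sup>2) = (1 - v\<^sup>2 - T v u) / (T v u)\<^sup>2"
          by (metis minus_diff_eq mult_minus_right times_divide_eq_right)
        also have "\<dots> = (1 - v\<^sup>2) * (1 / (T v u)\<^sup>2) - 1 / T v u"
          using Tv[OF elim] by (simp add: field_simps power2_eq_square)
        finally show ?case .
      qed
    qed auto
    then show ?thesis
      by (simp only: Bochner_Integration.integral_diff[OF integrable_mult_right[OF M2] M1] integral_mult_right_zero I1_def I2_def)
  qed
  \<comment> \<open>Integration by parts; its two sides are expressed through I1 and I2 after multiplication by 2v.\<close>
  have bp: "(real n - 1) * (\<integral>u. u * (1 / T v u) \<partial>M) = (\<integral>u. (1 - u\<^sup>2) * (- (2 * v) / (T v u)\<^sup>2) \<partial>M)"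
  proof (rule by_parts[where C="max (1 / d\<^sup>2) (2 / (d\<^sup>2)\<^sup>2)"])
    fix u :: real assume u: "\<bar>u\<bar> \<le> 1"
    have p: "0 < d\<^sup>2" "d\<^sup>2 \<le> T v u" using low[OF _ u, of v] d by auto
    then show "((\<lambda>u. 1 / T v u) has_real_derivative - (2 * v) / (T v u)\<^sup>2) (at u)"
      unfolding T_def by (auto intro!: derivative_eq_intros simp: power2_eq_square field_simps)
    have "(d\<^sup>2)\<^sup>2 \<le> (T v u)\<^sup>2" using p by (intro power_mono) auto
    moreover have "\<bar>- (2 * v)\<bar> \<le> 2" using v by linarith
    ultimately have "\<bar>- (2 * v) / (T v u)\<^sup>2\<bar> \<le> 2 / (d\<^sup>2)\<^sup>2"
      using p unfolding abs_divide by (intro frac_le) auto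
    moreover have "\<bar>1 / T v u\<bar> \<le> 1 / d\<^sup>2" using p by (auto simp: frac_le)
    ultimately show "\<bar>1 / T v u\<bar> \<le> max (1 / d\<^sup>2) (2 / (d\<^sup>2)\<^sup>2) \<and> \<bar>- (2 * v) / (T v u)\<^sup>2\<bar> \<le> max (1 / d\<^sup>2) (2 / (d\<^sup>2)\<^sup>2)"
      by linarith
  qed auto
  have l: "2 * v * (\<integral>u. u * (1 / T v u) \<partial>M) = 1 - (1 + v\<^sup>2) * I1"
  proof -
    have "2 * v * (\<integral>u. u * (1 / T v u) \<partial>M) = (\<integral>u. 1 - (1 + v\<^sup>2) * (1 / T v u) \<partial>M)"
      unfolding integral_mult_right_zero[symmetric]
    proof (rule integral_cong_AE, goal_cases)
      case 3
      from AE_bound show ?case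
      proof eventually_elim
        case (elim u)
        have "2 * v * u = T v u - (1 + v\<^sup>2)" by (simp add: T_def)
        then show ?case using Tv[OF elim] by (simp add: field_simps)
      qed
    qed auto
    then show ?thesis
      by (simp only: Bochner_Integration.integral_diff[OF integrable_const integrable_mult_right[OF M1]] integral_mult_right_zero)
        (simp add: I1_def prob_space)
  qed
  have rr: "2 * v * (\<integral>u. (1 - u\<^sup>2) * (- (2 * v) / (T v u)\<^sup>2) \<partial>M) = 1 - 2 * (1 + v\<^sup>2) * I1 + (1 - v\<^sup>2)\<^sup>2 * I2"
  proof -
    have "2 * v * (\<integral>u. (1 - u\<^sup>2) * (- (2 * v) / (T v u)\<^sup>2) \<partial>M)
      = (\<integral>u. 1 - 2 * (1 + v\<^sup>2) * (1 / T v u) + (1 - v\<^sup>2)\<^sup>2 * (1 / (T v u)\<^sup>2) \<partial>M)"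
      unfolding integral_mult_right_zero[symmetric]
    proof (rule integral_cong_AE, goal_cases)
      case 3
      from AE_bound show ?case
      proof eventually_elim
        case (elim u)
        have "2 * v * ((1 - u\<^sup>2) * (- (2 * v) / (T v u)\<^sup>2)) = ((2 * v * u)\<^sup>2 - 4 * v\<^sup>2) / (T v u)\<^sup>2"
          by (simp add: power2_eq_square minus_divide_left[symmetric] algebra_simps diff_divide_distrib)
        also have "2 * v * u = T v u - (1 + v\<^sup>2)" by (simp add: T_def)
        also have "(T v u - (1 + v\<^sup>2))\<^sup>2 - 4 * v\<^sup>2 = (T v u)\<^sup>2 - 2 * (1 + v\<^sup>2) * T v u + (1 - v\<^sup>2)\<^sup>2"
          by (simp add: power2_eq_square algebra_simps)
        finally have "2 * v * ((1 - u\<^sup>2) * (- (2 * v) / (T v u)\<^sup>2))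
          = ((T v u)\<^sup>2 - 2 * (1 + v\<^sup>2) * T v u + (1 - v\<^sup>2)\<^sup>2) / (T v u)\<^sup>2" .
        moreover have "(X\<^sup>2 - c * X + b) / X\<^sup>2 = 1 - c * (1 / X) + b * (1 / X\<^sup>2)" if "X \<noteq> 0" for X b c :: real
          using that by (simp add: diff_divide_distrib add_divide_distrib power2_eq_square)
        ultimately show ?case using Tv[OF elim] by simp
      qed
    qed auto
    then show ?thesis
      by (simp only: Bochner_Integration.integral_add[OF Bochner_Integration.integrable_diff[OF integrable_const integrable_mult_right[OF M1]] integrable_mult_right[OF M2]]
          Bochner_Integration.integral_diff[OF integrable_const integrable_mult_right[OF M1]] integral_mult_right_zero)
        (simp add: I1_def I2_def prob_space)
  qed
  have "(real n - 1) * (1 - (1 + v\<^sup>2) * I1) = 1 - 2 * (1 + v\<^sup>2) * I1 + (1 - v\<^sup>2)\<^sup>2 * I2"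
    using arg_cong[OF bp, of "\<lambda>x. 2 * v * x"] l rr by (metis mult.left_commute)
  then have e2: "(1 - v\<^sup>2)\<^sup>2 * I2 = (real n - 2) - (real n - 3) * (1 + v\<^sup>2) * I1"
    by (simp add: algebra_simps)
  have "v * (1 - v\<^sup>2) * D = (1 - v\<^sup>2)\<^sup>2 * I2 - (1 - v\<^sup>2) * I1"
    using arg_cong[OF vD, of "\<lambda>x. (1 - v\<^sup>2) * x"] by (simp add: algebra_simps power2_eq_square)
  also have "\<dots> = (real n - 2) - ((real n - 2) + (real n - 4) * v\<^sup>2) * I1"
    unfolding e2 by (simp add: algebra_simps)
  finally have 2: "v * (1 - v\<^sup>2) * D = (real n - 2) - ((real n - 2) + (real n - 4) * v\<^sup>2) * inv_mean v"
    by (simp add: inv I1_def)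
  show thesis using that[of D] 1 2 by (simp add: inv)
qed

text \<open>Comparison of \<open>inv_mean\<close> with a super- or subsolution b of its differential equation
(\<open>\<epsilon> = 1\<close> or \<open>\<epsilon> = -1\<close>). The factor \<open>x\<^bsup>n-2\<^esup> / (1 - x\<^sup>2)\<^bsup>n-3\<^esup>\<close> is the integrating factor: multiplied by it,
\<open>\<epsilon> (b - inv_mean)\<close> has a derivative of the sign of the residual in \<open>sub\<close>, and it vanishes at 0.\<close>
lemma inv_mean_compare:
  fixes b b' :: "real \<Rightarrow> real" and \<epsilon> :: real
  assumes v: "0 < v" "v < 1"
    and b: "\<And>x. 0 \<le> x \<Longrightarrow> x < 1 \<Longrightarrow> (b has_real_derivative b' x) (at x)"
    and sub: "\<And>x. 0 \<le> x \<Longrightarrow> x < 1 \<Longrightarrow>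
       0 \<le> \<epsilon> * (x * (1 - x\<^sup>2) * b' x + ((real n - 2) + (real n - 4) * x\<^sup>2) * b x - (real n - 2))"
  shows "0 \<le> \<epsilon> * (b v - inv_mean v)"
proof -
  \<comment> \<open>With n = k + 4 the exponents n - 2 and n - 3 become natural number terms without subtraction.\<close>
  obtain k where k: "n = k + 4" using dim by (metis add.commute le_Suc_ex)
  define P where "P = (\<lambda>x. \<epsilon> * (x^(k+2) / (1 - x\<^sup>2)^(k+1) * (b x - inv_mean x)))"
  have "P 0 \<le> P v"
  proof (rule DERIV_nonneg_imp_nondecreasing[OF less_imp_le[OF v(1)]])
    fix x assume x: "0 \<le> x" "x \<le> v"
    then have x1: "x < 1" using v by simp
    obtain D where D: "(inv_mean has_real_derivative D) (at x)"
      "x * (1 - x\<^sup>2) * D = (real n - 2) - ((real n - 2) + (real n - 4) * x\<^sup>2) * inv_mean x"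
      using inv_mean_deriv[of x] x x1 by auto
    define y where "y = 1 - x\<^sup>2"
    have y: "0 < y" using x x1 by (simp add: y_def power_less_one_iff abs_square_less_1)
    define E where "E = ((k+2) * x^(k+1) / y^(k+1) + x^(k+2) * ((k+1) * (2 * x)) / y^(k+2))"
    have der: "((\<lambda>x. x^(k+2) / (1 - x\<^sup>2)^(k+1)) has_real_derivative E) (at x)"
    proof -
      have h1: "((\<lambda>x. x^(k+2)) has_real_derivative (k+2) * x^(k+1)) (at x)"
        using DERIV_pow[of "k+2" x] by simp
      have h2: "((\<lambda>x. (1 - x\<^sup>2)^(k+1)) has_real_derivative (k+1) * y^k * (- (2 * x))) (at x)"
      proof -
        have "((\<lambda>x. 1 - x\<^sup>2) has_real_derivative - (2 * x)) (at x)"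
          by (auto intro!: derivative_eq_intros)
        from DERIV_power[OF this, of "k+1"] show ?thesis by (simp add: y_def mult_ac)
      qed
      have "((\<lambda>x. x^(k+2) / (1 - x\<^sup>2)^(k+1)) has_real_derivative
        ((k+2) * x^(k+1) * y^(k+1) - x^(k+2) * ((k+1) * y^k * (- (2 * x)))) / (y^(k+1) * y^(k+1))) (at x)"
        using DERIV_divide[OF h1 h2] y by (simp add: y_def)
      moreover have "((k+2) * x^(k+1) * y^(k+1) - x^(k+2) * ((k+1) * y^k * (- (2 * x)))) / (y^(k+1) * y^(k+1)) = E"
        unfolding E_def using y by (simp add: divide_simps) (simp add: algebra_simps)
      ultimately show ?thesis by simp
    qed
    have Pd: "(P has_real_derivative \<epsilon> * (E * (b x - inv_mean x) + (b' x - D) * (x^(k+2) / y^(k+1)))) (at x)"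
      unfolding P_def y_def
      by (intro DERIV_cmult DERIV_mult der DERIV_diff b D(1)) (use x x1 in auto)
    have "E * (b x - inv_mean x) + (b' x - D) * (x^(k+2) / y^(k+1))
      = x^(k+1) / y^(k+2) * (((k+2) * y + 2 * (k+1) * x\<^sup>2) * (b x - inv_mean x) + x * y * b' x - x * y * D)"
      using y unfolding E_def by (simp add: field_simps power2_eq_square)
    also have "(k+2) * y + 2 * (k+1) * x\<^sup>2 = (real n - 2) + (real n - 4) * x\<^sup>2"
      by (simp add: y_def k algebra_simps)
    also have "x * y * D = (real n - 2) - ((real n - 2) + (real n - 4) * x\<^sup>2) * inv_mean x"
      using D(2) by (simp add: y_def)
    finally have eq: "E * (b x - inv_mean x) + (b' x - D) * (x^(k+2) / y^(k+1))
       = x^(k+1) / y^(k+2) * (x * y * b' x + ((real n - 2) + (real n - 4) * x\<^sup>2) * b x - (real n - 2))"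
      by (simp add: algebra_simps)
    have "0 \<le> x^(k+1) / y^(k+2) * (\<epsilon> * (x * y * b' x + ((real n - 2) + (real n - 4) * x\<^sup>2) * b x - (real n - 2)))"
    proof (rule mult_nonneg_nonneg)
      show "0 \<le> x^(k+1) / y^(k+2)" using x y by simp
    qed (use sub[OF x(1) x1] in \<open>simp add: y_def\<close>)
    then show "\<exists>y. (P has_real_derivative y) (at x) \<and> 0 \<le> y"
      using Pd unfolding eq by (metis mult.left_commute)
  qed
  then have "0 \<le> v^(k+2) / (1 - v\<^sup>2)^(k+1) * (\<epsilon> * (b v - inv_mean v))"
    by (simp add: P_def mult.left_commute)
  moreover have "0 < v^(k+2) / (1 - v\<^sup>2)^(k+1)"
    using v by (intro divide_pos_pos) (auto simp: power_less_one_iff abs_square_less_1)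
  ultimately show ?thesis by (meson linorder_not_le mult_pos_neg)
qed

lemma inv_mean_0: "inv_mean 0 = 1"
  by (simp add: inv_mean_def prob_space)

text \<open>The bound agrees with \<open>inv_mean\<close> to first order in \<open>v\<^sup>2\<close> at 0 and is a supersolution.\<close>
lemma inv_mean_upper:
  assumes v: "0 \<le> v" "v < 1"
  shows "inv_mean v \<le> 1 / (1 + (real n - 4) / real n * v\<^sup>2)"
proof (cases "v = 0")
  case False
  define \<kappa> where "\<kappa> = (real n - 4) / real n"
  have \<kappa>: "0 \<le> \<kappa>" "\<kappa> \<le> 1" and n\<kappa>: "real n * \<kappa> = real n - 4" using dim by (auto simp: \<kappa>_def)
  have pos: "0 < 1 + \<kappa> * x\<^sup>2" for x using \<kappa> by (simp add: add_pos_nonneg)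
  have v0: "0 < v" using v False by simp
  have "0 \<le> 1 * (1 / (1 + \<kappa> * v\<^sup>2) - inv_mean v)"
  proof (rule inv_mean_compare[OF v0 v(2), where b'="\<lambda>x. - (2 * \<kappa> * x) / (1 + \<kappa> * x\<^sup>2)\<^sup>2"])
    fix x :: real assume x: "0 \<le> x" "x < 1"
    show "((\<lambda>a. 1 / (1 + \<kappa> * a\<^sup>2)) has_real_derivative - (2 * \<kappa> * x) / (1 + \<kappa> * x\<^sup>2)\<^sup>2) (at x)"
      using pos[of x] by (auto intro!: derivative_eq_intros simp: power2_eq_square)
    have "x * (1 - x\<^sup>2) * (- (2 * \<kappa> * x) / (1 + \<kappa> * x\<^sup>2)\<^sup>2) + ((real n - 2) + real n * \<kappa> * x\<^sup>2) * (1 / (1 + \<kappa> * x\<^sup>2)) - (real n - 2)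
       = (2 * \<kappa> * x\<^sup>2 * (1 + \<kappa> * x\<^sup>2) - 2 * \<kappa> * x\<^sup>2 * (1 - x\<^sup>2)) / (1 + \<kappa> * x\<^sup>2)\<^sup>2"
      using pos[of x] by (simp add: divide_simps power2_eq_square) (simp add: algebra_simps)
    also have "\<dots> = 2 * \<kappa> * x\<^sup>2 * (\<kappa> * x\<^sup>2 + x\<^sup>2) / (1 + \<kappa> * x\<^sup>2)\<^sup>2" by (simp add: algebra_simps)
    also have "\<dots> \<ge> 0" using \<kappa> by simp
    finally show "0 \<le> 1 * (x * (1 - x\<^sup>2) * (- (2 * \<kappa> * x) / (1 + \<kappa> * x\<^sup>2)\<^sup>2) + ((real n - 2) + (real n - 4) * x\<^sup>2) * (1 / (1 + \<kappa> * x\<^sup>2)) - (real n - 2))"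
      by (simp add: n\<kappa>)
  qed
  then show ?thesis by (simp add: \<kappa>_def)
qed (simp add: inv_mean_0)

text \<open>This function of v makes the right hand side of the differential equation vanish. It is decreasing, which
makes it a subsolution, and lying above it means that \<open>inv_mean\<close> is itself non-increasing.\<close>
lemma inv_mean_lower:
  assumes v: "0 \<le> v" "v < 1"
  shows "(real n - 2) / ((real n - 2) + (real n - 4) * v\<^sup>2) \<le> inv_mean v"
proof (cases "v = 0")
  case False
  define N where "N = (\<lambda>x. (real n - 2) + (real n - 4) * x\<^sup>2)"
  have N: "0 < N x" for x using dim unfolding N_def by (intro add_pos_nonneg) auto
  have v0: "0 < v" using v False by simp
  have "0 \<le> (-1) * ((real n - 2) / N v - inv_mean v)"
  proof (rule inv_mean_compare[OF v0 v(2), where b'="\<lambda>x. - ((real n - 2) * (2 * (real n - 4) * x)) / (N x)\<^sup>2"])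
    fix x :: real assume x: "0 \<le> x" "x < 1"
    show "((\<lambda>a. (real n - 2) / N a) has_real_derivative - ((real n - 2) * (2 * (real n - 4) * x)) / (N x)\<^sup>2) (at x)"
      using N[of x] unfolding N_def by (auto intro!: derivative_eq_intros simp: power2_eq_square)
    have A0: "0 \<le> x * (1 - x\<^sup>2) * (((real n - 2) * (2 * (real n - 4) * x)) / (N x)\<^sup>2)"
      using x dim by (intro mult_nonneg_nonneg divide_nonneg_nonneg) (auto simp: abs_square_le_1)
    have e1: "x * (1 - x\<^sup>2) * (- ((real n - 2) * (2 * (real n - 4) * x)) / (N x)\<^sup>2)
      = - (x * (1 - x\<^sup>2) * (((real n - 2) * (2 * (real n - 4) * x)) / (N x)\<^sup>2))" by simp
    have Nx: "(real n - 2) + (real n - 4) * x\<^sup>2 = N x" by (simp add: N_def)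
    have e2: "N x * ((real n - 2) / N x) = real n - 2" using N[of x] by simp
    show "0 \<le> (-1) * (x * (1 - x\<^sup>2) * (- ((real n - 2) * (2 * (real n - 4) * x)) / (N x)\<^sup>2) + ((real n - 2) + (real n - 4) * x\<^sup>2) * ((real n - 2) / N x) - (real n - 2))"
      unfolding Nx e1 e2 using A0 by simp
  qed
  then show ?thesis by (simp add: N_def)
qed (use dim in \<open>simp add: inv_mean_0\<close>)

lemma inv_mean_antimono:
  assumes "0 \<le> v" "v \<le> w" "w < 1"
  shows "inv_mean w \<le> inv_mean v"
proof (rule DERIV_nonpos_imp_decreasing_open[OF assms(2)])
  fix x assume x: "v < x" "x < w"
  then have x01: "0 < x" "x < 1" using assms by auto
  obtain D where D: "(inv_mean has_real_derivative D) (at x)"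
    "x * (1 - x\<^sup>2) * D = (real n - 2) - ((real n - 2) + (real n - 4) * x\<^sup>2) * inv_mean x"
    using inv_mean_deriv[of x] x01 by auto
  have N: "0 < (real n - 2) + (real n - 4) * x\<^sup>2" using dim by (intro add_pos_nonneg) auto
  have "x * (1 - x\<^sup>2) * D \<le> 0" unfolding D(2) using inv_mean_lower[of x] x01 N by (simp add: field_simps)
  moreover have "0 < x * (1 - x\<^sup>2)" using x01 by (simp add: abs_square_less_1)
  ultimately have "D \<le> 0" by (meson linorder_not_le mult_pos_pos)
  then show "\<exists>y. (inv_mean has_real_derivative y) (at x) \<and> y \<le> 0" using D by auto
next
  show "continuous_on {v..w} inv_mean"
  proof (intro continuous_at_imp_continuous_on ballI)
    fix x assume "x \<in> {v..w}"
    then show "isCont inv_mean x" using inv_mean_deriv[of x] assms by (auto intro: DERIV_isCont)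
  qed
qed


text \<open>At \<open>u = -1\<close> the integrand of \<open>inv_mean v\<close> is \<open>1/(1 - v)\<^sup>2\<close>, while \<open>inv_mean v \<le> 1\<close>. Letting v tend to 1 shows
that the antipode carries no mass, so that the squared distances below vanish with probability zero only.\<close>
lemma antipode_mass_le:
  assumes "0 \<le> v" "v < 1"
  shows "measure M {-1} \<le> (1 - v)\<^sup>2"
proof -
  have "(\<integral>u. indicator {-1} u / (1 - v)\<^sup>2 \<partial>M) \<le> inv_mean v"
    unfolding inv_mean_def
  proof (rule integral_mono_AE)
    show "AE u in M. indicator {-1} u / (1 - v)\<^sup>2 \<le> 1 / (1 + v\<^sup>2 + 2 * v * u)"
      using AE_bound
    proof eventually_elim
      case (elim u)
      then show ?case using sq_dist_pos[OF elim, of v] assms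
        by (cases "u = -1") (auto simp: power2_eq_square algebra_simps)
    qed
    show "integrable M (\<lambda>u. 1 / (1 + v\<^sup>2 + 2 * v * u))" using integrable_inv_power[of v 1] assms by simp
    show "integrable M (\<lambda>u. indicator {-1} u / (1 - v)\<^sup>2)" by (rule integrable_const_bound[where B="1 / (1 - v)\<^sup>2"]) (auto split: split_indicator)
  qed
  also have "inv_mean v \<le> 1"
    using inv_mean_antimono[of 0 v] assms by (simp add: inv_mean_0)
  finally show ?thesis using assms
    by (simp add: sets_M sets_eq_imp_space_eq[OF sets_M] field_simps)
qed

lemma AE_not_antipode: "AE u in M. u \<noteq> -1"
proof -
  define q where "q = measure M {-1}"
  have "q = 0"
  proof (rule ccontr)
    assume "q \<noteq> 0"
    then have q: "0 < q" "q \<le> 1" by (auto simp: q_def prob_le_1 zero_less_measure_iff)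
    have "measure M {-1} \<le> (1 - (1 - q/2))\<^sup>2" by (rule antipode_mass_le) (use q in auto)
    then have "q \<le> (q/2)\<^sup>2" unfolding q_def[symmetric] by simp
    also have "\<dots> \<le> q / 4" using q by (simp add: power2_eq_square mult_left_le)
    finally show False using q by simp
  qed
  then have "{-1} \<in> null_sets M" by (auto simp: q_def sets_M emeasure_eq_measure null_sets_def)
  then show ?thesis using AE_not_in[of "{-1}" M] by simp
qed

text \<open>Fatou's lemma along \<open>v \<rightarrow> 1\<close>. A sphere through the origin is the only one on which \<open>1/|x|\<^sup>2\<close> is unbounded.\<close>
lemma inv_mean_at_1:
  shows "integrable M (\<lambda>u. 1 / (1 + 1\<^sup>2 + 2 * 1 * u))"
    and "\<And>w. 0 \<le> w \<Longrightarrow> w < 1 \<Longrightarrow> inv_mean 1 \<le> inv_mean w"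
proof -
  define V :: "nat \<Rightarrow> real" where "V = (\<lambda>i. 1 - 1 / (real i + 2))"
  have V: "0 \<le> V i" "V i < 1" for i by (auto simp: V_def field_simps)
  have Vlim: "V \<longlonglongrightarrow> 1" unfolding V_def by real_asymp
  have nn: "(\<integral>\<^sup>+u. ennreal (1 / (1 + 1\<^sup>2 + 2 * 1 * u)) \<partial>M) \<le> ennreal (inv_mean w)" if w: "0 \<le> w" "w < 1" for w
  proof -
    have "(\<integral>\<^sup>+u. ennreal (1 / (1 + 1\<^sup>2 + 2 * 1 * u)) \<partial>M) \<le> (\<integral>\<^sup>+u. liminf (\<lambda>i. ennreal (1 / (1 + (V i)\<^sup>2 + 2 * V i * u))) \<partial>M)"
    proof (rule nn_integral_mono_AE)
      show "AE u in M. ennreal (1 / (1 + 1\<^sup>2 + 2 * 1 * u)) \<le> liminf (\<lambda>i. ennreal (1 / (1 + (V i)\<^sup>2 + 2 * V i * u)))"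
        using AE_bound AE_not_antipode
      proof eventually_elim
        case (elim u)
        then have "(\<lambda>i. ennreal (1 / (1 + (V i)\<^sup>2 + 2 * V i * u))) \<longlonglongrightarrow> ennreal (1 / (1 + 1\<^sup>2 + 2 * 1 * u))"
          by (intro tendsto_intros Vlim) auto
        then show ?case by (simp add: lim_imp_Liminf)
      qed
    qed
    also have "\<dots> \<le> liminf (\<lambda>i. \<integral>\<^sup>+u. ennreal (1 / (1 + (V i)\<^sup>2 + 2 * V i * u)) \<partial>M)"
      by (rule nn_integral_liminf) simp
    also have "\<dots> = liminf (\<lambda>i. ennreal (inv_mean (V i)))"
    proof -
      have "(\<integral>\<^sup>+u. ennreal (1 / (1 + (V i)\<^sup>2 + 2 * V i * u)) \<partial>M) = ennreal (inv_mean (V i))" for i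
        unfolding inv_mean_def
      proof (rule nn_integral_eq_integral)
        show "integrable M (\<lambda>u. 1 / (1 + (V i)\<^sup>2 + 2 * V i * u))" using integrable_inv_power[of "V i" 1] V[of i] by simp
        show "AE u in M. 0 \<le> 1 / (1 + (V i)\<^sup>2 + 2 * V i * u)" using AE_bound
        proof eventually_elim
          case (elim u)
          then show ?case using sq_dist_pos[OF elim, of "V i"] V[of i] by simp
        qed
      qed
      then show ?thesis by simp
    qed
    also have "\<dots> \<le> limsup (\<lambda>i. ennreal (inv_mean (V i)))" by (rule Liminf_le_Limsup) simp
    also have "\<dots> \<le> ennreal (inv_mean w)"
    proof (rule Limsup_bounded)
      have "\<forall>\<^sub>F i in sequentially. w < V i" using Vlim w(2) by (rule order_tendstoD)
      then show "\<forall>\<^sub>F i in sequentially. ennreal (inv_mean (V i)) \<le> ennreal (inv_mean w)"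
        by eventually_elim (auto intro!: ennreal_leI inv_mean_antimono simp: w V)
    qed
    finally show ?thesis .
  qed
  have nonneg: "AE u in M. 0 \<le> 1 / (1 + 1\<^sup>2 + 2 * 1 * u)" using AE_bound by eventually_elim auto
  show int: "integrable M (\<lambda>u. 1 / (1 + 1\<^sup>2 + 2 * 1 * u))"
    using nn[of 0] nonneg by (intro integrableI_nonneg) (auto intro: le_less_trans)
  fix w :: real assume w: "0 \<le> w" "w < 1"
  have "0 \<le> inv_mean w" unfolding inv_mean_def 
  proof (rule integral_nonneg_AE)
    show "AE u in M. 0 \<le> 1 / (1 + w\<^sup>2 + 2 * w * u)" using AE_bound
      by eventually_elim (use sq_dist_pos[of _ w] w in \<open>auto intro: less_imp_le\<close>)
  qed
  with nn[OF w] show "inv_mean 1 \<le> inv_mean w"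
    unfolding nn_integral_eq_integral[OF int nonneg] inv_mean_def[of 1, symmetric] by simp
qed

lemma inv_mean_integrable: "integrable M (\<lambda>u. 1 / (1 + v\<^sup>2 + 2 * v * u))" if "0 \<le> v" "v \<le> 1" for v
  using that inv_mean_at_1(1) integrable_inv_power[of v 1] by (cases "v = 1") auto

lemma inv_mean_antimono_closed: "inv_mean w \<le> inv_mean v" if "0 \<le> v" "v \<le> w" "w \<le> 1" for v w
  using that inv_mean_at_1(2)[of v] inv_mean_antimono[of v w] by (cases "w = 1"; cases "v = 1") auto

lemma inv_mean_upper_closed: 
  assumes "0 \<le> v" "v \<le> 1" shows "inv_mean v \<le> 1 / (1 + (real n - 4) / real n * v\<^sup>2)"
proof (cases "v = 1")
  case True
  have k: "0 \<le> (real n - 4) / real n" using dim by simp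
  have "(\<lambda>i. 1 / (1 + (real n - 4) / real n * (1 - 1 / (real i + 2))\<^sup>2)) \<longlonglongrightarrow> 1 / (1 + (real n - 4) / real n * 1\<^sup>2)"
  proof (rule tendsto_divide[OF tendsto_const])
    show "1 + (real n - 4) / real n * 1\<^sup>2 \<noteq> 0" using k unfolding power_one mult_1_right by linarith
    have "(\<lambda>i. (1 - 1 / (real i + 2))) \<longlonglongrightarrow> 1" by real_asymp
    then show "(\<lambda>i. 1 + (real n - 4) / real n * (1 - 1 / (real i + 2))\<^sup>2) \<longlonglongrightarrow> 1 + (real n - 4) / real n * 1\<^sup>2"
      by (intro tendsto_intros)
  qed
  moreover have "inv_mean 1 \<le> 1 / (1 + (real n - 4) / real n * (1 - 1 / (real i + 2))\<^sup>2)" for i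
  proof -
    have "0 \<le> 1 - 1 / (real i + 2)" "1 - 1 / (real i + 2) < 1" by (auto simp: field_simps)
    then show ?thesis using inv_mean_at_1(2) inv_mean_upper order_trans by blast
  qed
  ultimately show ?thesis using True by (auto intro: LIMSEQ_le_const)
qed (use assms inv_mean_upper in auto)

text \<open>The squared norm of a point at squared distance t from a centre of norm m, where u is the cosine of the
angle between the displacement and the centre.\<close>
definition sq_norm :: "real \<Rightarrow> real \<Rightarrow> real \<Rightarrow> real" where
  "sq_norm m t u = m\<^sup>2 + t + 2 * m * sqrt t * u"

lemma sq_norm_far: "sq_norm m t u = t * (1 + (m / sqrt t)\<^sup>2 + 2 * (m / sqrt t) * u)" if "0 < t"
  using that real_sqrt_mult_self[of t] by (simp add: sq_norm_def field_simps power_divide)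

lemma sq_norm_near: "sq_norm m t u = m\<^sup>2 * (1 + (sqrt t / m)\<^sup>2 + 2 * (sqrt t / m) * u)" if "0 < m" "0 < t"
  using that by (simp add: sq_norm_def field_simps power2_eq_square power_divide)

lemma sq_norm_AE_pos:
  assumes "0 \<le> m" "0 < t" shows "AE u in M. 0 < sq_norm m t u"
  using AE_bound AE_not_antipode
proof eventually_elim
  case (elim u)
  have eq: "sq_norm m t u = (m - sqrt t)\<^sup>2 + 2 * m * sqrt t * (1 + u)"
    using assms by (simp add: sq_norm_def power2_eq_square algebra_simps)
  show ?case
  proof (cases "m = 0")
    case False
    then have "0 < 2 * m * sqrt t * (1 + u)" using assms elim by (intro mult_pos_pos) auto
    then show ?thesis unfolding eq by (simp add: add_nonneg_pos)
  qed (use assms in \<open>simp add: sq_norm_def\<close>)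
qed

lemma inv_mean_nonneg: "0 \<le> inv_mean v"
  unfolding inv_mean_def
proof (rule integral_nonneg_AE)
  show "AE u in M. 0 \<le> 1 / (1 + v\<^sup>2 + 2 * v * u)" using AE_bound
  proof eventually_elim
    case (elim u)
    have "0 \<le> 1 + v\<^sup>2 + 2 * v * u" using sq_dist_lower[OF elim, of v] by (rule order_trans[rotated]) simp
    then show ?case by simp
  qed
qed

text \<open>Scaling reduces a sphere of radius \<open>\<surd>t\<close> about a centre of norm m to \<open>inv_mean\<close>: divide by \<open>\<surd>t\<close> if \<open>m \<le> \<surd>t\<close>,
and exchange the roles of m and \<open>\<surd>t\<close> otherwise, since \<open>sq_norm\<close> is symmetric in them. The bounds are
products because the weight \<open>m\<^sup>2 + (n-4)/n t\<close> is 0 for \<open>m = 0\<close> and \<open>n = 4\<close>.\<close>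
lemma inv_sq_norm:
  assumes m: "0 \<le> m" and t: "0 < t"
  shows integrable_inv_sq_norm: "integrable M (\<lambda>u. 1 / sq_norm m t u)"
    and inv_sq_norm_weighted: "(m\<^sup>2 + (real n - 4) / real n * t) * (\<integral>u. 1 / sq_norm m t u \<partial>M) \<le> 1"
    and inv_sq_norm_max: "max (m\<^sup>2) t * (\<integral>u. 1 / sq_norm m t u \<partial>M) \<le> 1"
proof -
  define \<kappa> where "\<kappa> = (real n - 4) / real n"
  have \<kappa>: "0 \<le> \<kappa>" "\<kappa> \<le> 1" using dim by (auto simp: \<kappa>_def)
  \<comment> \<open>R is the larger of the two squared lengths and v the quotient of the smaller length by the larger.\<close>
  have main: "integrable M (\<lambda>u. 1 / sq_norm m t u) \<and>
      (m\<^sup>2 + \<kappa> * t) * (\<integral>u. 1 / sq_norm m t u \<partial>M) \<le> 1 \<and> max (m\<^sup>2) t * (\<integral>u. 1 / sq_norm m t u \<partial>M) \<le> 1"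
    if R: "0 < R" "max (m\<^sup>2) t = R" "m\<^sup>2 + \<kappa> * t \<le> R * (1 + \<kappa> * v\<^sup>2)" and v: "0 \<le> v" "v \<le> 1"
      and eq: "\<And>u. sq_norm m t u = R * (1 + v\<^sup>2 + 2 * v * u)" for R v
  proof -
    have eq': "1 / sq_norm m t u = (1 / R) * (1 / (1 + v\<^sup>2 + 2 * v * u))" for u by (simp add: eq)
    have val: "(\<integral>u. 1 / sq_norm m t u \<partial>M) = (1 / R) * inv_mean v"
      unfolding eq' inv_mean_def by (rule integral_mult_right_zero)
    have "(m\<^sup>2 + \<kappa> * t) * ((1 / R) * inv_mean v) \<le> R * (1 + \<kappa> * v\<^sup>2) * ((1 / R) * inv_mean v)"
      using R inv_mean_nonneg[of v] by (intro mult_right_mono) auto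
    also have "\<dots> = (1 + \<kappa> * v\<^sup>2) * inv_mean v" using R by simp
    also have "\<dots> \<le> 1"
      using inv_mean_upper_closed[OF v] \<kappa> 
      by (simp add: \<kappa>_def[symmetric] field_simps add_pos_nonneg)
    finally have 1: "(m\<^sup>2 + \<kappa> * t) * ((1 / R) * inv_mean v) \<le> 1" .
    have "inv_mean v \<le> 1" using inv_mean_antimono_closed[of 0 v] v by (simp add: inv_mean_0)
    then have "max (m\<^sup>2) t * ((1 / R) * inv_mean v) \<le> 1" using R by simp
    moreover have "integrable M (\<lambda>u. 1 / sq_norm m t u)" unfolding eq'
      using inv_mean_integrable[OF v] by (rule integrable_mult_right)
    ultimately show ?thesis using 1 val by simp
  qed
  have "integrable M (\<lambda>u. 1 / sq_norm m t u) \<and>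
      (m\<^sup>2 + \<kappa> * t) * (\<integral>u. 1 / sq_norm m t u \<partial>M) \<le> 1 \<and> max (m\<^sup>2) t * (\<integral>u. 1 / sq_norm m t u \<partial>M) \<le> 1"
  proof (cases "m\<^sup>2 \<le> t")
    case True
    have "0 \<le> (1 - \<kappa>) * (t - m\<^sup>2)" using \<kappa> True by simp
    then have "m\<^sup>2 + \<kappa> * t \<le> t * (1 + \<kappa> * (m / sqrt t)\<^sup>2)" using t by (simp add: power_divide algebra_simps)
    then show ?thesis using True m t real_le_rsqrt[OF True]
      by (intro main[of t "m / sqrt t"]) (auto simp: sq_norm_far)
  next
    case False
    then have m0: "0 < m" using m t by (cases "m = 0") auto
    have "m\<^sup>2 + \<kappa> * t \<le> m\<^sup>2 * (1 + \<kappa> * (sqrt t / m)\<^sup>2)" using t m0 by (simp add: power_divide algebra_simps)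
    moreover have "sqrt t \<le> m" using False m by (simp add: real_le_lsqrt t)
    ultimately show ?thesis using False m0 t
      by (intro main[of "m\<^sup>2" "sqrt t / m"]) (auto simp: sq_norm_near)
  qed
  then show "integrable M (\<lambda>u. 1 / sq_norm m t u)"
    "(m\<^sup>2 + (real n - 4) / real n * t) * (\<integral>u. 1 / sq_norm m t u \<partial>M) \<le> 1"
    "max (m\<^sup>2) t * (\<integral>u. 1 / sq_norm m t u \<partial>M) \<le> 1" by (auto simp: \<kappa>_def)
qed

end

section \<open>Quadratic risk of Baranchik shrinkage at a fixed radius\<close>

locale shrinkage = cosine_law +
  fixes r :: "real \<Rightarrow> real"
  assumes r_measurable [measurable]: "r \<in> borel_measurable borel"
    and r_nonneg: "0 \<le> r t" and r_le_1: "r t \<le> 1"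
    and r_mono: "s \<le> t \<Longrightarrow> r s \<le> r t"
    and r_ratio: "0 < s \<Longrightarrow> s \<le> t \<Longrightarrow> r t / t \<le> r s / s"
begin

lemma sq_norm_measurable [measurable]: "(\<lambda>(t,u). sq_norm m t u) \<in> borel_measurable (borel \<Otimes>\<^sub>M borel)"
  "sq_norm m t \<in> borel_measurable borel"
  unfolding sq_norm_def by measurable

text \<open>The mean of \<open>r(|X|\<^sup>2)/|X|\<^sup>2\<close> over the sphere \<open>|X - \<mu>|\<^sup>2 = t\<close>, where \<open>|\<mu>| = m\<close>.\<close>
definition ratio_mean :: "real \<Rightarrow> real \<Rightarrow> real" where
  "ratio_mean m t = (\<integral>u. r (sq_norm m t u) / sq_norm m t u \<partial>M)"

text \<open>The mean of \<open>r(|X|\<^sup>2) X\<bullet>(X - \<mu>)/|X|\<^sup>2\<close> over the same sphere, as \<open>2 X\<bullet>(X - \<mu>) = |X|\<^sup>2 + t - m\<^sup>2\<close>.\<close>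
definition pull_mean :: "real \<Rightarrow> real \<Rightarrow> real" where
  "pull_mean m t = (\<integral>u. r (sq_norm m t u) * (sq_norm m t u + t - m\<^sup>2) / (2 * sq_norm m t u) \<partial>M)"

lemma integrable_ratio:
  assumes "0 \<le> m" "0 < t" and [measurable]: "g \<in> borel_measurable borel" and g: "\<And>u. \<bar>g u\<bar> \<le> 1"
  shows "integrable M (\<lambda>u. g u / sq_norm m t u)"
proof (rule Bochner_Integration.integrable_bound[OF integrable_inv_sq_norm[OF assms(1,2)]])
  show "AE u in M. norm (g u / sq_norm m t u) \<le> norm (1 / sq_norm m t u)"
    using g by (auto simp: divide_right_mono)
qed simp

lemma r_abs: "\<bar>r t\<bar> \<le> 1" using r_nonneg[of t] r_le_1[of t] by simp

lemma integrable_r_ratio: "0 \<le> m \<Longrightarrow> 0 < t \<Longrightarrow> integrable M (\<lambda>u. r (sq_norm m t u) / sq_norm m t u)"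
  by (rule integrable_ratio) (auto simp: r_abs)

lemma integrable_r_sq_norm: "integrable M (\<lambda>u. r (sq_norm m t u))"
  by (rule integrable_const_bound[where B=1]) (auto simp: r_abs)

lemma pull_decomp: 
  assumes "0 \<le> m" "0 < t"
  shows "AE u in M. r (sq_norm m t u) * (sq_norm m t u + t - m\<^sup>2) / (2 * sq_norm m t u)
     = r (sq_norm m t u) / 2 + (t - m\<^sup>2) / 2 * (r (sq_norm m t u) / sq_norm m t u)"
  using sq_norm_AE_pos[OF assms] by eventually_elim (simp add: field_simps)

text \<open>With \<open>T = |X|\<^sup>2\<close> and \<open>K = m\<^sup>2 + (n-4)/n t\<close>, the difference of the two sides is the mean of
\<open>r(T) (T - K)/(2T)\<close>. Since r and \<open>T - K\<close> increase together, r(T) may be replaced by r(K), and the mean of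
\<open>(T - K)/(2T)\<close> is non-negative because K times the mean of 1/T is at most 1.\<close>
lemma pull_ge_ratio:
  assumes m: "0 \<le> m" and t: "0 < t"
  shows "(real n - 2) / real n * (t * ratio_mean m t) \<le> pull_mean m t"
proof -
  define c where "c = (real n - 2) / real n"
  define K where "K = m\<^sup>2 + (real n - 4) / real n * t"
  have Kc: "t - m\<^sup>2 - 2 * c * t = - K" using dim by (simp add: K_def c_def field_simps)
  let ?T = "sq_norm m t"
  have int1: "integrable M (\<lambda>u. r (?T u) / 2 + (- K / 2) * (r (?T u) / ?T u))"
    using integrable_r_ratio[OF m t] integrable_r_sq_norm[of m t]
    by (intro Bochner_Integration.integrable_add integrable_mult_right) auto
  have int2: "integrable M (\<lambda>u. r K * (1 / 2 + (- K / 2) * (1 / ?T u)))"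
    using integrable_inv_sq_norm[OF m t]
    by (intro Bochner_Integration.integrable_add integrable_mult_right) auto
  have "0 \<le> r K * (1 / 2 - K / 2 * (\<integral>u. 1 / ?T u \<partial>M))"
    using inv_sq_norm_weighted[OF m t] r_nonneg[of K] by (intro mult_nonneg_nonneg) (auto simp: K_def)
  also have "\<dots> = (\<integral>u. r K * (1 / 2 + (- K / 2) * (1 / ?T u)) \<partial>M)"
    by (simp only: integral_mult_right_zero prob_space integral_const
        Bochner_Integration.integral_add[OF integrable_const integrable_mult_right[OF integrable_inv_sq_norm[OF m t]]]) (simp add: prob_space)
  also have "\<dots> \<le> (\<integral>u. r (?T u) / 2 + (- K / 2) * (r (?T u) / ?T u) \<partial>M)"
  proof (rule integral_mono_AE[OF int2 int1])
    show "AE u in M. r K * (1 / 2 + (- K / 2) * (1 / ?T u)) \<le> r (?T u) / 2 + (- K / 2) * (r (?T u) / ?T u)"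
      using sq_norm_AE_pos[OF m t]
    proof eventually_elim
      case (elim u)
      have "0 \<le> (r (?T u) - r K) * (?T u - K)"
        using r_mono[of "?T u" K] r_mono[of K "?T u"] by (cases "?T u \<le> K") (auto intro: mult_nonneg_nonneg mult_nonpos_nonpos)
      then have "0 \<le> (r (?T u) - r K) * (?T u - K) / (2 * ?T u)" using elim by simp
      also have "\<dots> = r (?T u) / 2 + (- K / 2) * (r (?T u) / ?T u) - r K * (1 / 2 + (- K / 2) * (1 / ?T u))"
        using elim by (simp add: field_simps)
      finally show ?case by simp
    qed
  qed
  also have "\<dots> = (\<integral>u. r (?T u) / 2 + (t - m\<^sup>2) / 2 * (r (?T u) / ?T u) - c * t * (r (?T u) / ?T u) \<partial>M)"
  proof -
    have "x + (- K / 2) * y = x + (t - m\<^sup>2) / 2 * y - c * t * y" for x y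
      using arg_cong[OF Kc, of "\<lambda>z. z * y / 2"] by (simp add: field_simps)
    then show ?thesis by (simp only:)
  qed
  also have "\<dots> = (\<integral>u. r (?T u) / 2 + (t - m\<^sup>2) / 2 * (r (?T u) / ?T u) \<partial>M) - c * t * ratio_mean m t"
    unfolding ratio_mean_def
    by (subst Bochner_Integration.integral_diff)
      (use integrable_r_ratio[OF m t] integrable_r_sq_norm[of m t] in
        \<open>auto simp del: times_divide_eq_right times_divide_eq_left intro!: Bochner_Integration.integrable_add integrable_mult_right\<close>)
  also have "(\<integral>u. r (?T u) / 2 + (t - m\<^sup>2) / 2 * (r (?T u) / ?T u) \<partial>M) = pull_mean m t"
    unfolding pull_mean_def by (rule integral_cong_AE) (use pull_decomp[OF m t] in auto)
  finally show ?thesis by (simp add: c_def)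
qed

text \<open>For spheres that do not enclose the origin the monotonicity holds point by point. As the radius grows, \<open>t/T\<close>
increases in a fixed direction; if T increases as well, so does r(T), and if T decreases, r(T)/T increases.\<close>
lemma scaled_ratio_mono_near:
  assumes m: "0 \<le> m" and st: "0 < s" "s \<le> t" "t \<le> m\<^sup>2"
  shows "s * ratio_mean m s \<le> t * ratio_mean m t"
proof -
  have t: "0 < t" using st by simp
  have "(\<integral>u. s * (r (sq_norm m s u) / sq_norm m s u) \<partial>M) \<le> (\<integral>u. t * (r (sq_norm m t u) / sq_norm m t u) \<partial>M)"
  proof (rule integral_mono_AE)
    show "AE u in M. s * (r (sq_norm m s u) / sq_norm m s u) \<le> t * (r (sq_norm m t u) / sq_norm m t u)"
      using sq_norm_AE_pos[OF m st(1)] sq_norm_AE_pos[OF m t] AE_bound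
    proof eventually_elim
      case (elim u)
      define v w where "v = m / sqrt s" and "w = m / sqrt t"
      have "1 \<le> w" using st(3) m t by (simp add: w_def real_le_lsqrt)
      moreover have "w \<le> v" using st m unfolding v_def w_def by (intro divide_left_mono) auto
      ultimately have "0 \<le> (v - w) * (v + w + 2 * u)" using elim by (intro mult_nonneg_nonneg) auto
      then have "1 + w\<^sup>2 + 2 * w * u \<le> 1 + v\<^sup>2 + 2 * v * u" by (simp add: power2_eq_square algebra_simps)
      then have le: "sq_norm m t u / t \<le> sq_norm m s u / s"
        using t st(1) by (simp add: sq_norm_far v_def w_def)
      show ?case
      proof (cases "sq_norm m s u \<le> sq_norm m t u")
        case True
        have "r (sq_norm m s u) * (s / sq_norm m s u) \<le> r (sq_norm m t u) * (t / sq_norm m t u)"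
          using le elim t st r_mono[OF True] r_nonneg by (intro mult_mono) (auto simp: field_simps)
        then show ?thesis by (simp add: mult.commute)
      next
        case False
        have "s * (r (sq_norm m s u) / sq_norm m s u) \<le> t * (r (sq_norm m t u) / sq_norm m t u)"
          using False elim st r_ratio[of "sq_norm m t u" "sq_norm m s u"] r_nonneg by (intro mult_mono) auto
        then show ?thesis .
      qed
    qed
  qed (intro integrable_mult_right integrable_r_ratio m t st)+
  then show ?thesis by (simp only: ratio_mean_def integral_mult_right_zero)
qed

text \<open>For spheres that enclose the origin, T increases with the radius in each direction, so r(T) may be kept at the
smaller radius. The change \<open>t/T - s/S\<close> of the other factor has a single sign change in u, from minus to plus, and S
increases with u; therefore r(S) may be replaced by its value at the sign change, and the remaining mean is a
difference of two values of \<open>inv_mean\<close>.\<close>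
lemma scaled_ratio_mono_far:
  assumes m: "0 \<le> m" and st: "0 < s" "m\<^sup>2 \<le> s" "s \<le> t"
  shows "s * ratio_mean m s \<le> t * ratio_mean m t"
proof -
  have t: "0 < t" using st by simp
  define v w where "v = m / sqrt s" and "w = m / sqrt t"
  have v1: "v \<le> 1" using st m by (simp add: v_def real_le_rsqrt)
  have wv: "0 \<le> w" "w \<le> v" using st m unfolding v_def w_def by (auto intro!: divide_left_mono)
  \<comment> \<open>T0 is the squared norm at \<open>u = -(v + w)/2\<close>, where the two quotients \<open>t/T\<close> and \<open>s/S\<close> agree.\<close>
  define T0 where "T0 = s * (1 - v * w)"
  have T: "sq_norm m s u = s * (1 + v\<^sup>2 + 2 * v * u)" "sq_norm m t u = t * (1 + w\<^sup>2 + 2 * w * u)" for u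
    using sq_norm_far[OF st(1)] sq_norm_far[OF t] by (auto simp: v_def w_def)
  have mean: "(\<integral>u. s / sq_norm m s u \<partial>M) = inv_mean v" "(\<integral>u. t / sq_norm m t u \<partial>M) = inv_mean w"
    using st t by (auto simp: T inv_mean_def)
  have ii: "integrable M (\<lambda>u. s / sq_norm m s u)" "integrable M (\<lambda>u. t / sq_norm m t u)"
    using integrable_mult_right[OF integrable_inv_sq_norm[OF m st(1)], of s]
       integrable_mult_right[OF integrable_inv_sq_norm[OF m t], of t] by auto
  have jj: "integrable M (\<lambda>u. r (sq_norm m s u) / sq_norm m t u)"
    by (rule integrable_ratio[OF m t]) (auto simp: r_abs)
  have "0 \<le> r T0 * (inv_mean w - inv_mean v)"
    using r_nonneg inv_mean_antimono_closed[of w v] wv v1 by simp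
  also have "\<dots> = (\<integral>u. r T0 * (t / sq_norm m t u - s / sq_norm m s u) \<partial>M)"
    using ii mean by simp
  also have "\<dots> \<le> (\<integral>u. t * (r (sq_norm m t u) / sq_norm m t u) - s * (r (sq_norm m s u) / sq_norm m s u) \<partial>M)"
  proof (rule integral_mono_AE)
    show "AE u in M. r T0 * (t / sq_norm m t u - s / sq_norm m s u)
       \<le> t * (r (sq_norm m t u) / sq_norm m t u) - s * (r (sq_norm m s u) / sq_norm m s u)"
      using sq_norm_AE_pos[OF m st(1)] sq_norm_AE_pos[OF m t] AE_bound
    proof eventually_elim
      case (elim u)
      let ?S = "sq_norm m s u" and ?T = "sq_norm m t u"
      have "0 \<le> (sqrt t - sqrt s) * (sqrt t + sqrt s + 2 * m * u)"
      proof (rule mult_nonneg_nonneg)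
        have "m \<le> sqrt s" "sqrt s \<le> sqrt t" using st m by (auto simp: real_le_rsqrt)
        moreover have "- m \<le> m * u" using m elim mult_left_mono[of "-1" u m] by simp
        ultimately show "0 \<le> sqrt t + sqrt s + 2 * m * u" by linarith
      qed (use st in simp)
      then have ST: "?S \<le> ?T" using st t by (simp add: sq_norm_def algebra_simps)
      have pos: "0 < 1 + v\<^sup>2 + 2 * v * u" "0 < 1 + w\<^sup>2 + 2 * w * u"
        using elim st t by (auto simp: T zero_less_mult_iff)
      have sgn: "0 \<le> (r ?S - r T0) * (t / ?T - s / ?S)"
      proof (cases "v = w")
        case True
        then show ?thesis using st t by (simp add: T)
      next
        case False
        then have vw: "w < v" using wv by simp
        have d: "t / ?T - s / ?S = (v - w) * (v + w + 2 * u) / ((1 + w\<^sup>2 + 2 * w * u) * (1 + v\<^sup>2 + 2 * v * u))"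
          using pos st t by (simp add: T divide_simps) (simp add: power2_eq_square algebra_simps)
        have e: "?S - T0 = s * v * (v + w + 2 * u)" by (simp add: T T0_def power2_eq_square algebra_simps)
        show ?thesis
        proof (cases "0 \<le> v + w + 2 * u")
          case True
          then have "0 \<le> ?S - T0" "0 \<le> t / ?T - s / ?S" unfolding d e using pos vw wv st
            by (auto intro!: mult_nonneg_nonneg divide_nonneg_nonneg)
          then show ?thesis using r_mono[of T0 ?S] by simp
        next
          case False
          then have "?S - T0 \<le> 0" "t / ?T - s / ?S \<le> 0" unfolding d e using pos vw wv st
            by (auto intro!: mult_nonneg_nonpos divide_nonpos_pos)
          then show ?thesis using r_mono[of ?S T0] by (intro mult_nonpos_nonpos) auto
        qed
      qed
      have "r ?S * (t / ?T) \<le> r ?T * (t / ?T)"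
        using r_mono[OF ST] elim t by (intro mult_right_mono) auto
      then show ?case using sgn by (simp add: algebra_simps)
    qed
  qed (intro integrable_mult_right Bochner_Integration.integrable_diff ii integrable_r_ratio m t st)+
  also have "\<dots> = t * ratio_mean m t - s * ratio_mean m s"
    using integrable_mult_right[OF integrable_r_ratio[OF m t], of t]
      integrable_mult_right[OF integrable_r_ratio[OF m st(1)], of s]
    by (simp only: ratio_mean_def Bochner_Integration.integral_diff integral_mult_right_zero)
  finally show ?thesis by simp
qed

lemma scaled_ratio_mono:
  assumes m: "0 \<le> m" and st: "0 < s" "s \<le> t"
  shows "s * ratio_mean m s \<le> t * ratio_mean m t"
proof (cases "t \<le> m\<^sup>2 \<or> m\<^sup>2 \<le> s")
  case True
  then show ?thesis using scaled_ratio_mono_near[OF m st] scaled_ratio_mono_far[OF m st(1) _ st(2)] by auto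
next
  case False
  then have "s < m\<^sup>2" by auto
  then have "0 < m\<^sup>2" using st by linarith
  with False have "s * ratio_mean m s \<le> m\<^sup>2 * ratio_mean m (m\<^sup>2)" "m\<^sup>2 * ratio_mean m (m\<^sup>2) \<le> t * ratio_mean m t"
    using scaled_ratio_mono_near[OF m, of s "m\<^sup>2"] scaled_ratio_mono_far[OF m, of "m\<^sup>2" t] st
    by (auto simp del: zero_less_power2)
  then show ?thesis by simp
qed


lemma ratio_mean_nonneg: 
  assumes "0 \<le> m" "0 < t"
  shows "0 \<le> ratio_mean m t"
  unfolding ratio_mean_def
proof (rule integral_nonneg_AE)
  show "AE u in M. 0 \<le> r (sq_norm m t u) / sq_norm m t u"
    using sq_norm_AE_pos[OF assms] by eventually_elim (simp add: r_nonneg)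
qed

lemma ratio_mean_le:
  assumes "0 \<le> m" "0 < t"
  shows "t * ratio_mean m t \<le> 1"
proof -
  have "ratio_mean m t \<le> (\<integral>u. 1 / sq_norm m t u \<partial>M)"
    unfolding ratio_mean_def
  proof (rule integral_mono_AE[OF integrable_r_ratio[OF assms] integrable_inv_sq_norm[OF assms]])
    show "AE u in M. r (sq_norm m t u) / sq_norm m t u \<le> 1 / sq_norm m t u"
      using sq_norm_AE_pos[OF assms] by eventually_elim (simp add: divide_right_mono r_le_1)
  qed
  then have "t * ratio_mean m t \<le> max (m\<^sup>2) t * (\<integral>u. 1 / sq_norm m t u \<partial>M)"
    using assms ratio_mean_nonneg[OF assms] by (intro mult_mono) auto
  then show ?thesis using inv_sq_norm_max[OF assms] by simp
qed

text \<open>The change of the quadratic loss caused by shrinkage, divided by a.\<close>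
definition excess :: "real \<Rightarrow> real \<Rightarrow> real \<Rightarrow> real \<Rightarrow> real" where
  "excess a m t u = a * (r (sq_norm m t u))\<^sup>2 / sq_norm m t u
     - r (sq_norm m t u) * (sq_norm m t u + t - m\<^sup>2) / sq_norm m t u"

lemma excess_measurable [measurable]: "(\<lambda>(t,u). excess a m t u) \<in> borel_measurable (borel \<Otimes>\<^sub>M borel)"
  unfolding excess_def by measurable

lemma integrable_pull:
  assumes "0 \<le> m" "0 < t"
  shows "integrable M (\<lambda>u. r (sq_norm m t u) * (sq_norm m t u + t - m\<^sup>2) / (2 * sq_norm m t u))"
proof (rule integrable_cong_AE_imp[where g="\<lambda>u. r (sq_norm m t u) / 2 + (t - m\<^sup>2) / 2 * (r (sq_norm m t u) / sq_norm m t u)"])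
  show "integrable M (\<lambda>u. r (sq_norm m t u) / 2 + (t - m\<^sup>2) / 2 * (r (sq_norm m t u) / sq_norm m t u))"
    using assms integrable_r_sq_norm[of m t] 
    by (intro Bochner_Integration.integrable_add integrable_mult_right integrable_r_ratio) auto
  show "AE u in M. r (sq_norm m t u) / 2 + (t - m\<^sup>2) / 2 * (r (sq_norm m t u) / sq_norm m t u)
     = r (sq_norm m t u) * (sq_norm m t u + t - m\<^sup>2) / (2 * sq_norm m t u)"
    using pull_decomp[OF assms] by eventually_elim (rule sym)
qed simp

lemma integrable_excess:
  assumes "0 \<le> m" "0 < t"
  shows "integrable M (excess a m t)"
proof -
  have "integrable M (\<lambda>u. a * ((r (sq_norm m t u))\<^sup>2 / sq_norm m t u))"
    by (intro integrable_mult_right integrable_ratio assms) (auto simp: abs_square_le_1 r_abs)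
  moreover have "integrable M (\<lambda>u. 2 * (r (sq_norm m t u) * (sq_norm m t u + t - m\<^sup>2) / (2 * sq_norm m t u)))"
    by (intro integrable_mult_right integrable_pull assms)
  ultimately show ?thesis unfolding excess_def by simp
qed

text \<open>Here \<open>r \<le> 1\<close> enters through \<open>r\<^sup>2 \<le> r\<close>.\<close>
lemma excess_mean:
  assumes "0 \<le> m" "0 < t" "0 \<le> a"
  shows "(\<integral>u. excess a m t u \<partial>M) \<le> a * ratio_mean m t - 2 * pull_mean m t"
proof -
  have i: "integrable M (\<lambda>u. a * (r (sq_norm m t u) / sq_norm m t u))"
      "integrable M (\<lambda>u. 2 * (r (sq_norm m t u) * (sq_norm m t u + t - m\<^sup>2) / (2 * sq_norm m t u)))"
    by (intro integrable_mult_right integrable_pull integrable_r_ratio assms)+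
  have "(\<integral>u. excess a m t u \<partial>M) \<le> (\<integral>u. a * (r (sq_norm m t u) / sq_norm m t u)
      - 2 * (r (sq_norm m t u) * (sq_norm m t u + t - m\<^sup>2) / (2 * sq_norm m t u)) \<partial>M)"
  proof (rule integral_mono_AE)
    show "AE u in M. excess a m t u \<le> a * (r (sq_norm m t u) / sq_norm m t u)
      - 2 * (r (sq_norm m t u) * (sq_norm m t u + t - m\<^sup>2) / (2 * sq_norm m t u))"
      using sq_norm_AE_pos[OF assms(1,2)]
    proof eventually_elim
      case (elim u)
      have "(r (sq_norm m t u))\<^sup>2 \<le> r (sq_norm m t u)"
        using r_nonneg r_le_1 by (simp add: power2_eq_square mult_left_le)
      then have "a * (r (sq_norm m t u))\<^sup>2 / sq_norm m t u \<le> a * r (sq_norm m t u) / sq_norm m t u"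
        using elim assms by (intro divide_right_mono mult_left_mono) auto
      then show ?case by (simp add: excess_def)
    qed
  qed (use i integrable_excess[OF assms(1,2)] in \<open>auto intro: Bochner_Integration.integrable_diff\<close>)
  also have "\<dots> = a * ratio_mean m t - 2 * pull_mean m t"
    unfolding Bochner_Integration.integral_diff[OF i] ratio_mean_def pull_mean_def integral_mult_right_zero ..
  finally show ?thesis .
qed

lemma pull_mean_0: "0 < t \<Longrightarrow> pull_mean 0 t = t * ratio_mean 0 t"
  by (simp add: pull_mean_def ratio_mean_def sq_norm_def field_simps prob_space)

lemma ratio_mean_0: "0 < t \<Longrightarrow> t * ratio_mean 0 t = r t"
  by (simp add: ratio_mean_def sq_norm_def prob_space)

lemma ratio_mean_measurable [measurable]: "ratio_mean m \<in> borel_measurable borel"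
  unfolding ratio_mean_def by measurable

text \<open>The radius is now random: W is a finite measure for the squared radius t.\<close>
context
  fixes W :: "real measure" and a m :: real
  assumes W: "finite_measure W" and sets_W [measurable_cong]: "sets W = sets borel"
    and W_pos: "AE t in W. 0 < t"
    and W_inv: "integrable W (\<lambda>t. 1 / t)"
    and a: "0 < a" and a_le: "a * (\<integral>t. 1 / t \<partial>W) \<le> 2 * (real n - 2) / real n * measure W (space W)"
    and m: "0 \<le> m"
begin

text \<open>Both terms of the excess are dominated, up to constants, by 1/T and by \<open>1 + |t - m\<^sup>2|/T\<close>. For given t the mean of 1/T
is at most 1/t, which W integrates, and the mean of \<open>|t - m\<^sup>2|/T\<close> is at most 1.\<close>
lemma integrable_radial_excess: "integrable (W \<Otimes>\<^sub>M M) (\<lambda>(t,u). excess a m t u)"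
proof -
  interpret W: finite_measure W by (rule W)
  interpret WM: pair_sigma_finite W M ..
  have AEW: "AE t in W. integrable M (\<lambda>u. 1 / sq_norm m t u) \<and> (\<integral>u. 1 / sq_norm m t u \<partial>M) \<le> 1 / t \<and>
     \<bar>t - m\<^sup>2\<bar> * (\<integral>u. 1 / sq_norm m t u \<partial>M) \<le> 1 \<and> 0 \<le> (\<integral>u. 1 / sq_norm m t u \<partial>M) \<and>
     (\<integral>u. norm (1 / sq_norm m t u) \<partial>M) = (\<integral>u. 1 / sq_norm m t u \<partial>M)"
    using W_pos
  proof eventually_elim
    case (elim t)
    have nn: "AE u in M. 0 \<le> 1 / sq_norm m t u" 
      using sq_norm_AE_pos[OF m elim] by eventually_elim simp
    have nn': "0 \<le> (\<integral>u. 1 / sq_norm m t u \<partial>M)" by (rule integral_nonneg_AE[OF nn])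
    have "t * (\<integral>u. 1 / sq_norm m t u \<partial>M) \<le> max (m\<^sup>2) t * (\<integral>u. 1 / sq_norm m t u \<partial>M)"
      "\<bar>t - m\<^sup>2\<bar> * (\<integral>u. 1 / sq_norm m t u \<partial>M) \<le> max (m\<^sup>2) t * (\<integral>u. 1 / sq_norm m t u \<partial>M)"
      using nn' elim by (auto intro!: mult_right_mono simp: abs_if max_def)
    moreover have "(\<integral>u. norm (1 / sq_norm m t u) \<partial>M) = (\<integral>u. 1 / sq_norm m t u \<partial>M)"
    proof (rule integral_cong_AE)
      show "AE u in M. norm (1 / sq_norm m t u) = 1 / sq_norm m t u"
        using nn by eventually_elim simp
    qed simp_all
    ultimately show ?case using inv_sq_norm_max[OF m elim] integrable_inv_sq_norm[OF m elim] elim nn'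
      by (simp add: field_simps)
  qed
  have I1: "integrable (W \<Otimes>\<^sub>M M) (\<lambda>(t,u). 1 / sq_norm m t u)"
  proof (rule WM.Fubini_integrable)
    show "integrable W (\<lambda>t. \<integral>u. norm (case (t, u) of (t, u) \<Rightarrow> 1 / sq_norm m t u) \<partial>M)"
    proof (rule Bochner_Integration.integrable_bound[OF W_inv])
      show "AE t in W. norm (\<integral>u. norm (case (t, u) of (t, u) \<Rightarrow> 1 / sq_norm m t u) \<partial>M) \<le> norm (1 / t)"
        using AEW W_pos by eventually_elim simp
    qed simp
    show "AE t in W. integrable M (\<lambda>u. case (t, u) of (t, u) \<Rightarrow> 1 / sq_norm m t u)"
      using AEW by eventually_elim simp
  qed simp
  have I2: "integrable (W \<Otimes>\<^sub>M M) (\<lambda>(t,u). (t - m\<^sup>2) * (1 / sq_norm m t u))"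
  proof (rule WM.Fubini_integrable)
    show "integrable W (\<lambda>t. \<integral>u. norm (case (t, u) of (t, u) \<Rightarrow> (t - m\<^sup>2) * (1 / sq_norm m t u)) \<partial>M)"
    proof (rule W.integrable_const_bound[where B=1])
      show "AE t in W. norm (\<integral>u. norm (case (t, u) of (t, u) \<Rightarrow> (t - m\<^sup>2) * (1 / sq_norm m t u)) \<partial>M) \<le> 1"
        using AEW
      proof eventually_elim
        case (elim t)
        have "(\<integral>u. norm ((t - m\<^sup>2) * (1 / sq_norm m t u)) \<partial>M) = \<bar>t - m\<^sup>2\<bar> * (\<integral>u. norm (1 / sq_norm m t u) \<partial>M)"
          unfolding norm_mult by (subst integral_mult_right_zero) simp
        then show ?case using elim by simp
      qed
    qed simp
    show "AE t in W. integrable M (\<lambda>u. case (t, u) of (t, u) \<Rightarrow> (t - m\<^sup>2) * (1 / sq_norm m t u))"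
      using AEW by eventually_elim (auto intro: integrable_mult_right simp del: times_divide_eq_right)
  qed simp
  have "finite_measure (W \<Otimes>\<^sub>M M)" by (rule finite_measure_pair_measure[OF finite_measure_axioms W])
  then have I0: "integrable (W \<Otimes>\<^sub>M M) (\<lambda>_. 1 :: real)" by (rule finite_measure.integrable_const)
  have dom: "integrable (W \<Otimes>\<^sub>M M) (\<lambda>x. a * norm ((\<lambda>(t,u). 1 / sq_norm m t u) x) + 1
      + norm ((\<lambda>(t,u). (t - m\<^sup>2) * (1 / sq_norm m t u)) x))"
    by (intro Bochner_Integration.integrable_add integrable_mult_right integrable_norm I0 I1 I2)
  show ?thesis
  proof (rule Bochner_Integration.integrable_bound[OF dom])
    show "AE x in W \<Otimes>\<^sub>M M. norm ((\<lambda>(t,u). excess a m t u) x) \<le> norm (a * norm ((\<lambda>(t,u). 1 / sq_norm m t u) x) + 1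
      + norm ((\<lambda>(t,u). (t - m\<^sup>2) * (1 / sq_norm m t u)) x))"
    proof (rule AE_I2)
      fix x :: "real \<times> real"
      obtain t u where x: "x = (t, u)" by (cases x)
      let ?T = "sq_norm m t u"
      have 1: "\<bar>a * (r ?T)\<^sup>2 / ?T\<bar> \<le> a * \<bar>1 / ?T\<bar>"
        using a r_abs[of ?T] by (auto simp: abs_mult abs_square_le_1 intro!: divide_right_mono)
      have "\<bar>(?T + t - m\<^sup>2) / ?T\<bar> \<le> 1 + \<bar>(t - m\<^sup>2) * (1 / ?T)\<bar>"
      proof (cases "?T = 0")
        case False
        then have "(?T + t - m\<^sup>2) / ?T = 1 + (t - m\<^sup>2) * (1 / ?T)" by (simp add: field_simps)
        then show ?thesis by linarith
      qed simp
      moreover have "\<bar>r ?T * (?T + t - m\<^sup>2) / ?T\<bar> \<le> \<bar>(?T + t - m\<^sup>2) / ?T\<bar>"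
        using r_abs[of ?T] by (simp add: abs_mult mult_left_le_one_le divide_right_mono)
      ultimately have 2: "\<bar>r ?T * (?T + t - m\<^sup>2) / ?T\<bar> \<le> 1 + \<bar>(t - m\<^sup>2) * (1 / ?T)\<bar>" by linarith
      have "norm (excess a m t u) \<le> a * \<bar>1 / ?T\<bar> + 1 + \<bar>(t - m\<^sup>2) * (1 / ?T)\<bar>"
        unfolding excess_def real_norm_def using 1 2 abs_triangle_ineq4[of "a * (r ?T)\<^sup>2 / ?T" "r ?T * (?T + t - m\<^sup>2) / ?T"] by linarith
      then show "norm ((\<lambda>(t,u). excess a m t u) x) \<le> norm (a * norm ((\<lambda>(t,u). 1 / sq_norm m t u) x) + 1
          + norm ((\<lambda>(t,u). (t - m\<^sup>2) * (1 / sq_norm m t u)) x))"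
        unfolding x prod.case real_norm_def by (rule order_trans) (rule abs_ge_self)
    qed
  qed simp
qed

text \<open>The factor \<open>a/t - 2(n-2)/n\<close> is positive before its zero and negative after it, while \<open>t * ratio_mean m t\<close> is
non-decreasing; replacing the latter by its value at the zero can only increase the integral.\<close>
lemma radial_ratio_le: 
  shows "integrable W (\<lambda>t. (a / t - 2 * (real n - 2) / real n) * (t * ratio_mean m t))"
    and "(\<integral>t. (a / t - 2 * (real n - 2) / real n) * (t * ratio_mean m t) \<partial>W) \<le> 0"
proof -
  interpret W: finite_measure W by (rule W)
  define c where "c = 2 * (real n - 2) / real n"
  have c: "0 < c" using dim by (simp add: c_def)
  define t0 where "t0 = a / c"
  have t0: "0 < t0" using a c by (simp add: t0_def)
  have ib: "integrable W (\<lambda>t. a / t - c)" using integrable_mult_right[OF W_inv, of a] by simp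
  show i: "integrable W (\<lambda>t. (a / t - 2 * (real n - 2) / real n) * (t * ratio_mean m t))"
  proof (rule Bochner_Integration.integrable_bound[OF ib])
    show "AE t in W. norm ((a / t - 2 * (real n - 2) / real n) * (t * ratio_mean m t)) \<le> norm (a / t - c)"
      using W_pos
    proof eventually_elim
      case (elim t)
      have "\<bar>t * ratio_mean m t\<bar> \<le> 1" using ratio_mean_le[OF m elim] ratio_mean_nonneg[OF m elim] elim by simp
      then show ?case unfolding norm_mult real_norm_def c_def[symmetric]
        abs_mult[of "a / t - c"] by (intro mult_left_le) auto
    qed
  qed simp
  have "(\<integral>t. (a / t - c) * (t * ratio_mean m t) \<partial>W) \<le> (\<integral>t. (a / t - c) * (t0 * ratio_mean m t0) \<partial>W)"
  proof (rule integral_mono_AE)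
    show "AE t in W. (a / t - c) * (t * ratio_mean m t) \<le> (a / t - c) * (t0 * ratio_mean m t0)"
      using W_pos
    proof eventually_elim
      case (elim t)
      show ?case
      proof (cases "t \<le> t0")
        case True
        then have "0 \<le> a / t - c" using elim c by (simp add: t0_def field_simps)
        then show ?thesis using scaled_ratio_mono[OF m elim True] by (intro mult_left_mono)
      next
        case False
        then have "a / t - c \<le> 0" using elim c by (simp add: t0_def field_simps)
        then show ?thesis using scaled_ratio_mono[OF m t0, of t] False by (intro mult_left_mono_neg) auto
      qed
    qed
  qed (use i ib c_def in auto)
  also have "\<dots> = (a * (\<integral>t. 1 / t \<partial>W) - c * measure W (space W)) * (t0 * ratio_mean m t0)"
    using W_inv ib integrable_mult_right[OF W_inv, of a] integral_mult_right_zero[of W a "\<lambda>t. 1 / t"]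
    by (simp add: mult.commute)
  also have "\<dots> \<le> 0" using a_le ratio_mean_nonneg[OF m t0] t0 by (intro mult_nonpos_nonneg) (auto simp: c_def)
  finally show "(\<integral>t. (a / t - 2 * (real n - 2) / real n) * (t * ratio_mean m t) \<partial>W) \<le> 0" by (simp add: c_def)
qed

lemma radial_excess_nonpos: "(\<integral>(t,u). excess a m t u \<partial>(W \<Otimes>\<^sub>M M)) \<le> 0"
proof -
  interpret W: finite_measure W by (rule W)
  interpret WM: pair_sigma_finite W M ..
  have "(\<integral>(t,u). excess a m t u \<partial>(W \<Otimes>\<^sub>M M)) = (\<integral>t. (\<integral>u. excess a m t u \<partial>M) \<partial>W)"
    using WM.integral_fst'[OF integrable_radial_excess] by simp
  also have "\<dots> \<le> (\<integral>t. (a / t - 2 * (real n - 2) / real n) * (t * ratio_mean m t) \<partial>W)"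
  proof (rule integral_mono_AE)
    show "integrable W (\<lambda>t. \<integral>u. excess a m t u \<partial>M)"
      using WM.integrable_fst'[OF integrable_radial_excess] by simp
    show "AE t in W. (\<integral>u. excess a m t u \<partial>M) \<le> (a / t - 2 * (real n - 2) / real n) * (t * ratio_mean m t)"
      using W_pos
    proof eventually_elim
      case (elim t)
      have "(\<integral>u. excess a m t u \<partial>M) \<le> a * ratio_mean m t - 2 * pull_mean m t"
        using m elim a by (intro excess_mean) auto
      also have "\<dots> \<le> a * ratio_mean m t - 2 * ((real n - 2) / real n * (t * ratio_mean m t))"
        using pull_ge_ratio[OF m elim] by simp
      also have "\<dots> = a / t * (t * ratio_mean m t) - 2 * (real n - 2) / real n * (t * ratio_mean m t)"
        using elim by simp
      finally show ?case by (simp only: left_diff_distrib)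
    qed
  qed (rule radial_ratio_le)
  also have "\<dots> \<le> 0" by (rule radial_ratio_le)
  finally show ?thesis .
qed

text \<open>About the origin, \<open>X\<bullet>(X - \<mu>)/|X|\<^sup>2 = 1\<close>, and the loss of the factor \<open>(n-2)/n\<close> in \<open>pull_ge_ratio\<close> is avoided. The gain
\<open>(2 - c) r\<close> with \<open>c = 2(n-2)/n < 2\<close> has a positive integral.\<close>
lemma radial_excess_neg:
  assumes m0: "m = 0" and r_pos: "\<And>t. 0 < t \<Longrightarrow> 0 < r t" and W0: "0 < measure W (space W)"
  shows "(\<integral>(t,u). excess a m t u \<partial>(W \<Otimes>\<^sub>M M)) < 0"
proof -
  interpret W: finite_measure W by (rule W)
  interpret WM: pair_sigma_finite W M ..
  define c where "c = 2 * (real n - 2) / real n"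
  have c: "c < 2" using dim by (simp add: c_def field_simps)
  have ir: "integrable W r" by (rule W.integrable_const_bound[where B=1]) (auto simp: r_abs)
  have rpos: "0 < (\<integral>t. r t \<partial>W)"
  proof -
    have "(\<integral>t. r t \<partial>W) \<noteq> 0"
    proof
      assume "(\<integral>t. r t \<partial>W) = 0"
      then have "AE t in W. r t = 0" using integral_nonneg_eq_0_iff_AE[OF ir] r_nonneg by auto
      then have "AE t in W. False" using W_pos by eventually_elim (use r_pos in fastforce)
      then have "emeasure W (space W) = 0" by (simp add: AE_iff_measurable[OF _ refl])
      then show False using W0 by (simp add: measure_def)
    qed
    moreover have "0 \<le> (\<integral>t. r t \<partial>W)" by (rule integral_nonneg_AE) (simp add: r_nonneg)
    ultimately show ?thesis by simp
  qed
  have "(\<integral>(t,u). excess a m t u \<partial>(W \<Otimes>\<^sub>M M)) = (\<integral>t. (\<integral>u. excess a m t u \<partial>M) \<partial>W)"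
    using WM.integral_fst'[OF integrable_radial_excess] by simp
  also have "\<dots> \<le> (\<integral>t. (a / t - c) * (t * ratio_mean m t) - (2 - c) * r t \<partial>W)"
  proof (rule integral_mono_AE)
    show "integrable W (\<lambda>t. \<integral>u. excess a m t u \<partial>M)"
      using WM.integrable_fst'[OF integrable_radial_excess] by simp
    show "AE t in W. (\<integral>u. excess a m t u \<partial>M) \<le> (a / t - c) * (t * ratio_mean m t) - (2 - c) * r t"
      using W_pos
    proof eventually_elim
      case (elim t)
      have "(\<integral>u. excess a m t u \<partial>M) \<le> a * ratio_mean m t - 2 * (t * ratio_mean m t)"
        using m elim a excess_mean[of m t a] m0 pull_mean_0[OF elim] by simp
      also have "\<dots> = (a / t - c) * (t * ratio_mean m t) - (2 - c) * (t * ratio_mean m t)"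
        using elim by (simp add: field_simps)
      finally show ?case using ratio_mean_0[OF elim] m0 by simp
    qed
    show "integrable W (\<lambda>t. (a / t - c) * (t * ratio_mean m t) - (2 - c) * r t)"
      using radial_ratio_le(1) ir unfolding c_def by (intro Bochner_Integration.integrable_diff integrable_mult_right)
  qed
  also have "\<dots> = (\<integral>t. (a / t - c) * (t * ratio_mean m t) \<partial>W) - (2 - c) * (\<integral>t. r t \<partial>W)"
    using radial_ratio_le(1) ir unfolding c_def by (subst Bochner_Integration.integral_diff) auto
  also have "\<dots> < 0" using radial_ratio_le(2) rpos c unfolding c_def[symmetric]
    by (smt (verit) mult_pos_pos)
  finally show ?thesis .
qed

end
end

section \<open>Rotations and polar coordinates of Lebesgue measure\<close>

lemma nn_integral_lborel_plus:
  fixes f :: "'a::euclidean_space \<Rightarrow> ennreal"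
  assumes [measurable]: "f \<in> borel_measurable borel"
  shows "(\<integral>\<^sup>+x. f (c + x) \<partial>lborel) = (\<integral>\<^sup>+x. f x \<partial>lborel)"
  by (subst (2) lborel_distr_plus[symmetric, of c]) (simp add: nn_integral_distr)

lemma orthogonal_transformation_measurable:
  fixes T :: "'a::euclidean_space \<Rightarrow> 'a"
  assumes "orthogonal_transformation T" shows "T \<in> borel_measurable borel"
  by (intro borel_measurable_continuous_onI linear_continuous_on linear_conv_bounded_linear[THEN iffD1] orthogonal_transformation_linear assms)

text \<open>Uniqueness of translation invariant measures. The image of Lebesgue measure \<open>\<lambda>\<close> under T is again translation
invariant. Evaluating the integral of the product of the indicators of A at Tz and of B at y - Tz over all y
and z in both orders gives \<open>\<lambda>(T -` A) \<lambda>(B) = \<lambda>(A) \<lambda>(B)\<close> for the unit ball B, which T and \<open>z \<mapsto> -z\<close> preserve.\<close>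
lemma lborel_distr_orthogonal:
  fixes T :: "'a::euclidean_space \<Rightarrow> 'a"
  assumes T: "orthogonal_transformation T"
  shows "distr lborel borel T = (lborel :: 'a measure)"
proof (rule measure_eqI)
  have [measurable]: "T \<in> borel_measurable borel" by (rule orthogonal_transformation_measurable[OF T])
  have Tadd: "T (x + y) = T x + T y" for x y
    by (simp add: linear_add orthogonal_transformation_linear[OF T])
  define B :: "'a set" where "B = cball 0 1"
  have [measurable]: "B \<in> sets borel" by (simp add: B_def)
  have B: "emeasure lborel B \<noteq> 0" "emeasure lborel B \<noteq> \<infinity>"
    using content_cball_pos[of 1 "0::'a"] emeasure_lborel_cball_finite[of "0::'a" 1] unfolding B_def by (auto simp: measure_def)
  fix A assume "A \<in> sets (distr lborel borel T)"
  then have [measurable]: "A \<in> sets borel" by simp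
  let ?I = "\<integral>\<^sup>+z. (\<integral>\<^sup>+y. indicator A (T z) * indicator B (- T z + y) \<partial>lborel) \<partial>lborel"
  have "?I = (\<integral>\<^sup>+z. indicator A (T z) * emeasure lborel B \<partial>lborel)"
  proof (rule nn_integral_cong)
    fix z
    have "(\<integral>\<^sup>+y. indicator A (T z) * indicator B (- T z + y) \<partial>lborel) = indicator A (T z) * (\<integral>\<^sup>+y. indicator B (- T z + y) \<partial>lborel)"
      by (subst nn_integral_cmult[symmetric]) auto
    also have "\<dots> = indicator A (T z) * emeasure lborel B"
      by (subst nn_integral_lborel_plus) auto
    finally show "(\<integral>\<^sup>+y. indicator A (T z) * indicator B (- T z + y) \<partial>lborel) = indicator A (T z) * emeasure lborel B" .
  qed
  also have "\<dots> = (\<integral>\<^sup>+z. indicator A z \<partial>distr lborel borel T) * emeasure lborel B"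
    by (subst nn_integral_distr) (simp_all add: nn_integral_multc)
  also have "\<dots> = emeasure (distr lborel borel T) A * emeasure lborel B" by simp
  finally have 1: "?I = emeasure (distr lborel borel T) A * emeasure lborel B" .
  have "?I = (\<integral>\<^sup>+y. (\<integral>\<^sup>+z. indicator A (T z) * indicator B (- T z + y) \<partial>lborel) \<partial>lborel)"
    by (rule lborel_pair.Fubini') simp
  also have "\<dots> = (\<integral>\<^sup>+y. (\<integral>\<^sup>+z. indicator A (y + T z) * indicator B z \<partial>lborel) \<partial>lborel)"
  proof (rule nn_integral_cong)
    fix y
    obtain x where x: "y = T x" using orthogonal_transformation_surj[OF T] by blast
    have "(\<integral>\<^sup>+z. indicator A (T z) * indicator B (- T z + y) \<partial>lborel)
       = (\<integral>\<^sup>+z. indicator A (T (x + z)) * indicator B (- T (x + z) + y) \<partial>lborel)"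
      by (subst nn_integral_lborel_plus[where f="\<lambda>z. indicator A (T z) * indicator B (- T z + y)"]) auto
    also have "\<dots> = (\<integral>\<^sup>+z. indicator A (y + T z) * indicator B z \<partial>lborel)"
      by (rule nn_integral_cong) (simp add: Tadd x B_def indicator_def orthogonal_transformation_norm[OF T])
    finally show "(\<integral>\<^sup>+z. indicator A (T z) * indicator B (- T z + y) \<partial>lborel) = (\<integral>\<^sup>+z. indicator A (y + T z) * indicator B z \<partial>lborel)" .
  qed
  also have "\<dots> = (\<integral>\<^sup>+z. (\<integral>\<^sup>+y. indicator A (y + T z) * indicator B z \<partial>lborel) \<partial>lborel)"
    by (rule lborel_pair.Fubini') simp
  also have "\<dots> = (\<integral>\<^sup>+z. emeasure lborel A * indicator B z \<partial>lborel)"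
  proof (rule nn_integral_cong)
    fix z
    have "(\<integral>\<^sup>+y. indicator A (y + T z) * indicator B z \<partial>lborel) = (\<integral>\<^sup>+y. indicator A (T z + y) \<partial>lborel) * indicator B z"
      by (subst nn_integral_multc[symmetric]) (auto simp: add.commute)
    also have "\<dots> = emeasure lborel A * indicator B z" by (subst nn_integral_lborel_plus) auto
    finally show "(\<integral>\<^sup>+y. indicator A (y + T z) * indicator B z \<partial>lborel) = emeasure lborel A * indicator B z" .
  qed
  also have "\<dots> = emeasure lborel A * emeasure lborel B" by (simp add: nn_integral_cmult)
  finally have "emeasure (distr lborel borel T) A * emeasure lborel B = emeasure lborel A * emeasure lborel B"
    unfolding 1 .
  then show "emeasure (distr lborel borel T) A = emeasure lborel A"
    using B by (simp add: mult.commute[of _ "emeasure lborel B"] ennreal_mult_cancel_left)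
qed simp

text \<open>At \<open>z = 0\<close> this is 0, which keeps the bound by 1 and the identity \<open>norm z * cosine e z = z \<bullet> e\<close> valid there.\<close>
definition cosine :: "'a::euclidean_space \<Rightarrow> 'a \<Rightarrow> real" where
  "cosine e z = (z \<bullet> e) / norm z"

definition cosine_measure :: "'a::euclidean_space \<Rightarrow> real measure" where
  "cosine_measure e = distr (uniform_measure lborel (cball 0 1)) borel (cosine e)"

text \<open>The image of Lebesgue measure under the squared norm.\<close>
definition radial_measure :: "'a::euclidean_space itself \<Rightarrow> real measure" where
  "radial_measure _ = density lborel (\<lambda>t. ennreal (measure lborel (cball (0::'a) 1) * (DIM('a) / 2)
     * t powr ((real DIM('a) - 2) / 2)) * indicator {0<..} t)"

lemma cosine_measurable [measurable]: "cosine e \<in> borel_measurable borel"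
  unfolding cosine_def by measurable

lemma unit_cball: "emeasure lborel (cball (0::'a::euclidean_space) 1) = ennreal (measure lborel (cball (0::'a) 1))"
  "0 < measure lborel (cball (0::'a) 1)"
  using content_cball_pos[of 1 "0::'a"] emeasure_lborel_cball_finite[of "0::'a" 1] 
  by (auto simp: emeasure_eq_ennreal_measure)

lemma prob_uniform_cball: "prob_space (uniform_measure lborel (cball (0::'a::euclidean_space) 1))"
  by (rule prob_space_uniform_measure) (use unit_cball(2)[where 'a='a] in \<open>simp_all only: unit_cball(1)\<close>, simp_all)

lemma prob_cosine_measure: "prob_space (cosine_measure e)"
  unfolding cosine_measure_def by (intro prob_space.prob_space_distr prob_uniform_cball) simp

lemma cosine_bound: "norm e = 1 \<Longrightarrow> \<bar>cosine e z\<bar> \<le> 1"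
  using Cauchy_Schwarz_ineq2[of z e] by (cases "z = 0") (auto simp: cosine_def divide_simps)

text \<open>The primitive \<open>w * |t|\<^bsup>DIM/2\<^esup>\<close> of the density is differentiable at 0 as well because the exponent exceeds 1, so the
fundamental theorem applies on the closed interval from 0 to s.\<close>
lemma emeasure_radial_atMost:
  fixes s :: real
  assumes dim: "3 \<le> DIM('a::euclidean_space)"
  shows "emeasure (radial_measure TYPE('a)) {..s} =
    ennreal (measure lborel (cball (0::'a) 1) * (if 0 < s then s powr (real DIM('a) / 2) else 0))"
proof -
  define w where "w = measure lborel (cball (0::'a) 1)"
  define k where "k = real DIM('a) / 2"
  have k: "1 < k" and kk: "(real DIM('a) - 2) / 2 = k - 1" using dim by (auto simp: k_def field_simps)
  have w: "0 < w" using unit_cball(2)[where 'a='a] by (simp add: w_def)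
  have em: "emeasure (radial_measure TYPE('a)) {..s} = (\<integral>\<^sup>+t. ennreal (w * k * t powr (k - 1)) * indicator {0<..} t * indicator {..s} t \<partial>lborel)"
    by (simp add: radial_measure_def emeasure_density kk flip: w_def k_def)
  show ?thesis
  proof (cases "0 < s")
    case False
    then have "emeasure (radial_measure TYPE('a)) {..s} = (\<integral>\<^sup>+t. 0 \<partial>(lborel :: real measure))"
      unfolding em by (intro nn_integral_cong) (auto split: split_indicator)
    then show ?thesis using False by simp
  next
    case True
    have F0: "((\<lambda>t. w * \<bar>t\<bar> powr k) has_real_derivative 0) (at 0)"
    proof -
      have "((\<lambda>h::real. \<bar>h\<bar> powr (k - 1)) \<longlongrightarrow> 0 powr (k - 1)) (at 0)"
        by (rule tendsto_powr') (use k in \<open>auto intro!: tendsto_eq_intros\<close>)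
      then have "((\<lambda>h::real. w * \<bar>h\<bar> powr (k - 1)) \<longlongrightarrow> 0) (at 0)"
        using k by (intro tendsto_eq_intros) auto
      moreover have "w * \<bar>h\<bar> powr (k - 1) = \<bar>(w * \<bar>h\<bar> powr k) / h\<bar>" if "h \<noteq> 0" for h
        using that w by (simp add: powr_diff abs_mult)
      then have "\<forall>\<^sub>F h in at 0. w * \<bar>h\<bar> powr (k - 1) = \<bar>(w * \<bar>h\<bar> powr k) / h\<bar>"
        by (simp add: eventually_at_filter)
      ultimately have "((\<lambda>h. \<bar>(w * \<bar>h\<bar> powr k) / h\<bar>) \<longlongrightarrow> 0) (at 0)" by (rule Lim_transform_eventually)
      then have "((\<lambda>h. (w * \<bar>h\<bar> powr k) / h) \<longlongrightarrow> 0) (at 0)" by (rule tendsto_rabs_zero_cancel)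
      then show ?thesis by (simp add: DERIV_def)
    qed
    have Fpos: "((\<lambda>t. w * \<bar>t\<bar> powr k) has_real_derivative w * k * t powr (k - 1)) (at t)" if "0 < t" for t
    proof -
      have "((\<lambda>t. w * t powr k) has_real_derivative w * k * t powr (k - 1)) (at t)"
        using that by (auto intro!: derivative_eq_intros simp: powr_diff)
      then show ?thesis
        by (rule has_field_derivative_transform_within_open[of _ _ _ "{0<..}"]) (use that in auto)
    qed
    have "emeasure (radial_measure TYPE('a)) {..s} = (\<integral>\<^sup>+t. ennreal (w * k * t powr (k - 1)) * indicator {0..s} t \<partial>lborel)"
      unfolding em by (intro nn_integral_cong) (auto split: split_indicator)
    also have "\<dots> = ennreal (w * \<bar>s\<bar> powr k - w * \<bar>0\<bar> powr k)"
    proof (rule nn_integral_FTC_Icc)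
      fix t assume "t \<in> {0..s}"
      then show "((\<lambda>t. w * \<bar>t\<bar> powr k) has_real_derivative w * k * t powr (k - 1)) (at t)"
        using F0 Fpos[of t] k by (cases "t = 0") auto
    qed (use True w k in auto)
    finally show ?thesis using True k by (simp add: w_def k_def)
  qed
qed

lemma sigma_finite_radial_measure: "sigma_finite_measure (radial_measure TYPE('a::euclidean_space))"
  unfolding radial_measure_def
  by (subst sigma_finite_measure.sigma_finite_iff_density_finite[OF sigma_finite_lborel])
    (auto split: split_indicator)

lemma emeasure_lborel_scale:
  fixes A :: "'a::euclidean_space set"
  assumes [measurable]: "A \<in> sets borel" and c: "0 < c"
  shows "emeasure lborel A = ennreal (c ^ DIM('a)) * emeasure lborel {x. c *\<^sub>R x \<in> A}"
proof -
  have "emeasure lborel A = emeasure (density (distr lborel borel (\<lambda>x. 0 + c *\<^sub>R x)) (\<lambda>_. ennreal (\<bar>c\<bar> ^ DIM('a)))) A"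
    using lborel_affine[of c "0::'a"] c by simp
  also have "\<dots> = ennreal (c ^ DIM('a)) * emeasure (distr lborel borel (\<lambda>x. 0 + c *\<^sub>R x)) A"
    using c by (subst emeasure_density) (auto simp: nn_integral_cmult)
  also have "emeasure (distr lborel borel (\<lambda>x. 0 + c *\<^sub>R x)) A = emeasure lborel {x. c *\<^sub>R x \<in> A}"
    by (subst emeasure_distr) (auto simp: vimage_def)
  finally show ?thesis .
qed

lemma cosine_scaleR: "0 < c \<Longrightarrow> cosine e (c *\<^sub>R z) = cosine e z"
  by (simp add: cosine_def)

text \<open>For fixed C both sides are measures in A. They agree on \<open>{..s}\<close>: the set of all z with \<open>|z|\<^sup>2 \<le> s\<close> and cosine in C is
the dilation by \<open>\<surd>s\<close> of its intersection with the unit ball.\<close>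
lemma polar_rectangle:
  fixes e :: "'a::euclidean_space"
  assumes dim: "3 \<le> DIM('a)" and [measurable]: "A \<in> sets borel" "C \<in> sets borel"
  shows "emeasure (radial_measure TYPE('a)) A * emeasure (cosine_measure e) C
     = emeasure lborel {z::'a. (norm z)\<^sup>2 \<in> A \<and> cosine e z \<in> C}"
proof -
  let ?\<tau> = "radial_measure TYPE('a)"
  define w where "w = measure lborel (cball (0::'a) 1)"
  have w: "0 < w" "emeasure lborel (cball (0::'a) 1) = ennreal w"
    using unit_cball[where 'a='a] by (auto simp: w_def)
  define L where "L = density ?\<tau> (\<lambda>_. emeasure (cosine_measure e) C)"
  define N where "N = distr (density lborel (\<lambda>z. indicator C (cosine e z))) borel (\<lambda>z::'a. (norm z)\<^sup>2)"
  interpret C: prob_space "cosine_measure e" by (rule prob_cosine_measure)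
  have sets_\<tau>: "sets ?\<tau> = sets borel" by (simp add: radial_measure_def)
  have L: "emeasure L A = ?\<tau> A * emeasure (cosine_measure e) C" if "A \<in> sets borel" for A
    using that by (simp add: L_def emeasure_density sets_\<tau> nn_integral_cmult_indicator) (simp add: mult.commute)
  have N: "emeasure N A = emeasure lborel {z::'a. (norm z)\<^sup>2 \<in> A \<and> cosine e z \<in> C}" if [measurable]: "A \<in> sets borel" for A
  proof -
    have "emeasure N A = (\<integral>\<^sup>+z. indicator C (cosine e z) * indicator {z. (norm z)\<^sup>2 \<in> A} z \<partial>lborel)"
      by (simp add: N_def emeasure_distr vimage_def emeasure_density)
    also have "\<dots> = (\<integral>\<^sup>+z. indicator {z. (norm z)\<^sup>2 \<in> A \<and> cosine e z \<in> C} z \<partial>lborel)"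
      by (intro nn_integral_cong) (auto split: split_indicator)
    finally show ?thesis by simp
  qed
  have unit: "emeasure lborel {z::'a. norm z \<le> 1 \<and> cosine e z \<in> C} = ennreal w * emeasure (cosine_measure e) C"
  proof -
    have "emeasure (cosine_measure e) C = emeasure lborel (cball 0 1 \<inter> {z. cosine e z \<in> C}) / ennreal w"
      by (simp add: cosine_measure_def emeasure_distr vimage_def w)
    moreover have "cball 0 1 \<inter> {z. cosine e z \<in> C} = {z. norm z \<le> 1 \<and> cosine e z \<in> C}" by auto
    ultimately show ?thesis using w
      by (simp add: ennreal_times_divide mult.commute[of "ennreal w"] ennreal_mult_divide_eq)
  qed
  have atMost: "emeasure L {..s} = emeasure N {..s}" for s :: real
  proof (cases "0 < s")
    case True
    have eq: "{z::'a. sqrt s *\<^sub>R z \<in> {z. (norm z)\<^sup>2 \<in> {..s} \<and> cosine e z \<in> C}} = {z. norm z \<le> 1 \<and> cosine e z \<in> C}"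
      using True by (auto simp: cosine_scaleR power_mult_distrib abs_square_le_1)
    have "emeasure N {..s} = emeasure lborel {z::'a. (norm z)\<^sup>2 \<in> {..s} \<and> cosine e z \<in> C}"
      by (rule N) simp
    also have "\<dots> = ennreal (sqrt s ^ DIM('a)) * emeasure lborel {z::'a. norm z \<le> 1 \<and> cosine e z \<in> C}"
      unfolding eq[symmetric] by (rule emeasure_lborel_scale) (use True in simp_all)
    also have "sqrt s ^ DIM('a) = s powr (real DIM('a) / 2)"
      using True by (simp add: powr_half_sqrt[symmetric] powr_realpow[symmetric] powr_powr)
    finally show ?thesis
      using True w unfolding L[OF borel_closed[OF closed_atMost]] emeasure_radial_atMost[OF dim] unit 
      by (simp add: w_def[symmetric] ennreal_mult' mult.assoc mult.left_commute)
  next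
    case False
    have "{z::'a. (norm z)\<^sup>2 \<in> {..s} \<and> cosine e z \<in> C} \<subseteq> {0}"
      using False by (auto simp: power2_eq_square mult_le_0_iff dest!: order_trans[of _ s 0])
    then have "emeasure N {..s} \<le> emeasure lborel {0::'a}"
      unfolding N[OF borel_closed[OF closed_atMost]] by (rule emeasure_mono) auto
    then show ?thesis using False by (simp add: L emeasure_radial_atMost[OF dim])
  qed
  have "L = N"
  proof (rule measure_eqI_generator_eq[where E="range atMost" and \<Omega>=UNIV and A="\<lambda>i. {..real i}"])
    show "Int_stable (range atMost :: real set set)" by (auto simp: Int_stable_def)
    show "sets L = sigma_sets UNIV (range atMost)" "sets N = sigma_sets UNIV (range atMost)"
      by (simp_all add: L_def N_def sets_\<tau> borel_eq_atMost)
    show "(\<Union>i. {..real i}) = UNIV" by (auto intro: real_arch_simple)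
    show "emeasure L {..real i} \<noteq> \<infinity>" for i
      by (simp add: L emeasure_radial_atMost[OF dim] ennreal_mult_eq_top_iff C.emeasure_finite)
  qed (auto simp: atMost)
  then show ?thesis using L[of A] N[of A] by simp
qed

theorem polar_decomposition:
  fixes e :: "'a::euclidean_space"
  assumes dim: "3 \<le> DIM('a)"
  shows "distr lborel (borel \<Otimes>\<^sub>M borel) (\<lambda>z::'a. ((norm z)\<^sup>2, cosine e z)) = radial_measure TYPE('a) \<Otimes>\<^sub>M cosine_measure e"
proof (rule pair_measure_eqI[symmetric])
  show "sigma_finite_measure (radial_measure TYPE('a))" by (rule sigma_finite_radial_measure)
  show "sigma_finite_measure (cosine_measure e)"
    using prob_cosine_measure[of e] by (simp add: prob_space_imp_sigma_finite)
  show "sets (radial_measure TYPE('a) \<Otimes>\<^sub>M cosine_measure e) = sets (distr lborel (borel \<Otimes>\<^sub>M borel) (\<lambda>z::'a. ((norm z)\<^sup>2, cosine e z)))"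
    by (simp, intro sets_pair_measure_cong) (auto simp: radial_measure_def cosine_measure_def)
  fix A C assume "A \<in> sets (radial_measure TYPE('a))" "C \<in> sets (cosine_measure e)"
  then have [measurable]: "A \<in> sets borel" "C \<in> sets borel" by (auto simp: radial_measure_def cosine_measure_def)
  show "emeasure (radial_measure TYPE('a)) A * emeasure (cosine_measure e) C =
     emeasure (distr lborel (borel \<Otimes>\<^sub>M borel) (\<lambda>z. ((norm z)\<^sup>2, cosine e z))) (A \<times> C)"
    by (subst polar_rectangle[OF dim]) (auto simp: emeasure_distr vimage_def)
qed

text \<open>The rotation by the angle \<open>\<theta>\<close> in the plane of the orthonormal vectors e and b, and the identity on its
orthogonal complement.\<close>
definition plane_rotation :: "'a::euclidean_space \<Rightarrow> 'a \<Rightarrow> real \<Rightarrow> 'a \<Rightarrow> 'a" where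
  "plane_rotation e b \<theta> z = z + ((cos \<theta> - 1) * (z \<bullet> e) - sin \<theta> * (z \<bullet> b)) *\<^sub>R e
     + (sin \<theta> * (z \<bullet> e) + (cos \<theta> - 1) * (z \<bullet> b)) *\<^sub>R b"

lemma orthogonal_plane_rotation:
  assumes "norm e = 1" "norm b = 1" "e \<bullet> b = 0"
  shows "orthogonal_transformation (plane_rotation e b \<theta>)"
    and "plane_rotation e b \<theta> z \<bullet> e = cos \<theta> * (z \<bullet> e) - sin \<theta> * (z \<bullet> b)"
    and "plane_rotation e b \<theta> z \<bullet> b = sin \<theta> * (z \<bullet> e) + cos \<theta> * (z \<bullet> b)"
proof -
  have u: "e \<bullet> e = 1" "b \<bullet> b = 1" "b \<bullet> e = 0"
    using assms by (auto simp: norm_eq_1 inner_commute)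
  show 1: "plane_rotation e b \<theta> z \<bullet> e = cos \<theta> * (z \<bullet> e) - sin \<theta> * (z \<bullet> b)"
    and 2: "plane_rotation e b \<theta> z \<bullet> b = sin \<theta> * (z \<bullet> e) + cos \<theta> * (z \<bullet> b)" for z
    using assms(3) by (auto simp: plane_rotation_def inner_add_left u algebra_simps)
  have "norm (plane_rotation e b \<theta> z) = norm z" for z
  proof -
    let ?p = "(cos \<theta> - 1) * (z \<bullet> e) - sin \<theta> * (z \<bullet> b)" and ?q = "sin \<theta> * (z \<bullet> e) + (cos \<theta> - 1) * (z \<bullet> b)"
    have "plane_rotation e b \<theta> z \<bullet> plane_rotation e b \<theta> z
       = z \<bullet> plane_rotation e b \<theta> z + ?p * (plane_rotation e b \<theta> z \<bullet> e) + ?q * (plane_rotation e b \<theta> z \<bullet> b)"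
      by (subst (1) plane_rotation_def) (simp add: inner_add_left inner_commute[of e "plane_rotation e b \<theta> z"] inner_commute[of b "plane_rotation e b \<theta> z"])
    also have "z \<bullet> plane_rotation e b \<theta> z = z \<bullet> z + ?p * (z \<bullet> e) + ?q * (z \<bullet> b)"
      by (simp add: plane_rotation_def inner_add_right)
    also have "\<dots> + ?p * (plane_rotation e b \<theta> z \<bullet> e) + ?q * (plane_rotation e b \<theta> z \<bullet> b)
      = z \<bullet> z + ((sin \<theta>)\<^sup>2 + (cos \<theta>)\<^sup>2 - 1) * ((z \<bullet> e)\<^sup>2 + (z \<bullet> b)\<^sup>2)"
    proof -
      have "x + ((c - 1) * \<alpha> - s * \<beta>) * \<alpha> + (s * \<alpha> + (c - 1) * \<beta>) * \<beta>
          + ((c - 1) * \<alpha> - s * \<beta>) * (c * \<alpha> - s * \<beta>) + (s * \<alpha> + (c - 1) * \<beta>) * (s * \<alpha> + c * \<beta>)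
          = x + (s\<^sup>2 + c\<^sup>2 - 1) * (\<alpha>\<^sup>2 + \<beta>\<^sup>2)" for x c s \<alpha> \<beta> :: real
        by (simp add: algebra_simps power2_eq_square)
      then show ?thesis unfolding 1 2 .
    qed
    finally show ?thesis by (simp add: norm_eq_sqrt_inner)
  qed
  moreover have "linear (plane_rotation e b \<theta>)"
    by (rule linearI) (simp_all add: plane_rotation_def inner_add_left algebra_simps)
  ultimately show "orthogonal_transformation (plane_rotation e b \<theta>)" by (simp add: orthogonal_transformation)
qed

lemma uniform_cball_orthogonal:
  fixes T :: "'a::euclidean_space \<Rightarrow> 'a"
  assumes T: "orthogonal_transformation T"
  shows "distr (uniform_measure lborel (cball 0 1)) borel T = uniform_measure lborel (cball 0 1)"
proof (rule measure_eqI)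
  have [measurable]: "T \<in> borel_measurable borel" by (rule orthogonal_transformation_measurable[OF T])
  fix A assume "A \<in> sets (distr (uniform_measure lborel (cball 0 1)) borel T)"
  then have [measurable]: "A \<in> sets borel" by simp
  have [measurable]: "T -` A \<in> sets borel" using measurable_sets[of T borel borel A] by simp
  have "emeasure lborel (cball 0 1 \<inter> A) = emeasure (distr lborel borel T) (cball 0 1 \<inter> A)"
    by (simp add: lborel_distr_orthogonal[OF T])
  also have "\<dots> = emeasure lborel (cball 0 1 \<inter> T -` A)"
    by (subst emeasure_distr) (auto simp: orthogonal_transformation_norm[OF T] intro!: arg_cong[where f="emeasure lborel"])
  finally show "emeasure (distr (uniform_measure lborel (cball 0 1)) borel T) A = emeasure (uniform_measure lborel (cball 0 1)) A"
    by (simp add: emeasure_distr)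
qed simp

lemma cosine_measure_orthogonal:
  fixes T :: "'a::euclidean_space \<Rightarrow> 'a"
  assumes T: "orthogonal_transformation T"
  shows "cosine_measure (T e) = cosine_measure e"
proof -
  have [measurable]: "T \<in> borel_measurable borel" by (rule orthogonal_transformation_measurable[OF T])
  have "cosine (T e) (T z) = cosine e z" for z
    using T by (simp add: cosine_def orthogonal_transformation_norm orthogonal_transformation_def[of T])
  then have "cosine_measure e = distr (uniform_measure lborel (cball 0 1)) borel (cosine (T e) \<circ> T)"
    by (simp add: cosine_measure_def o_def)
  also have "\<dots> = distr (distr (uniform_measure lborel (cball 0 1)) borel T) borel (cosine (T e))"
    by (subst distr_distr) auto
  finally show ?thesis by (simp add: uniform_cball_orthogonal[OF T] cosine_measure_def)
qed

text \<open>The mean of \<open>cosine b * f (cosine e)\<close> over the ball does not change under rotation of the plane of e and b; the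
integral is its derivative at the angle 0.\<close>
lemma cosine_by_parts_plane:
  fixes e b :: "'a::euclidean_space"
  assumes eb: "norm e = 1" "norm b = 1" "e \<bullet> b = 0"
    and [measurable]: "f \<in> borel_measurable borel" "f' \<in> borel_measurable borel"
    and deriv: "\<And>u. \<bar>u\<bar> \<le> 1 \<Longrightarrow> (f has_real_derivative f' u) (at u)"
    and bound: "\<And>u. \<bar>u\<bar> \<le> 1 \<Longrightarrow> \<bar>f u\<bar> \<le> C \<and> \<bar>f' u\<bar> \<le> C"
  shows "(\<integral>z. cosine e z * f (cosine e z) - (cosine b z)\<^sup>2 * f' (cosine e z) \<partial>uniform_measure lborel (cball 0 1)) = 0"
proof -
  let ?U = "uniform_measure lborel (cball 0 1) :: 'a measure"
  interpret U: prob_space ?U by (rule prob_uniform_cball)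
  define X where "X = (\<lambda>\<theta> z. cos \<theta> * cosine e z - sin \<theta> * cosine b z)"
  define Y where "Y = (\<lambda>\<theta> z. sin \<theta> * cosine e z + cos \<theta> * cosine b z)"
  have [measurable]: "X \<theta> \<in> borel_measurable borel" "Y \<theta> \<in> borel_measurable borel" for \<theta>
    unfolding X_def Y_def by measurable
  have rot: "X \<theta> z = cosine e (plane_rotation e b \<theta> z)" "Y \<theta> z = cosine b (plane_rotation e b \<theta> z)" for \<theta> z
    using orthogonal_plane_rotation[OF eb, of \<theta>]
    by (auto simp: cosine_def X_def Y_def orthogonal_transformation_norm add_divide_distrib diff_divide_distrib)
  have X1: "\<bar>X \<theta> z\<bar> \<le> 1" "\<bar>Y \<theta> z\<bar> \<le> 1" for \<theta> z
    unfolding rot using cosine_bound eb by auto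
  have const: "(\<integral>z. Y \<theta> z * f (X \<theta> z) \<partial>?U) = (\<integral>z. cosine b z * f (cosine e z) \<partial>?U)" for \<theta>
  proof -
    have T: "orthogonal_transformation (plane_rotation e b \<theta>)" by (rule orthogonal_plane_rotation[OF eb])
    have [measurable]: "plane_rotation e b \<theta> \<in> borel_measurable borel" by (rule orthogonal_transformation_measurable[OF T])
    have "(\<integral>z. cosine b z * f (cosine e z) \<partial>?U) = (\<integral>z. cosine b z * f (cosine e z) \<partial>distr ?U borel (plane_rotation e b \<theta>))"
      by (simp add: uniform_cball_orthogonal[OF T])
    also have "\<dots> = (\<integral>z. Y \<theta> z * f (X \<theta> z) \<partial>?U)"
      by (subst integral_distr) (auto simp: rot)
    finally show ?thesis by simp
  qed
  have C: "0 \<le> C" using bound[of 0] by auto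
  have "((\<lambda>\<theta>. \<integral>z. Y \<theta> z * f (X \<theta> z) \<partial>?U) has_real_derivative
     (\<integral>z. X 0 z * f (X 0 z) - Y 0 z * Y 0 z * f' (X 0 z) \<partial>?U)) (at 0)"
  proof (rule has_real_derivative_integral_bounded[where d=1 and C="C + C"
        and f'="\<lambda>\<theta> z. X \<theta> z * f (X \<theta> z) - Y \<theta> z * Y \<theta> z * f' (X \<theta> z)"])
    show "integrable ?U (\<lambda>z. Y \<theta> z * f (X \<theta> z))" for \<theta>
    proof (rule U.integrable_const_bound[where B=C])
      show "AE z in ?U. norm (Y \<theta> z * f (X \<theta> z)) \<le> C"
      proof (rule AE_I2)
        fix z
        have "\<bar>Y \<theta> z\<bar> * \<bar>f (X \<theta> z)\<bar> \<le> 1 * C" using bound[OF X1(1)] X1(2) by (intro mult_mono) auto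
        then show "norm (Y \<theta> z * f (X \<theta> z)) \<le> C" by (simp add: abs_mult)
      qed
    qed simp
    show "AE z in ?U. \<forall>\<theta>. \<bar>\<theta> - 0\<bar> < 1 \<longrightarrow>
       ((\<lambda>\<theta>. Y \<theta> z * f (X \<theta> z)) has_real_derivative X \<theta> z * f (X \<theta> z) - Y \<theta> z * Y \<theta> z * f' (X \<theta> z)) (at \<theta>) \<and>
       \<bar>X \<theta> z * f (X \<theta> z) - Y \<theta> z * Y \<theta> z * f' (X \<theta> z)\<bar> \<le> C + C"
    proof (rule AE_I2, intro allI impI conjI)
      fix z \<theta>
      have dX: "((\<lambda>\<theta>. X \<theta> z) has_real_derivative - Y \<theta> z) (at \<theta>)"
        and dY: "((\<lambda>\<theta>. Y \<theta> z) has_real_derivative X \<theta> z) (at \<theta>)"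
        unfolding X_def Y_def by (auto intro!: derivative_eq_intros)
      have "((\<lambda>\<theta>. f (X \<theta> z)) has_real_derivative f' (X \<theta> z) * - Y \<theta> z) (at \<theta>)"
        by (rule DERIV_chain2[OF deriv[OF X1(1)] dX])
      from DERIV_mult[OF dY this]
      show "((\<lambda>\<theta>. Y \<theta> z * f (X \<theta> z)) has_real_derivative X \<theta> z * f (X \<theta> z) - Y \<theta> z * Y \<theta> z * f' (X \<theta> z)) (at \<theta>)"
        by (simp add: algebra_simps)
      have "\<bar>X \<theta> z * f (X \<theta> z)\<bar> \<le> 1 * C" unfolding abs_mult
        using bound[OF X1(1)] X1 by (intro mult_mono) auto
      moreover have "\<bar>Y \<theta> z * Y \<theta> z * f' (X \<theta> z)\<bar> \<le> 1 * 1 * C" unfolding abs_mult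
        using bound[OF X1(1)] X1 by (intro mult_mono) auto
      ultimately show "\<bar>X \<theta> z * f (X \<theta> z) - Y \<theta> z * Y \<theta> z * f' (X \<theta> z)\<bar> \<le> C + C" by linarith
    qed
  qed (auto intro: U.finite_measure_axioms)
  then have "(\<integral>z. X 0 z * f (X 0 z) - Y 0 z * Y 0 z * f' (X 0 z) \<partial>?U) = 0"
    unfolding const using DERIV_unique DERIV_const by blast
  then show ?thesis by (simp add: X_def Y_def power2_eq_square)
qed

text \<open>Sum the identities \<open>cosine_by_parts_plane\<close> over all basis vectors b other than e; the squared cosines with the
basis vectors add up to 1.\<close>
lemma cosine_law_Basis:
  fixes e :: "'a::euclidean_space"
  assumes e: "e \<in> Basis" and dim: "4 \<le> DIM('a)"
  shows "cosine_law (cosine_measure e) (DIM('a))"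
proof -
  let ?U = "uniform_measure lborel (cball 0 1) :: 'a measure"
  interpret U: prob_space ?U by (rule prob_uniform_cball)
  interpret prob_space "cosine_measure e" by (rule prob_cosine_measure)
  show ?thesis
  proof
    show "sets (cosine_measure e) = sets borel" by (simp add: cosine_measure_def)
    show "AE u in cosine_measure e. \<bar>u\<bar> \<le> 1"
      unfolding cosine_measure_def using e by (subst AE_distr_iff) (auto simp: cosine_bound)
    fix f f' :: "real \<Rightarrow> real" and C
    assume [measurable]: "f \<in> borel_measurable borel" "f' \<in> borel_measurable borel"
      and deriv: "\<And>u. \<bar>u\<bar> \<le> 1 \<Longrightarrow> (f has_real_derivative f' u) (at u)"
      and bound: "\<And>u. \<bar>u\<bar> \<le> 1 \<Longrightarrow> \<bar>f u\<bar> \<le> C \<and> \<bar>f' u\<bar> \<le> C"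
    have C: "0 \<le> C" using bound[of 0] by auto
    have ce: "\<bar>cosine e z\<bar> \<le> 1" for z by (rule cosine_bound) (use e in simp)
    have i1: "integrable ?U (\<lambda>z. cosine e z * f (cosine e z))"
    proof (rule U.integrable_const_bound[where B="1 * C"])
      show "AE z in ?U. norm (cosine e z * f (cosine e z)) \<le> 1 * C"
      proof (rule AE_I2)
        fix z
        have "\<bar>cosine e z\<bar> * \<bar>f (cosine e z)\<bar> \<le> 1 * C" using bound[OF ce[of z]] ce[of z] by (intro mult_mono) auto
        then show "norm (cosine e z * f (cosine e z)) \<le> 1 * C" by (simp add: abs_mult)
      qed
    qed simp
    have i2: "integrable ?U (\<lambda>z. (cosine b z)\<^sup>2 * f' (cosine e z))" if "b \<in> Basis" for b
    proof (rule U.integrable_const_bound[where B="1 * C"])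
      show "AE z in ?U. norm ((cosine b z)\<^sup>2 * f' (cosine e z)) \<le> 1 * C"
      proof (rule AE_I2)
        fix z
        have "\<bar>cosine b z\<bar> \<le> 1" by (rule cosine_bound) (use that in simp)
        then have "\<bar>(cosine b z)\<^sup>2\<bar> * \<bar>f' (cosine e z)\<bar> \<le> 1 * C"
          using bound[OF ce[of z]] by (intro mult_mono) (auto simp: abs_square_le_1)
        then show "norm ((cosine b z)\<^sup>2 * f' (cosine e z)) \<le> 1 * C" by (simp add: abs_mult)
      qed
    qed simp
    have each: "(\<integral>z. cosine e z * f (cosine e z) \<partial>?U) = (\<integral>z. (cosine b z)\<^sup>2 * f' (cosine e z) \<partial>?U)" if "b \<in> Basis - {e}" for b
      using cosine_by_parts_plane[of e b f f' C] deriv bound e that i1 i2[of b]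
      by (auto simp: inner_Basis)
    have "(real DIM('a) - 1) * (\<integral>z. cosine e z * f (cosine e z) \<partial>?U) = (\<Sum>b\<in>Basis - {e}. (\<integral>z. cosine e z * f (cosine e z) \<partial>?U))"
      using e dim by (simp add: card_Diff_singleton of_nat_diff)
    also have "\<dots> = (\<Sum>b\<in>Basis - {e}. (\<integral>z. (cosine b z)\<^sup>2 * f' (cosine e z) \<partial>?U))"
      by (rule sum.cong) (use each in auto)
    also have "\<dots> = (\<integral>z. (\<Sum>b\<in>Basis - {e}. (cosine b z)\<^sup>2 * f' (cosine e z)) \<partial>?U)"
      by (rule Bochner_Integration.integral_sum[symmetric]) (use i2 in auto)
    also have "\<dots> = (\<integral>z. (1 - (cosine e z)\<^sup>2) * f' (cosine e z) \<partial>?U)"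
    proof (rule integral_cong_AE)
      have "AE z in lborel. z \<noteq> (0::'a)" by (rule AE_lborel_singleton)
      then have "AE z in ?U. z \<noteq> 0" by (intro AE_uniform_measureI) (auto elim: eventually_mono)
      then show "AE z in ?U. (\<Sum>b\<in>Basis - {e}. (cosine b z)\<^sup>2 * f' (cosine e z)) = (1 - (cosine e z)\<^sup>2) * f' (cosine e z)"
      proof eventually_elim
        case (elim z)
        have "(\<Sum>b\<in>Basis. (cosine b z)\<^sup>2) = (\<Sum>b\<in>Basis. (z \<bullet> b)\<^sup>2) / (norm z)\<^sup>2"
          by (simp add: cosine_def power_divide sum_divide_distrib)
        also have "(\<Sum>b\<in>Basis. (z \<bullet> b)\<^sup>2) = z \<bullet> z"
          by (subst euclidean_inner[of z z]) (simp add: power2_eq_square)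
        also have "\<dots> / (norm z)\<^sup>2 = 1" using elim by (simp add: power2_norm_eq_inner)
        finally have "(\<Sum>b\<in>Basis - {e}. (cosine b z)\<^sup>2) = 1 - (cosine e z)\<^sup>2"
          using e by (simp add: sum_diff1)
        then show ?case by (simp add: sum_distrib_right[symmetric])
      qed
    qed auto
    finally show "(real DIM('a) - 1) * (\<integral>u. u * f u \<partial>cosine_measure e) = (\<integral>u. (1 - u\<^sup>2) * f' u \<partial>cosine_measure e)"
      by (simp add: cosine_measure_def integral_distr)
  qed (use dim in auto)
qed

section \<open>The integrated \<open>L\<^sub>1\<close> loss of a plug-in density\<close>

lemma spherical_measurable:
  assumes "lebesgue_density (\<lambda>y :: real^'n. q ((norm y)\<^sup>2))"
  shows "spherical q (\<mu> :: real^'n) \<in> borel_measurable borel"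
proof -
  have [measurable]: "(\<lambda>y :: real^'n. q ((norm y)\<^sup>2)) \<in> borel_measurable borel"
    using assms by (simp add: lebesgue_density_def)
  have "(\<lambda>y. (\<lambda>y :: real^'n. q ((norm y)\<^sup>2)) (y - \<mu>)) \<in> borel_measurable borel"
    by measurable
  then show ?thesis by (simp add: spherical_def[abs_def])
qed

lemma spherical_nonneg:
  assumes "lebesgue_density (\<lambda>y :: real^'n. q ((norm y)\<^sup>2))"
  shows "0 \<le> spherical q (\<mu> :: real^'n) y"
proof -
  have "0 \<le> q ((norm (y - \<mu>))\<^sup>2)" using assms unfolding lebesgue_density_def by blast
  then show ?thesis by (simp add: spherical_def)
qed

lemma nn_integral_spherical:
  assumes d: "lebesgue_density (\<lambda>y :: real^'n. q ((norm y)\<^sup>2))"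
    and [measurable]: "h \<in> borel_measurable borel"
  shows "(\<integral>\<^sup>+y. ennreal (spherical q \<mu> y) * h y \<partial>lborel)
    = (\<integral>\<^sup>+z. ennreal (q ((norm z)\<^sup>2)) * h (\<mu> + z :: real^'n) \<partial>lborel)"
proof -
  note [measurable] = spherical_measurable[OF d]
  have "(\<integral>\<^sup>+y. ennreal (spherical q \<mu> y) * h y \<partial>lborel) = (\<integral>\<^sup>+z. ennreal (spherical q \<mu> (\<mu> + z)) * h (\<mu> + z) \<partial>lborel)"
    by (rule nn_integral_lborel_plus[symmetric]) measurable
  then show ?thesis by (simp add: spherical_def)
qed

lemma sets_spherical_law [measurable_cong]: "sets (spherical_law q \<mu>) = sets borel"
  by (simp add: spherical_law_def)

lemma nn_integral_spherical_law:
  assumes d: "lebesgue_density (\<lambda>y :: real^'n. q ((norm y)\<^sup>2))"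
    and [measurable]: "h \<in> borel_measurable borel"
  shows "(\<integral>\<^sup>+y. h y \<partial>spherical_law q \<mu>) = (\<integral>\<^sup>+z. ennreal (q ((norm z)\<^sup>2)) * h (\<mu> + z :: real^'n) \<partial>lborel)"
proof -
  note [measurable] = spherical_measurable[OF d]
  show ?thesis unfolding spherical_law_def
    by (subst nn_integral_density) (simp_all add: nn_integral_spherical[OF d])
qed

lemma prob_spherical_law:
  assumes d: "lebesgue_density (\<lambda>y :: real^'n. q ((norm y)\<^sup>2))"
  shows "prob_space (spherical_law q (\<mu> :: real^'n))"
proof
  have "emeasure (spherical_law q \<mu>) (space (spherical_law q \<mu>)) = (\<integral>\<^sup>+y. 1 \<partial>spherical_law q \<mu>)"
    by simp
  also have "\<dots> = 1" using d by (subst nn_integral_spherical_law[OF d]) (auto simp: lebesgue_density_def)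
  finally show "emeasure (spherical_law q \<mu>) (space (spherical_law q \<mu>)) = 1" .
qed

lemma spherical_law_orthogonal:
  fixes T :: "real^'n \<Rightarrow> real^'n"
  assumes d: "lebesgue_density (\<lambda>y :: real^'n. q ((norm y)\<^sup>2))" and T: "orthogonal_transformation T"
  shows "distr (spherical_law q 0) borel T = spherical_law q 0"
proof (rule measure_eqI)
  have [measurable]: "T \<in> borel_measurable borel" by (rule orthogonal_transformation_measurable[OF T])
  have qm[measurable]: "(\<lambda>y :: real^'n. q ((norm y)\<^sup>2)) \<in> borel_measurable borel"
    using d by (simp add: lebesgue_density_def)
  fix A assume "A \<in> sets (distr (spherical_law q 0) borel T)"
  then have [measurable]: "A \<in> sets borel" by simp
  have [measurable]: "T -` A \<in> sets borel" using measurable_sets[of T borel borel A] by simp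
  have em: "emeasure (spherical_law q 0) B = (\<integral>\<^sup>+z. ennreal (q ((norm z)\<^sup>2)) * indicator B z \<partial>lborel)"
    if [measurable]: "B \<in> sets borel" for B :: "(real^'n) set"
    unfolding spherical_law_def using qm by (subst emeasure_density) (auto simp: spherical_def)
  have "emeasure (distr (spherical_law q 0) borel T) A = emeasure (spherical_law q 0) (T -` A)"
    by (subst emeasure_distr) (simp_all add: spherical_law_def)
  also have "\<dots> = (\<integral>\<^sup>+z. (\<lambda>z. ennreal (q ((norm z)\<^sup>2)) * indicator A z) (T z) \<partial>lborel)"
    by (subst em) (auto simp: orthogonal_transformation_norm[OF T] indicator_def intro!: nn_integral_cong)
  also have "\<dots> = (\<integral>\<^sup>+z. ennreal (q ((norm z)\<^sup>2)) * indicator A z \<partial>distr lborel borel T)"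
    by (subst nn_integral_distr) auto
  also have "\<dots> = emeasure (spherical_law q 0) A"
    by (simp add: lborel_distr_orthogonal[OF T] em)
  finally show "emeasure (distr (spherical_law q 0) borel T) A = emeasure (spherical_law q 0) A" .
qed (simp add: spherical_law_def)

lemma measure_spherical_law_orthogonal:
  fixes T :: "real^'n \<Rightarrow> real^'n"
  assumes d: "lebesgue_density (\<lambda>y :: real^'n. q ((norm y)\<^sup>2))" and T: "orthogonal_transformation T"
    and [measurable]: "A \<in> sets borel"
  shows "measure (spherical_law q 0) (T -` A) = measure (spherical_law q 0) A"
proof -
  have [measurable]: "T \<in> borel_measurable borel" by (rule orthogonal_transformation_measurable[OF T])
  have "measure (spherical_law q 0) A = measure (distr (spherical_law q 0) borel T) A"
    by (simp add: spherical_law_orthogonal[OF d T])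
  then show ?thesis by (subst (asm) measure_distr) (simp_all add: spherical_law_def)
qed

text \<open>The target density, together with the coordinate k that defines its marginal distribution function.\<close>
locale unimodal_law =
  fixes q :: "real \<Rightarrow> real" and k :: "'n::finite"
  assumes dens: "lebesgue_density (\<lambda>y :: real^'n. q ((norm y)\<^sup>2))"
    and unimodal: "unimodal (\<lambda>y :: real^'n. q ((norm y)\<^sup>2))"
begin

abbreviation "Q \<equiv> spherical_law q (0 :: real^'n)"
abbreviation "F \<equiv> coord_cdf q k"

sublocale Q: prob_space Q by (rule prob_spherical_law[OF dens])

lemma radial_measurable [measurable]: "(\<lambda>y :: real^'n. q ((norm y)\<^sup>2)) \<in> borel_measurable borel"
  using dens by (simp add: lebesgue_density_def)

lemma space_Q: "space Q = UNIV" by (simp add: spherical_law_def)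

lemma emeasure_Q:
  "A \<in> sets borel \<Longrightarrow> emeasure Q A = (\<integral>\<^sup>+z. ennreal (q ((norm z)\<^sup>2)) * indicator A z \<partial>lborel)"
  unfolding spherical_law_def using radial_measurable by (subst emeasure_density) (auto simp: spherical_def)

lemma cdf_eq: "F x = measure Q {y. y $ k \<le> x}"
  unfolding coord_cdf_def cdf_def by (subst measure_distr) (auto simp: space_Q vimage_def)

lemma cdf_halfspace:
  assumes e: "norm (e :: real^'n) = 1"
  shows "measure Q {y. y \<bullet> e \<le> x} = F x"
proof -
  have "norm (axis k 1 :: real^'n) = norm e" by (simp add: e)
  then obtain T :: "real^'n \<Rightarrow> real^'n" where T: "orthogonal_transformation T" "T (axis k 1) = e"
    using orthogonal_transformation_exists[of "axis k 1 :: real^'n" e] by blast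
  have "T -` {y. y \<bullet> e \<le> x} = {y. y $ k \<le> x}"
  proof -
    have "T y \<bullet> e = y $ k" for y
      using T(1) unfolding T(2)[symmetric] orthogonal_transformation_def by (simp add: inner_axis)
    then show ?thesis by auto
  qed
  then show ?thesis
    using measure_spherical_law_orthogonal[OF dens T(1), of "{y. y \<bullet> e \<le> x}"] by (simp add: cdf_eq)
qed

lemma hyperplane_null: "measure Q {y. y $ k = x} = 0"
proof -
  have "{y :: real^'n. y $ k = x} \<in> null_sets lebesgue"
    using negligible_standard_hyperplane[of "axis k 1 :: real^'n" x]
    by (simp add: inner_axis flip: negligible_iff_null_sets)
  then have "{y :: real^'n. y $ k = x} \<in> null_sets lborel"
    by (subst (asm) null_sets_completion_iff) auto
  then have "AE y in lborel. y \<notin> {y :: real^'n. y $ k = x}" by (rule AE_not_in)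
  then have "AE y in lborel. ennreal (q ((norm y)\<^sup>2)) * indicator {y :: real^'n. y $ k = x} y = 0"
    by eventually_elim simp
  then have "(\<integral>\<^sup>+y. ennreal (q ((norm y)\<^sup>2)) * indicator {y :: real^'n. y $ k = x} y \<partial>lborel) = (\<integral>\<^sup>+y. 0 \<partial>(lborel :: (real^'n) measure))"
    by (rule nn_integral_cong_AE)
  then have "emeasure Q {y. y $ k = x} = 0" by (subst emeasure_Q) auto
  then show ?thesis by (simp add: measure_def)
qed

text \<open>Point reflection preserves the law, and hyperplanes are null sets.\<close>
lemma cdf_reflect: "F (- x) = 1 - F x"
proof -
  have T: "orthogonal_transformation (uminus :: real^'n \<Rightarrow> real^'n)"
    by (simp add: orthogonal_transformation_def linear_uminus)
  have "F (- x) = measure Q (uminus -` {y. y $ k \<le> - x})"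
    unfolding cdf_eq by (rule measure_spherical_law_orthogonal[OF dens T, symmetric]) simp
  also have "uminus -` {y :: real^'n. y $ k \<le> - x} = {y. y $ k = x} \<union> (space Q - {y. y $ k \<le> x})"
    by (auto simp: space_Q)
  also have "measure Q \<dots> = measure Q {y. y $ k = x} + measure Q (space Q - {y. y $ k \<le> x})"
    by (rule Q.finite_measure_Union) (auto simp: space_Q spherical_law_def)
  also have "\<dots> = 1 - F x"
    by (subst Q.prob_compl) (simp_all add: hyperplane_null cdf_eq sets_spherical_law)
  finally show ?thesis .
qed

lemma cdf_mono: "x \<le> y \<Longrightarrow> F x \<le> F y"
  unfolding cdf_eq by (rule Q.finite_measure_mono) (auto simp: spherical_law_def)

lemma measure_spherical_law:
  assumes [measurable]: "A \<in> sets borel"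
  shows "(\<integral>y. spherical q \<mu> y * indicator A y \<partial>lborel) = measure Q {z. \<mu> + z \<in> A}"
proof -
  note [measurable] = spherical_measurable[OF dens]
  have [measurable]: "{z. \<mu> + z \<in> A} \<in> sets borel"
    using measurable_sets[of "\<lambda>z. \<mu> + z" borel borel A] by (simp add: vimage_def)
  have "(\<integral>y. spherical q \<mu> y * indicator A y \<partial>lborel) = enn2real (\<integral>\<^sup>+y. ennreal (spherical q \<mu> y * indicator A y) \<partial>lborel)"
    by (rule integral_eq_nn_integral) (auto simp: spherical_nonneg[OF dens])
  also have "(\<integral>\<^sup>+y. ennreal (spherical q \<mu> y * indicator A y) \<partial>lborel) = (\<integral>\<^sup>+y. ennreal (spherical q \<mu> y) * indicator A y \<partial>lborel)"
    by (intro nn_integral_cong) (auto split: split_indicator)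
  also have "\<dots> = emeasure Q {z. \<mu> + z \<in> A}"
    by (subst nn_integral_spherical[OF dens]) (auto simp: emeasure_Q indicator_def)
  finally show ?thesis by (simp add: measure_def)
qed

lemma spherical_integrable: "integrable lborel (spherical q (\<mu> :: real^'n))"
proof (rule integrableI_nonneg)
  show "spherical q \<mu> \<in> borel_measurable lborel" using spherical_measurable[OF dens] by simp
  have "(\<integral>\<^sup>+y. ennreal (spherical q \<mu> y) * 1 \<partial>lborel) = 1"
    using dens by (subst nn_integral_spherical[OF dens]) (auto simp: lebesgue_density_def)
  then show "(\<integral>\<^sup>+y. ennreal (spherical q \<mu> y) \<partial>lborel) < \<infinity>" by simp
qed (auto simp: spherical_nonneg[OF dens])

text \<open>The two densities are translates of each other and ordered by the distance to their centres. The first one is the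
larger on the half-space H of points closer to \<open>\<mu>\<close>. Both have integral 1, so the loss is twice the difference of the
masses that they give to H, which are values of the distribution function at plus and minus half the distance.\<close>
lemma l1_loss_eq:
  fixes \<mu> d :: "real^'n"
  shows "l1_loss q \<mu> (spherical q d) = ennreal (4 * F (norm (d - \<mu>) / 2) - 2)"
proof -
  note sm [measurable] = spherical_measurable[OF dens]
  define H where "H = {y. norm (y - \<mu>) \<le> norm (y - d)}"
  have H [measurable]: "H \<in> sets borel" unfolding H_def by measurable
  define \<Delta> where "\<Delta> = d - \<mu>"
  define s where "s = norm \<Delta> / 2"
  have ae: "AE y in lborel. \<bar>spherical q \<mu> y - spherical q d y\<bar>
      = 2 * (spherical q \<mu> y * indicator H y) - 2 * (spherical q d y * indicator H y) - spherical q \<mu> y + spherical q d y"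
    using AE_lborel_singleton[of \<mu>] AE_lborel_singleton[of d]
  proof eventually_elim
    case (elim y)
    show ?case
    proof (cases "y \<in> H")
      case True
      then have "0 < norm (y - \<mu>) \<and> norm (y - \<mu>) \<le> norm (y - d)" using elim by (simp add: H_def)
      then have "q ((norm (y - d))\<^sup>2) \<le> q ((norm (y - \<mu>))\<^sup>2)" using unimodal unfolding unimodal_def by blast
      then show ?thesis using True by (simp add: spherical_def)
    next
      case False
      then have "0 < norm (y - d) \<and> norm (y - d) \<le> norm (y - \<mu>)" using elim by (simp add: H_def)
      then have "q ((norm (y - \<mu>))\<^sup>2) \<le> q ((norm (y - d))\<^sup>2)" using unimodal unfolding unimodal_def by blast
      then show ?thesis using False by (simp add: spherical_def)
    qed
  qed
  have one: "(\<integral>y. spherical q c y \<partial>lborel) = 1" for c :: "real^'n"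
    using measure_spherical_law[of UNIV c] Q.prob_space by (simp add: space_Q)
  have i: "integrable lborel (spherical q c)" "integrable lborel (\<lambda>y. spherical q c y * indicator H y)" for c :: "real^'n"
    using spherical_integrable[of c] by (auto intro: integrable_real_mult_indicator)
  have "l1_loss q \<mu> (spherical q d) = ennreal (\<integral>y. \<bar>spherical q \<mu> y - spherical q d y\<bar> \<partial>lborel)"
    unfolding l1_loss_def by (rule nn_integral_eq_integral) (use i in auto)
  also have "(\<integral>y. \<bar>spherical q \<mu> y - spherical q d y\<bar> \<partial>lborel)
     = (\<integral>y. 2 * (spherical q \<mu> y * indicator H y) - 2 * (spherical q d y * indicator H y) - spherical q \<mu> y + spherical q d y \<partial>lborel)"
    by (rule integral_cong_AE[OF _ _ ae]) auto
  also have "\<dots> = 2 * measure Q {z. \<mu> + z \<in> H} - 2 * measure Q {z. d + z \<in> H}"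
    using i by (simp add: one measure_spherical_law)
  also have "\<dots> = 2 * F s - 2 * F (- s)"
  proof (cases "\<Delta> = 0")
    case True
    then have "d = \<mu>" by (simp add: \<Delta>_def)
    then show ?thesis using True by (simp add: s_def)
  next
    case False
    define e where "e = \<Delta> /\<^sub>R norm \<Delta>"
    have e: "norm e = 1" using False by (simp add: e_def)
    have ze: "z \<bullet> \<Delta> = 2 * s * (z \<bullet> e)" for z using False by (simp add: s_def e_def)
    have nD: "\<Delta> \<bullet> \<Delta> = (2 * s)\<^sup>2" by (simp add: s_def power2_norm_eq_inner)
    have s0: "0 < s" using False by (simp add: s_def)
    have "\<mu> + z \<in> H \<longleftrightarrow> z \<bullet> e \<le> s" for z
    proof -
      have "\<mu> + z \<in> H \<longleftrightarrow> norm z \<le> norm (z - \<Delta>)" by (simp add: H_def \<Delta>_def algebra_simps)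
      also have "\<dots> \<longleftrightarrow> z \<bullet> z \<le> (z - \<Delta>) \<bullet> (z - \<Delta>)" by (simp add: norm_le)
      also have "\<dots> \<longleftrightarrow> 2 * (z \<bullet> \<Delta>) \<le> \<Delta> \<bullet> \<Delta>" by (auto simp: inner_diff_left inner_diff_right inner_commute)
      also have "\<dots> \<longleftrightarrow> 4 * s * (z \<bullet> e) \<le> 4 * s * s" unfolding nD ze[of z] by (simp add: power2_eq_square)
      also have "\<dots> \<longleftrightarrow> z \<bullet> e \<le> s" by (subst mult_le_cancel_left_pos) (use s0 in auto)
      finally show ?thesis .
    qed
    moreover have "d + z \<in> H \<longleftrightarrow> z \<bullet> e \<le> - s" for z
    proof -
      have "d + z \<in> H \<longleftrightarrow> norm (z + \<Delta>) \<le> norm z" by (simp add: H_def \<Delta>_def algebra_simps)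
      also have "\<dots> \<longleftrightarrow> (z + \<Delta>) \<bullet> (z + \<Delta>) \<le> z \<bullet> z" by (simp add: norm_le)
      also have "\<dots> \<longleftrightarrow> 2 * (z \<bullet> \<Delta>) \<le> - (\<Delta> \<bullet> \<Delta>)" by (auto simp: inner_add_left inner_add_right inner_commute)
      also have "\<dots> \<longleftrightarrow> 4 * s * (z \<bullet> e) \<le> 4 * s * (- s)" unfolding nD ze[of z] by (simp add: power2_eq_square)
      also have "\<dots> \<longleftrightarrow> z \<bullet> e \<le> - s" by (subst mult_le_cancel_left_pos) (use s0 in auto)
      finally show ?thesis .
    qed
    ultimately show ?thesis by (simp add: cdf_halfspace[OF e])
  qed
  also have "\<dots> = 4 * F (norm (d - \<mu>) / 2) - 2" by (simp add: cdf_reflect s_def \<Delta>_def)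
  finally show ?thesis .
qed

lemma slab_measure:
  assumes "x \<le> y" shows "measure Q {w. x < w $ k \<and> w $ k \<le> y} = F y - F x"
proof -
  have "{w :: real^'n. x < w $ k \<and> w $ k \<le> y} = {w. w $ k \<le> y} - {w. w $ k \<le> x}" by auto
  also have "measure Q \<dots> = F y - F x"
    unfolding cdf_eq by (rule Q.finite_measure_Diff) (use assms in \<open>auto simp: spherical_law_def\<close>)
  finally show ?thesis .
qed

text \<open>An affine map in the coordinate k carries the slab between y and z onto the slab between x and y. It moves
points closer to the origin, where a unimodal density is larger.\<close>
lemma slab_compare:
  assumes "0 \<le> x" "x < y" "y < z"
  shows "(y - x) / (z - y) * (F z - F y) \<le> F y - F x"
proof -
  define s where "s = (y - x) / (z - y)"
  have s: "0 < s" using assms by (simp add: s_def)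
  have sz: "s * (z - y) = y - x" using assms by (simp add: s_def)
  define e where "e = (axis k 1 :: real^'n)"
  have e: "e \<in> Basis" "e \<bullet> e = 1" by (simp_all add: e_def inner_axis_axis)
  have we: "w \<bullet> e = w $ k" for w :: "real^'n" by (simp add: e_def inner_axis)
  have ew: "e \<bullet> w = w $ k" for w :: "real^'n" using we[of w] by (simp add: inner_commute)
  define c where "c = (\<lambda>j. if j = e then s else 1 :: real)"
  \<comment> \<open>A acts on the coordinate k as \<open>x + s * (w $ k - y)\<close>, which sends y to x and z to y.\<close>
  define A where "A = (\<lambda>w :: real^'n. (x - s * y) *\<^sub>R e + (\<Sum>j\<in>Basis. (c j * (w \<bullet> j)) *\<^sub>R j))"
  have A_eq: "A w = w + (x - s * y + (s - 1) * (w $ k)) *\<^sub>R e" for w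
  proof -
    have "(\<Sum>j\<in>Basis. (c j * (w \<bullet> j)) *\<^sub>R j) = (\<Sum>j\<in>Basis. (w \<bullet> j) *\<^sub>R j + (if j = e then ((s - 1) * (w \<bullet> e)) *\<^sub>R e else 0))"
      by (rule sum.cong) (auto simp: c_def algebra_simps)
    also have "\<dots> = w + ((s - 1) * (w \<bullet> e)) *\<^sub>R e"
      using e(1) by (simp add: sum.distrib euclidean_representation)
    finally show ?thesis by (simp add: A_def we algebra_simps)
  qed
  have Ak: "A w $ k = x + s * (w $ k - y)" for w
    by (simp add: A_eq e_def algebra_simps)
  have lb: "lborel = density (distr lborel borel A) (\<lambda>_. ennreal s)"
  proof -
    have "(\<Prod>j\<in>Basis. \<bar>c j\<bar>) = s"
      using e(1) s by (simp add: c_def if_distrib[of abs] prod.delta cong: if_cong)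
    then show ?thesis
      using lborel_affine_euclidean[of c "(x - s * y) *\<^sub>R e"] s by (simp add: A_def c_def)
  qed
  have [measurable]: "A \<in> borel_measurable borel" unfolding A_eq[abs_def] by measurable
  have "ennreal s * emeasure Q {w. y < w $ k \<and> w $ k \<le> z}
      = ennreal s * (\<integral>\<^sup>+w. ennreal (q ((norm w)\<^sup>2)) * indicator {w. y < w $ k \<and> w $ k \<le> z} w \<partial>lborel)"
    by (subst emeasure_Q) auto
  also have "\<dots> \<le> ennreal s * (\<integral>\<^sup>+w. ennreal (q ((norm (A w))\<^sup>2)) * indicator {w. x < w $ k \<and> w $ k \<le> y} (A w) \<partial>lborel)"
  proof (intro mult_left_mono nn_integral_mono)
    fix w :: "real^'n"
    show "ennreal (q ((norm w)\<^sup>2)) * indicator {w. y < w $ k \<and> w $ k \<le> z} w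
      \<le> ennreal (q ((norm (A w))\<^sup>2)) * indicator {w. x < w $ k \<and> w $ k \<le> y} (A w)"
    proof (cases "y < w $ k \<and> w $ k \<le> z")
      case True
      have "s * (w $ k - y) \<le> s * (z - y)" using True s by (intro mult_left_mono) auto
      then have up: "A w $ k \<le> y" using sz by (simp add: Ak)
      have lo: "x < A w $ k" using True s by (simp add: Ak)
      have "(norm (A w))\<^sup>2 = (norm w)\<^sup>2 - (w $ k)\<^sup>2 + (A w $ k)\<^sup>2"
        unfolding power2_norm_eq_inner A_eq
        by (simp add: inner_add_left inner_add_right e we ew) (simp add: e_def power2_eq_square algebra_simps)
      moreover have "(A w $ k)\<^sup>2 \<le> (w $ k)\<^sup>2" using up lo True assms by (intro power_mono) auto
      ultimately have "(norm (A w))\<^sup>2 \<le> (norm w)\<^sup>2" by linarith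
      then have "norm (A w) \<le> norm w" by (rule power2_le_imp_le) simp
      moreover have "A w \<noteq> 0"
      proof
        assume "A w = 0"
        then have "A w $ k = 0" by simp
        then show False using lo assms by linarith
      qed
      then have "0 < norm (A w)" by simp
      ultimately have "q ((norm w)\<^sup>2) \<le> q ((norm (A w))\<^sup>2)" using unimodal unfolding unimodal_def by blast
      then show ?thesis using True up lo by (simp add: ennreal_leI)
    qed simp
  qed simp
  also have "\<dots> = (\<integral>\<^sup>+w. ennreal (q ((norm w)\<^sup>2)) * indicator {w. x < w $ k \<and> w $ k \<le> y} w \<partial>lborel)"
    by (subst (2) lb) (simp add: nn_integral_density nn_integral_distr nn_integral_cmult)
  also have "\<dots> = emeasure Q {w. x < w $ k \<and> w $ k \<le> y}" by (subst emeasure_Q) auto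
  finally have "s * measure Q {w. y < w $ k \<and> w $ k \<le> z} \<le> measure Q {w. x < w $ k \<and> w $ k \<le> y}"
    using s by (simp add: Q.emeasure_eq_measure flip: ennreal_mult)
  then show ?thesis using assms by (simp add: slab_measure s_def)
qed

lemma cdf_concave: "convex_on {0..} (\<lambda>x. - F x)"
proof (rule convex_on_linorderI)
  fix t x z :: real assume t: "0 < t" "t < 1" and xz: "x \<in> {0..}" "z \<in> {0..}" "x < z"
  define y where "y = (1 - t) * x + t * z"
  have yx: "y - x = t * (z - x)" and zy: "z - y = (1 - t) * (z - x)" by (simp_all add: y_def algebra_simps)
  have "0 < y - x" "0 < z - y" unfolding yx zy using t xz by simp_all
  then have "(y - x) / (z - y) * (F z - F y) \<le> F y - F x" using xz by (intro slab_compare) auto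
  also have "(y - x) / (z - y) = t / (1 - t)" unfolding yx zy using xz by simp
  finally have "t * (F z - F y) \<le> (1 - t) * (F y - F x)" using t by (simp add: field_simps)
  then have "- F y \<le> (1 - t) * - F x + t * - F z" by (simp add: algebra_simps)
  then show "- F ((1 - t) *\<^sub>R x + t *\<^sub>R z) \<le> (1 - t) * - F x + t * - F z"
    by (simp add: y_def)
qed simp

text \<open>A concave function has a supergradient f at each interior point. Supergradients are non-increasing, hence
continuous outside a countable set N, and at a point of continuity the supergradient is the derivative.\<close>
lemma marginal_density_supergradient:
  obtains f N where "countable N" "f \<in> borel_measurable borel"
    "\<And>x. 0 \<le> f x" "\<And>x y. 0 < x \<Longrightarrow> 0 \<le> y \<Longrightarrow> F y \<le> F x + f x * (y - x)"
    "\<And>x. 0 < x \<Longrightarrow> x \<notin> N \<Longrightarrow> marginal_density q k x = f x"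
proof -
  have "\<exists>g. \<forall>y\<ge>0. F y \<le> F x + g * (y - x)" if "0 < x" for x
  proof -
    let ?g = "- Inf ((\<lambda>t. (- F x - - F t) / (x - t)) ` ({x<..} \<inter> {0..}))"
    have "- F x + (- ?g) * (y - x) \<le> - F y" if "0 \<le> y" for y
      using convex_le_Inf_differential[OF cdf_concave, of x y] \<open>0 < x\<close> that by simp
    then show ?thesis by (intro exI[of _ ?g]) force
  qed
  then obtain g where g: "\<And>x y. 0 < x \<Longrightarrow> 0 \<le> y \<Longrightarrow> F y \<le> F x + g x * (y - x)" by metis
  have anti: "g y \<le> g x" if "0 < x" "x \<le> y" for x y
  proof (cases "x = y")
    case False
    then have "g y * (y - x) \<le> g x * (y - x)"
      using g[of x y] g[of y x] that by (simp add: algebra_simps)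
    then show ?thesis using False that by simp
  qed simp
  have g0: "0 \<le> g x" if "0 < x" for x using g[of x "x + 1"] cdf_mono[of x "x + 1"] that by simp
  have mono: "mono_on {0<..} (\<lambda>x. - g x)" by (auto simp: mono_on_def anti)
  define N where "N = {x \<in> {0<..}. \<not> isCont (\<lambda>x. - g x) x}"
  have "countable N" unfolding N_def by (rule mono_on_ctble_discont_open[OF open_greaterThan mono])
  moreover define f where "f = (\<lambda>x. indicator {0<..} x *\<^sub>R g x)"
  have "(\<lambda>x. indicator {0<..} x *\<^sub>R - g x) \<in> borel_measurable borel"
    using borel_measurable_mono_on_fnc[OF mono] by (subst (asm) borel_measurable_restrict_space_iff) auto
  then have "f \<in> borel_measurable borel" unfolding f_def by (simp add: scaleR_minus_right)
  moreover have "marginal_density q k x = f x" if x: "0 < x" "x \<notin> N" for x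
  proof -
    have "isCont (\<lambda>x. - g x) x" using x by (simp add: N_def)
    then have cont: "isCont g x" using continuous_minus[of "at x" "\<lambda>x. - g x"] by simp
    have "((\<lambda>h. g (x + h) - g x) \<longlongrightarrow> 0) (at 0)"
      using cont by (simp add: isCont_iff LIM_zero_iff)
    then have lim: "((\<lambda>h. \<bar>g (x + h) - g x\<bar>) \<longlongrightarrow> 0) (at 0)" by (rule tendsto_rabs_zero)
    have "((\<lambda>h. (F (x + h) - F x) / h - g x) \<longlongrightarrow> 0) (at 0)"
    proof (rule Lim_null_comparison[OF _ lim])
      have "\<forall>\<^sub>F h in at 0. \<bar>h\<bar> < x \<and> h \<noteq> 0"
        using x by (auto simp: eventually_at intro!: exI[of _ x])
      then show "\<forall>\<^sub>F h in at 0. norm ((F (x + h) - F x) / h - g x) \<le> \<bar>g (x + h) - g x\<bar>"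
      proof eventually_elim
        case (elim h)
        then have xh: "0 < x + h" by linarith
        have up: "F (x + h) - F x \<le> g x * h" using g[of x "x + h"] x xh by simp
        have lo: "g (x + h) * h \<le> F (x + h) - F x" using g[of "x + h" x] x xh by simp
        show ?case
        proof (cases "0 < h")
          case True
          then have "(F (x + h) - F x) / h \<le> g x" "g (x + h) \<le> (F (x + h) - F x) / h"
            using up lo by (auto simp: field_simps)
          then show ?thesis by simp
        next
          case False
          then have "g x \<le> (F (x + h) - F x) / h" "(F (x + h) - F x) / h \<le> g (x + h)"
            using up lo elim by (auto simp: field_simps)
          then show ?thesis by simp
        qed
      qed
    qed
    then have "(F has_real_derivative g x) (at x)" by (simp add: DERIV_def LIM_zero_iff)
    then show ?thesis using x by (simp add: marginal_density_def DERIV_imp_deriv f_def)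
  qed
  moreover have "0 \<le> f x" for x using g0 by (auto simp: f_def split: split_indicator)
  moreover have "F y \<le> F x + f x * (y - x)" if "0 < x" "0 \<le> y" for x y
    using g[OF that] that by (simp add: f_def)
  ultimately show thesis using that by blast
qed

end

section \<open>Comparison of the two \<open>L\<^sub>1\<close> risks\<close>

text \<open>The density, with respect to \<open>radial_measure\<close>, of the squared distance t under the reweighted law of X.\<close>
definition radial_weight :: "(real \<Rightarrow> real) \<Rightarrow> (real \<Rightarrow> real) \<Rightarrow> real \<Rightarrow> real" where
  "radial_weight p f t = (if 0 < t then p t * (f (sqrt t / 2) / sqrt t) else 0)"

text \<open>A measurable radial function on the whole space has a measurable profile, by restriction to a ray.\<close>
lemma radial_profile:
  assumes d: "lebesgue_density (\<lambda>y :: real^'n. p ((norm y)\<^sup>2))"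
  shows "(\<lambda>t. if 0 < t then p t else 0) \<in> borel_measurable borel" and "0 \<le> t \<Longrightarrow> 0 \<le> p t"
proof -
  have [measurable]: "(\<lambda>y :: real^'n. p ((norm y)\<^sup>2)) \<in> borel_measurable borel"
    using d by (simp add: lebesgue_density_def)
  have eq: "(norm (sqrt t *\<^sub>R axis undefined 1 :: real^'n))\<^sup>2 = t" if "0 \<le> t" for t
    using that by (simp add: power_mult_distrib)
  have "(\<lambda>t. if 0 < t then (\<lambda>y :: real^'n. p ((norm y)\<^sup>2)) (sqrt t *\<^sub>R axis undefined 1) else 0) \<in> borel_measurable borel"
    by measurable
  also have "(\<lambda>t. if 0 < t then (\<lambda>y :: real^'n. p ((norm y)\<^sup>2)) (sqrt t *\<^sub>R axis undefined 1) else 0) = (\<lambda>t. if 0 < t then p t else 0)"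
    using eq by (auto simp del: norm_scaleR)
  finally show "(\<lambda>t. if 0 < t then p t else 0) \<in> borel_measurable borel" .
  assume "0 \<le> t"
  have "0 \<le> p ((norm (sqrt t *\<^sub>R axis undefined 1 :: real^'n))\<^sup>2)" using d unfolding lebesgue_density_def by blast
  then show "0 \<le> p t" using eq[OF \<open>0 \<le> t\<close>] by simp
qed

lemma radial_weight_measurable:
  assumes d: "lebesgue_density (\<lambda>y :: real^'n. p ((norm y)\<^sup>2))" and [measurable]: "f \<in> borel_measurable borel"
  shows "radial_weight p f \<in> borel_measurable borel"
proof -
  note [measurable] = radial_profile(1)[OF d]
  have "(\<lambda>t. (if 0 < t then p t else 0) * (f (sqrt t / 2) / sqrt t)) \<in> borel_measurable borel" by measurable
  also have "(\<lambda>t. (if 0 < t then p t else 0) * (f (sqrt t / 2) / sqrt t)) = radial_weight p f"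
    by (auto simp: radial_weight_def)
  finally show ?thesis .
qed

text \<open>Here f is a supergradient of F, a version of the marginal density that is defined everywhere. W is the law
of the squared distance under the reweighted law of X, and \<open>a_le\<close> is the bound on the shrinkage constant.\<close>
locale plug_in_comparison = unimodal_law q k for q and k :: "'n::finite" +
  fixes p f r :: "real \<Rightarrow> real" and a :: real and \<tau> W :: "real measure"
  assumes tau_def: "\<tau> = radial_measure TYPE(real^'n)"
    and W_def: "W = density \<tau> (\<lambda>t. ennreal (radial_weight p f t))"
    and dim: "4 \<le> CARD('n)"
    and dens_p: "lebesgue_density (\<lambda>x :: real^'n. p ((norm x)\<^sup>2))"
    and f_measurable [measurable]: "f \<in> borel_measurable borel"
    and f_nonneg: "0 \<le> f x"
    and f_supergradient: "0 < x \<Longrightarrow> 0 \<le> y \<Longrightarrow> F y \<le> F x + f x * (y - x)"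
    and r_measurable [measurable]: "r \<in> borel_measurable borel"
    and r_nonneg: "0 \<le> r t" and r_le_1: "r t \<le> 1"
    and r_mono: "s \<le> t \<Longrightarrow> r s \<le> r t"
    and r_ratio: "0 < s \<Longrightarrow> s \<le> t \<Longrightarrow> r t / t \<le> r s / s"
    and a_pos: "0 < a"
    and weight_finite: "(\<integral>\<^sup>+t. ennreal (radial_weight p f t) \<partial>\<tau>) < \<infinity>"
    and weight_inv_finite: "(\<integral>\<^sup>+t. ennreal (radial_weight p f t / t) \<partial>\<tau>) < \<infinity>"
    and a_le: "ennreal a * (\<integral>\<^sup>+t. ennreal (radial_weight p f t / t) \<partial>\<tau>)
      \<le> ennreal (2 * (real CARD('n) - 2) / real CARD('n)) * (\<integral>\<^sup>+t. ennreal (radial_weight p f t) \<partial>\<tau>)"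
begin

lemma sets_tau [measurable_cong]: "sets \<tau> = sets borel" by (simp add: tau_def radial_measure_def)

lemma weight_measurable [measurable]: "radial_weight p f \<in> borel_measurable borel"
  by (rule radial_weight_measurable[OF dens_p f_measurable])

lemma weight_nonneg: "0 \<le> radial_weight p f t"
  using radial_profile(2)[OF dens_p, of t] f_nonneg by (simp add: radial_weight_def)

lemma sets_W [measurable_cong]: "sets W = sets borel" by (simp add: W_def sets_tau)

lemma emeasure_W: "emeasure W (space W) = (\<integral>\<^sup>+t. ennreal (radial_weight p f t) \<partial>\<tau>)"
  unfolding W_def by (subst emeasure_density) (auto intro!: nn_integral_cong)

lemma finite_W: "finite_measure W"
  by (rule finite_measureI) (use weight_finite emeasure_W in auto)

lemma W_pos: "AE t in W. 0 < t"
proof -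
  have m: "(\<lambda>t. ennreal (radial_weight p f t)) \<in> borel_measurable \<tau>" by measurable
  show ?thesis unfolding W_def AE_density[OF m] by (auto simp: radial_weight_def split: if_splits)
qed

lemma nn_integral_W_inv: "(\<integral>\<^sup>+t. ennreal (1 / t) \<partial>W) = (\<integral>\<^sup>+t. ennreal (radial_weight p f t / t) \<partial>\<tau>)"
  unfolding W_def
  by (subst nn_integral_density) (auto intro!: nn_integral_cong simp: weight_nonneg simp flip: ennreal_mult')

lemma W_inv_integrable: "integrable W (\<lambda>t. 1 / t)"
proof (rule integrableI_nonneg)
  show "AE t in W. 0 \<le> 1 / t" using W_pos by eventually_elim simp
  show "(\<integral>\<^sup>+t. ennreal (1 / t) \<partial>W) < \<infinity>" using weight_inv_finite by (simp add: nn_integral_W_inv)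
qed simp

lemma a_le_W: "a * (\<integral>t. 1 / t \<partial>W) \<le> 2 * (real CARD('n) - 2) / real CARD('n) * measure W (space W)"
proof -
  have nn: "AE t in W. 0 \<le> 1 / t" using W_pos by eventually_elim simp
  have "ennreal (a * (\<integral>t. 1 / t \<partial>W)) = ennreal a * (\<integral>\<^sup>+t. ennreal (1 / t) \<partial>W)"
    using a_pos by (subst nn_integral_eq_integral[OF W_inv_integrable nn]) (simp add: ennreal_mult')
  also have "\<dots> \<le> ennreal (2 * (real CARD('n) - 2) / real CARD('n)) * emeasure W (space W)"
    using a_le by (simp add: nn_integral_W_inv emeasure_W)
  also have "\<dots> = ennreal (2 * (real CARD('n) - 2) / real CARD('n) * measure W (space W))"
    using dim by (subst finite_measure.emeasure_eq_measure[OF finite_W]) (rule ennreal_mult'[symmetric], simp)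
  finally show ?thesis using dim by (subst (asm) ennreal_le_iff) auto
qed

lemma shrinkage_cosine:
  assumes e: "norm (e :: real^'n) = 1"
  shows "shrinkage (cosine_measure e) (CARD('n)) r"
proof -
  have "norm (axis k 1 :: real^'n) = norm e" by (simp add: e)
  then obtain T :: "real^'n \<Rightarrow> real^'n" where T: "orthogonal_transformation T" "T (axis k 1) = e"
    using orthogonal_transformation_exists[of "axis k 1 :: real^'n" e] by blast
  have "cosine_law (cosine_measure (axis k 1 :: real^'n)) (DIM(real^'n))"
    by (rule cosine_law_Basis) (use dim in auto)
  then interpret cosine_law "cosine_measure e" "CARD('n)"
    using cosine_measure_orthogonal[OF T(1), of "axis k 1"] by (simp add: T(2))
  show ?thesis
    by unfold_locales (auto simp: r_nonneg r_le_1 intro: r_mono r_ratio)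
qed

text \<open>The law of X, weighted by the slope at X of the loss as a function of the squared distance to \<open>\<mu>\<close>.\<close>
definition "slope_law \<mu> = density (spherical_law p \<mu>) (\<lambda>x :: real^'n. ennreal (f (norm (x - \<mu>) / 2) / norm (x - \<mu>)))"

lemma slope_law_polar:
  fixes e \<mu> :: "real^'n"
  shows "distr (slope_law \<mu>) (borel \<Otimes>\<^sub>M borel) (\<lambda>x. ((norm (x - \<mu>))\<^sup>2, cosine e (x - \<mu>))) = W \<Otimes>\<^sub>M cosine_measure e"
proof -
  interpret L: prob_space "cosine_measure e" by (rule prob_cosine_measure)
  have [measurable_cong]: "sets (cosine_measure e) = sets borel" by (simp add: cosine_measure_def)
  have [measurable_cong]: "sets (slope_law \<mu>) = sets borel" by (simp add: slope_law_def sets_spherical_law)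
  note pm [measurable] = spherical_measurable[OF dens_p]
  have p0[measurable]: "(\<lambda>y :: real^'n. p ((norm y)\<^sup>2)) \<in> borel_measurable borel"
    using dens_p by (simp add: lebesgue_density_def)
  have "W \<Otimes>\<^sub>M cosine_measure e = density \<tau> (\<lambda>t. ennreal (radial_weight p f t)) \<Otimes>\<^sub>M density (cosine_measure e) (\<lambda>_. 1)"
    by (simp add: W_def density_1)
  also have "\<dots> = density (\<tau> \<Otimes>\<^sub>M cosine_measure e) (\<lambda>(t, u). ennreal (radial_weight p f t) * 1)"
    by (rule pair_measure_density) (auto simp: density_1 L.sigma_finite_measure_axioms)
  finally have W_eq: "W \<Otimes>\<^sub>M cosine_measure e = density (\<tau> \<Otimes>\<^sub>M cosine_measure e) (\<lambda>(t, u). ennreal (radial_weight p f t))"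
    by simp
  show ?thesis
  proof (rule measure_eqI)
    show "sets (distr (slope_law \<mu>) (borel \<Otimes>\<^sub>M borel) (\<lambda>x. ((norm (x - \<mu>))\<^sup>2, cosine e (x - \<mu>)))) = sets (W \<Otimes>\<^sub>M cosine_measure e)"
      by (simp, intro sets_pair_measure_cong[symmetric]) (auto simp: sets_W cosine_measure_def)
    fix A assume "A \<in> sets (distr (slope_law \<mu>) (borel \<Otimes>\<^sub>M borel) (\<lambda>x. ((norm (x - \<mu>))\<^sup>2, cosine e (x - \<mu>))))"
    then have A[measurable]: "A \<in> sets (borel \<Otimes>\<^sub>M borel)" by simp
    have A': "A \<in> sets (\<tau> \<Otimes>\<^sub>M cosine_measure e)" using A by measurable
    let ?g = "\<lambda>x. ennreal (f (norm (x - \<mu>) / 2) / norm (x - \<mu>))"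
    have "emeasure (distr (slope_law \<mu>) (borel \<Otimes>\<^sub>M borel) (\<lambda>x. ((norm (x - \<mu>))\<^sup>2, cosine e (x - \<mu>)))) A
        = (\<integral>\<^sup>+y. indicator A y \<partial>distr (slope_law \<mu>) (borel \<Otimes>\<^sub>M borel) (\<lambda>x. ((norm (x - \<mu>))\<^sup>2, cosine e (x - \<mu>))))"
      by (subst nn_integral_indicator) auto
    also have "\<dots> = (\<integral>\<^sup>+x. indicator A ((norm (x - \<mu>))\<^sup>2, cosine e (x - \<mu>)) \<partial>slope_law \<mu>)"
      by (rule nn_integral_distr) auto
    also have "\<dots> = (\<integral>\<^sup>+x. ?g x * indicator A ((norm (x - \<mu>))\<^sup>2, cosine e (x - \<mu>)) \<partial>spherical_law p \<mu>)"
      unfolding slope_law_def by (rule nn_integral_density) auto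
    also have "\<dots> = (\<integral>\<^sup>+z. ennreal (p ((norm z)\<^sup>2)) * (ennreal (f (norm z / 2) / norm z) * indicator A ((norm z)\<^sup>2, cosine e z)) \<partial>lborel)"
      by (subst nn_integral_spherical_law[OF dens_p]) auto
    also have "\<dots> = (\<integral>\<^sup>+z. (\<lambda>(t, u). ennreal (radial_weight p f t) * indicator A (t, u)) ((norm z)\<^sup>2, cosine e z) \<partial>lborel)"
    proof (rule nn_integral_cong)
      fix z :: "real^'n"
      have "ennreal (p ((norm z)\<^sup>2)) * ennreal (f (norm z / 2) / norm z) = ennreal (radial_weight p f ((norm z)\<^sup>2))"
        using radial_profile(2)[OF dens_p, of "(norm z)\<^sup>2"]
        by (cases "z = 0") (auto simp: radial_weight_def simp flip: ennreal_mult')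
      then show "ennreal (p ((norm z)\<^sup>2)) * (ennreal (f (norm z / 2) / norm z) * indicator A ((norm z)\<^sup>2, cosine e z))
        = (\<lambda>(t, u). ennreal (radial_weight p f t) * indicator A (t, u)) ((norm z)\<^sup>2, cosine e z)"
        by (simp add: mult.assoc[symmetric])
    qed
    also have "\<dots> = (\<integral>\<^sup>+y. (\<lambda>(t, u). ennreal (radial_weight p f t) * indicator A (t, u)) y
        \<partial>distr lborel (borel \<Otimes>\<^sub>M borel) (\<lambda>z :: real^'n. ((norm z)\<^sup>2, cosine e z)))"
      by (rule nn_integral_distr[symmetric]) auto
    also have "\<dots> = (\<integral>\<^sup>+y. (\<lambda>(t, u). ennreal (radial_weight p f t) * indicator A (t, u)) y \<partial>(\<tau> \<Otimes>\<^sub>M cosine_measure e))"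
      using dim by (subst polar_decomposition) (auto simp: tau_def)
    also have "\<dots> = emeasure (W \<Otimes>\<^sub>M cosine_measure e) A"
      unfolding W_eq by (subst emeasure_density[OF _ A']) (auto intro!: nn_integral_cong)
    finally show "emeasure (distr (slope_law \<mu>) (borel \<Otimes>\<^sub>M borel) (\<lambda>x. ((norm (x - \<mu>))\<^sup>2, cosine e (x - \<mu>)))) A
      = emeasure (W \<Otimes>\<^sub>M cosine_measure e) A" .
  qed
qed

lemma cdf_bounds: "F x \<le> 1" "0 \<le> x \<Longrightarrow> 1 / 2 \<le> F x"
proof -
  show "F x \<le> 1" by (simp add: cdf_eq)
  assume "0 \<le> x"
  then have "F (- x) \<le> F x" by (intro cdf_mono) simp
  then show "1 / 2 \<le> F x" by (simp add: cdf_reflect)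
qed

lemma cdf_measurable [measurable]: "F \<in> borel_measurable borel"
  by (rule borel_measurable_mono) (simp add: mono_def cdf_mono)

lemma l1_risk_plug_in:
  fixes \<delta> :: "real^'n \<Rightarrow> real^'n"
  assumes [measurable]: "\<delta> \<in> borel_measurable borel"
  shows "integrable (spherical_law p \<mu>) (\<lambda>x. 4 * F (norm (\<delta> x - \<mu>) / 2) - 2)"
    and "l1_risk p q (plug_in q \<delta>) \<mu> = ennreal (\<integral>x. 4 * F (norm (\<delta> x - \<mu>) / 2) - 2 \<partial>spherical_law p \<mu>)"
    and "0 \<le> (\<integral>x. 4 * F (norm (\<delta> x - \<mu>) / 2) - 2 \<partial>spherical_law p \<mu>)"
proof -
  interpret P: prob_space "spherical_law p \<mu>" by (rule prob_spherical_law[OF dens_p])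
  have b: "1 / 2 \<le> F (norm (\<delta> x - \<mu>) / 2)" "F (norm (\<delta> x - \<mu>) / 2) \<le> 1" for x
    by (rule cdf_bounds(2), simp) (rule cdf_bounds(1))
  then have b': "0 \<le> 4 * F (norm (\<delta> x - \<mu>) / 2) - 2" "4 * F (norm (\<delta> x - \<mu>) / 2) - 2 \<le> 2" for x
    using b[of x] by linarith+
  show i: "integrable (spherical_law p \<mu>) (\<lambda>x. 4 * F (norm (\<delta> x - \<mu>) / 2) - 2)"
  proof (rule P.integrable_const_bound[where B=2])
    show "AE x in spherical_law p \<mu>. norm (4 * F (norm (\<delta> x - \<mu>) / 2) - 2) \<le> 2"
    proof (rule AE_I2)
      fix x
      show "norm (4 * F (norm (\<delta> x - \<mu>) / 2) - 2) \<le> 2"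
        using b'[of x] unfolding real_norm_def abs_le_iff by linarith
    qed
  qed simp
  show "l1_risk p q (plug_in q \<delta>) \<mu> = ennreal (\<integral>x. 4 * F (norm (\<delta> x - \<mu>) / 2) - 2 \<partial>spherical_law p \<mu>)"
    unfolding l1_risk_def plug_in_def l1_loss_eq
    by (rule nn_integral_eq_integral[OF i]) (use b' in auto)
  show "0 \<le> (\<integral>x. 4 * F (norm (\<delta> x - \<mu>) / 2) - 2 \<partial>spherical_law p \<mu>)"
    by (rule integral_nonneg_AE) (use b' in auto)
qed

lemma baranchik_measurable [measurable]: "baranchik a r \<in> borel_measurable (borel :: (real^'n) measure)"
  unfolding baranchik_def[abs_def] by measurable

lemma baranchik_excess:
  fixes \<mu> x e :: "real^'n"
  assumes \<mu>: "\<mu> = m *\<^sub>R e" and e: "norm e = 1"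
  shows "(norm (baranchik a r x - \<mu>))\<^sup>2 - (norm (x - \<mu>))\<^sup>2
    = a * shrinkage.excess r a m ((norm (x - \<mu>))\<^sup>2) (cosine e (x - \<mu>))"
proof -
  interpret shrinkage "cosine_measure e" "CARD('n)" r by (rule shrinkage_cosine[OF e])
  define T where "T = (norm x)\<^sup>2"
  define t where "t = (norm (x - \<mu>))\<^sup>2"
  have \<mu>\<mu>: "\<mu> \<bullet> \<mu> = m\<^sup>2" using e by (simp add: \<mu> power2_eq_square norm_eq_1)
  have sq: "sq_norm m t (cosine e (x - \<mu>)) = T"
  proof -
    have "sqrt t * cosine e (x - \<mu>) = (x - \<mu>) \<bullet> e" by (simp add: t_def cosine_def)
    then have "2 * m * sqrt t * cosine e (x - \<mu>) = 2 * ((x - \<mu>) \<bullet> \<mu>)"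
      by (simp add: \<mu> mult.assoc)
    then show ?thesis
      unfolding sq_norm_def T_def t_def power2_norm_eq_inner \<mu>\<mu>[symmetric]
      by (simp add: inner_diff_left inner_diff_right inner_commute)
  qed
  have tT: "2 * (x \<bullet> (x - \<mu>)) = T + t - m\<^sup>2"
    unfolding T_def t_def power2_norm_eq_inner \<mu>\<mu>[symmetric]
    by (simp add: inner_diff_left inner_diff_right inner_commute)
  have "baranchik a r x - \<mu> = (x - \<mu>) - (a * (r T / T)) *\<^sub>R x"
    by (simp add: baranchik_def T_def algebra_simps)
  moreover have "(norm (y - c *\<^sub>R x))\<^sup>2 = (norm y)\<^sup>2 - c * (2 * (x \<bullet> y)) + c\<^sup>2 * (norm x)\<^sup>2" for y c
    unfolding power2_norm_eq_inner
    by (simp add: inner_diff_left inner_diff_right inner_commute power2_eq_square algebra_simps)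
  ultimately have "(norm (baranchik a r x - \<mu>))\<^sup>2 = t - a * (r T / T) * (2 * (x \<bullet> (x - \<mu>))) + (a * (r T / T))\<^sup>2 * T"
    by (simp only: T_def t_def)
  also have "(a * (r T / T))\<^sup>2 * T = a * (a * (r T)\<^sup>2 / T)" by (simp add: power2_eq_square)
  finally have *: "(norm (baranchik a r x - \<mu>))\<^sup>2
    = t - a * (r T / T) * (2 * (x \<bullet> (x - \<mu>))) + a * (a * (r T)\<^sup>2 / T)" .
  have "(norm (baranchik a r x - \<mu>))\<^sup>2 - t = a * (a * (r T)\<^sup>2 / T - r T * (T + t - m\<^sup>2) / T)"
  proof -
    have "z - t = a * (B - A)" if "z = t - A' + a * B" "A' = a * A" for z A A' B :: real
      using that by (simp add: algebra_simps)
    from this[OF *[unfolded tT]] show ?thesis by simp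
  qed
  then show ?thesis by (simp add: excess_def sq flip: t_def)
qed

text \<open>As a function of the squared distance the loss lies below its tangent at \<open>t\<^sup>2\<close>, because F lies below its tangent at
t/2 and the square root lies below its tangent at \<open>t\<^sup>2\<close>.\<close>
lemma loss_tangent:
  assumes t: "0 < t" and s: "0 \<le> s"
  shows "4 * F (s / 2) - 2 \<le> 4 * F (t / 2) - 2 + f (t / 2) / t * (s\<^sup>2 - t\<^sup>2)"
proof -
  have "F (s / 2) \<le> F (t / 2) + f (t / 2) * (s / 2 - t / 2)" using t s by (intro f_supergradient) auto
  moreover have "2 * (s - t) \<le> (s\<^sup>2 - t\<^sup>2) / t"
  proof -
    have "0 \<le> (s - t)\<^sup>2" by simp
    then have "2 * (s - t) * t \<le> s\<^sup>2 - t\<^sup>2" by (simp add: power2_eq_square algebra_simps)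
    then show ?thesis using t by (simp add: field_simps)
  qed
  then have "f (t / 2) * (2 * (s - t)) \<le> f (t / 2) * ((s\<^sup>2 - t\<^sup>2) / t)" using f_nonneg by (rule mult_left_mono)
  moreover have "4 * (f (t / 2) * (s / 2 - t / 2)) = f (t / 2) * (2 * (s - t))" by (simp add: algebra_simps)
  moreover have "f (t / 2) / t * (s\<^sup>2 - t\<^sup>2) = f (t / 2) * ((s\<^sup>2 - t\<^sup>2) / t)" by simp
  ultimately show ?thesis by linarith
qed

text \<open>Integrating the tangent bound turns the difference of the \<open>L\<^sub>1\<close> risks into a quadratic risk difference under
\<open>slope_law\<close>, which is read off in polar coordinates.\<close>
lemma risk_difference_le:
  fixes \<mu> e :: "real^'n"
  assumes \<mu>: "\<mu> = m *\<^sub>R e" and e: "norm e = 1" and m: "0 \<le> m"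
  shows "(\<integral>x. 4 * F (norm (baranchik a r x - \<mu>) / 2) - 2 \<partial>spherical_law p \<mu>)
    \<le> (\<integral>x. 4 * F (norm (x - \<mu>) / 2) - 2 \<partial>spherical_law p \<mu>)
      + a * (\<integral>(t, u). shrinkage.excess r a m t u \<partial>(W \<Otimes>\<^sub>M cosine_measure e))"
proof -
  interpret S: shrinkage "cosine_measure e" "CARD('n)" r by (rule shrinkage_cosine[OF e])
  let ?P = "spherical_law p \<mu>"
  have [measurable_cong]: "sets (slope_law \<mu>) = sets borel" by (simp add: slope_law_def sets_spherical_law)
  define G where "G = (\<lambda>x. f (norm (x - \<mu>) / 2) / norm (x - \<mu>))"
  have [measurable]: "G \<in> borel_measurable borel" unfolding G_def by measurable
  have G0: "0 \<le> G x" for x by (simp add: G_def f_nonneg)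
  define E where "E = (\<lambda>x. S.excess a m ((norm (x - \<mu>))\<^sup>2) (cosine e (x - \<mu>)))"
  have Em: "E = (\<lambda>x. (\<lambda>(t,u). S.excess a m t u) ((norm (x - \<mu>))\<^sup>2, cosine e (x - \<mu>)))" by (simp add: E_def)
  have [measurable]: "E \<in> borel_measurable borel" unfolding Em by measurable
  have SL: "slope_law \<mu> = density ?P (\<lambda>x. ennreal (G x))" by (simp add: slope_law_def G_def)
  have int: "integrable (W \<Otimes>\<^sub>M cosine_measure e) (\<lambda>(t, u). S.excess a m t u)"
    by (rule S.integrable_radial_excess[OF finite_W sets_W W_pos W_inv_integrable a_pos a_le_W m])
  have "integrable (slope_law \<mu>) E"
    using int unfolding slope_law_polar[symmetric, of e \<mu>] Em by (subst (asm) integrable_distr_eq) auto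
  then have GE: "integrable ?P (\<lambda>x. G x * E x)"
    unfolding SL by (subst (asm) integrable_density) (auto simp: G0)
  have "(\<integral>x. G x * E x \<partial>?P) = (\<integral>x. E x \<partial>slope_law \<mu>)"
    unfolding SL by (subst integral_density) (auto simp: G0)
  also have "\<dots> = (\<integral>(t, u). S.excess a m t u \<partial>(W \<Otimes>\<^sub>M cosine_measure e))"
    unfolding slope_law_polar[symmetric, of e \<mu>] Em by (subst integral_distr) auto
  finally have val: "(\<integral>x. G x * E x \<partial>?P) = (\<integral>(t, u). S.excess a m t u \<partial>(W \<Otimes>\<^sub>M cosine_measure e))" .
  have i1: "integrable ?P (\<lambda>x. 4 * F (norm (baranchik a r x - \<mu>) / 2) - 2)"
    by (rule l1_risk_plug_in) simp
  have i2: "integrable ?P (\<lambda>x. 4 * F (norm (x - \<mu>) / 2) - 2)"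
    using l1_risk_plug_in(1)[of "\<lambda>x. x" \<mu>] by simp
  have "(\<integral>x. 4 * F (norm (baranchik a r x - \<mu>) / 2) - 2 \<partial>?P)
     \<le> (\<integral>x. (4 * F (norm (x - \<mu>) / 2) - 2) + a * (G x * E x) \<partial>?P)"
  proof (rule integral_mono_AE[OF i1 Bochner_Integration.integrable_add[OF i2 integrable_mult_right[OF GE]]])
    note [measurable] = spherical_measurable[OF dens_p]
    have "AE x in ?P. x \<noteq> \<mu>" unfolding spherical_law_def
      by (subst AE_density) (use AE_lborel_singleton[of \<mu>] in \<open>auto elim: eventually_mono\<close>)
    then show "AE x in ?P. 4 * F (norm (baranchik a r x - \<mu>) / 2) - 2 \<le> (4 * F (norm (x - \<mu>) / 2) - 2) + a * (G x * E x)"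
    proof eventually_elim
      case (elim x)
      have "4 * F (norm (baranchik a r x - \<mu>) / 2) - 2 \<le> 4 * F (norm (x - \<mu>) / 2) - 2
          + G x * ((norm (baranchik a r x - \<mu>))\<^sup>2 - (norm (x - \<mu>))\<^sup>2)"
        unfolding G_def using elim by (intro loss_tangent) auto
      then show ?case unfolding baranchik_excess[OF \<mu> e] E_def by (simp add: mult.left_commute)
    qed
  qed
  also have "\<dots> = (\<integral>x. 4 * F (norm (x - \<mu>) / 2) - 2 \<partial>?P) + a * (\<integral>x. G x * E x \<partial>?P)"
    unfolding Bochner_Integration.integral_add[OF i2 integrable_mult_right[OF GE]] integral_mult_right_zero ..
  finally show ?thesis unfolding val .
qed

theorem baranchik_dominates:
  assumes r_pos: "\<And>t. 0 < t \<Longrightarrow> 0 < r t" and W0: "0 < (\<integral>\<^sup>+t. ennreal (radial_weight p f t) \<partial>\<tau>)"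
  shows "dominates p q (plug_in q (baranchik a r)) (plug_in q (\<lambda>x :: real^'n. x))"
  unfolding dominates_def
proof (intro conjI allI exI)
  fix \<mu> :: "real^'n"
  obtain e where e: "norm e = 1" "\<mu> = norm \<mu> *\<^sub>R e"
  proof (cases "\<mu> = 0")
    case True
    then show ?thesis using that[of "axis k 1"] by simp
  next
    case False
    then show ?thesis using that[of "\<mu> /\<^sub>R norm \<mu>"] by simp
  qed
  interpret S: shrinkage "cosine_measure e" "CARD('n)" r by (rule shrinkage_cosine[OF e(1)])
  have "(\<integral>(t, u). S.excess a (norm \<mu>) t u \<partial>(W \<Otimes>\<^sub>M cosine_measure e)) \<le> 0"
    by (rule S.radial_excess_nonpos[OF finite_W sets_W W_pos W_inv_integrable a_pos a_le_W]) simp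
  then have "a * (\<integral>(t, u). S.excess a (norm \<mu>) t u \<partial>(W \<Otimes>\<^sub>M cosine_measure e)) \<le> 0"
    using a_pos by (simp add: mult_le_0_iff)
  then have "(\<integral>x. 4 * F (norm (baranchik a r x - \<mu>) / 2) - 2 \<partial>spherical_law p \<mu>)
    \<le> (\<integral>x. 4 * F (norm (x - \<mu>) / 2) - 2 \<partial>spherical_law p \<mu>)"
    using risk_difference_le[OF e(2) e(1)] by simp
  then show "l1_risk p q (plug_in q (baranchik a r)) \<mu> \<le> l1_risk p q (plug_in q (\<lambda>x. x)) \<mu>"
    unfolding l1_risk_plug_in(2)[OF baranchik_measurable] l1_risk_plug_in(2)[OF measurable_ident_sets[OF refl]]
    by (rule ennreal_leI)
next
  let ?e = "axis k 1 :: real^'n"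
  interpret S: shrinkage "cosine_measure ?e" "CARD('n)" r by (rule shrinkage_cosine) simp
  have "0 < measure W (space W)"
    using W0 emeasure_W finite_measure.emeasure_eq_measure[OF finite_W, of "space W"]
    by (auto simp: order_less_le)
  then have "(\<integral>(t, u). S.excess a 0 t u \<partial>(W \<Otimes>\<^sub>M cosine_measure ?e)) < 0"
    using r_pos by (intro S.radial_excess_neg[OF finite_W sets_W W_pos W_inv_integrable a_pos a_le_W]) auto
  then have "a * (\<integral>(t, u). S.excess a 0 t u \<partial>(W \<Otimes>\<^sub>M cosine_measure ?e)) < 0"
    using a_pos by (simp add: mult_less_0_iff)
  then have "(\<integral>x. 4 * F (norm (baranchik a r x - 0) / 2) - 2 \<partial>spherical_law p (0 :: real^'n))
    < (\<integral>x. 4 * F (norm (x - 0) / 2) - 2 \<partial>spherical_law p (0 :: real^'n))"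
    using risk_difference_le[of 0 0 ?e] by simp
  then show "l1_risk p q (plug_in q (baranchik a r)) (0 :: real^'n) < l1_risk p q (plug_in q (\<lambda>x :: real^'n. x)) 0"
    unfolding l1_risk_plug_in(2)[OF baranchik_measurable] l1_risk_plug_in(2)[OF measurable_ident_sets[OF refl]]
    using l1_risk_plug_in(3)[OF baranchik_measurable, of 0] by (simp add: ennreal_less_iff)
qed

end


section \<open>Radial moments and dominance\<close>

text \<open>Spheres are null sets, so the countably many radii at which the marginal density may differ from the supergradient
do not affect integrals over the space.\<close>
lemma AE_norm_avoids:
  assumes "countable N"
  shows "AE z in lborel. norm (z - c :: 'a::euclidean_space) / 2 \<notin> N"
proof -
  have "sphere c r \<in> null_sets lborel" for r
    using negligible_sphere[of c r] by (auto simp: negligible_iff_null_sets null_sets_completion_iff)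
  then have "(\<Union>s\<in>N. sphere c (2 * s)) \<in> null_sets lborel"
    using assms by (intro null_sets_UN') auto
  then have "AE z in lborel. z \<notin> (\<Union>s\<in>N. sphere c (2 * s))" by (rule AE_not_in)
  then show ?thesis
  proof eventually_elim
    case (elim z)
    show ?case
    proof
      assume "norm (z - c) / 2 \<in> N"
      then have "z \<in> sphere c (2 * (norm (z - c) / 2))" by (simp add: dist_norm norm_minus_commute)
      then show False using elim \<open>norm (z - c) / 2 \<in> N\<close> by blast
    qed
  qed
qed

lemma AE_sqrt_avoids:
  assumes "countable N"
  shows "AE u in lborel. 0 < u \<longrightarrow> sqrt u / 2 \<notin> N"
proof -
  have "countable ((\<lambda>s. (2 * s)\<^sup>2) ` N)" using assms by simp
  then have "AE u in lborel. u \<notin> (\<lambda>s. (2 * s)\<^sup>2) ` N"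
    by (intro AE_not_in countable_imp_null_set_lborel)
  then show ?thesis
  proof eventually_elim
    case (elim u)
    show ?case
    proof (intro impI notI)
      assume u: "0 < u" and N: "sqrt u / 2 \<in> N"
      have "u = (2 * (sqrt u / 2))\<^sup>2" using u by simp
      then show False using elim N by blast
    qed
  qed
qed

lemma nn_integral_radial_measure:
  fixes h :: "real \<Rightarrow> ennreal"
  assumes [measurable]: "h \<in> borel_measurable borel"
  shows "(\<integral>\<^sup>+t. h t \<partial>radial_measure TYPE('a::euclidean_space))
    = ennreal (measure lborel (cball (0::'a) 1) * (DIM('a) / 2))
      * (\<integral>\<^sup>+t\<in>{0<..}. ennreal (t powr ((real DIM('a) - 2) / 2)) * h t \<partial>lborel)"
proof -
  have "(\<integral>\<^sup>+t. h t \<partial>radial_measure TYPE('a)) = (\<integral>\<^sup>+t. ennreal (measure lborel (cball (0::'a) 1) * (DIM('a) / 2)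
     * t powr ((real DIM('a) - 2) / 2)) * indicator {0<..} t * h t \<partial>lborel)"
    unfolding radial_measure_def by (subst nn_integral_density) auto
  also have "\<dots> = (\<integral>\<^sup>+t. ennreal (measure lborel (cball (0::'a) 1) * (DIM('a) / 2))
     * (ennreal (t powr ((real DIM('a) - 2) / 2)) * h t * indicator {0<..} t) \<partial>lborel)"
  proof (rule nn_integral_cong)
    fix t
    have "ennreal (measure lborel (cball (0::'a) 1) * (DIM('a) / 2) * t powr ((real DIM('a) - 2) / 2))
      = ennreal (measure lborel (cball (0::'a) 1) * (DIM('a) / 2)) * ennreal (t powr ((real DIM('a) - 2) / 2))"
      by (rule ennreal_mult') simp
    then show "ennreal (measure lborel (cball (0::'a) 1) * (DIM('a) / 2) * t powr ((real DIM('a) - 2) / 2)) * indicator {0<..} t * h t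
      = ennreal (measure lborel (cball (0::'a) 1) * (DIM('a) / 2)) * (ennreal (t powr ((real DIM('a) - 2) / 2)) * h t * indicator {0<..} t)"
      by (simp only: mult.assoc mult.commute[of "h t"])
  qed
  also have "\<dots> = ennreal (measure lborel (cball (0::'a) 1) * (DIM('a) / 2))
      * (\<integral>\<^sup>+t\<in>{0<..}. ennreal (t powr ((real DIM('a) - 2) / 2)) * h t \<partial>lborel)"
    by (rule nn_integral_cmult) auto
  finally show ?thesis .
qed

text \<open>The density \<open>t\<^bsup>(n-2)/2\<^esup>\<close> of the squared norm and the factor \<open>1/\<surd>t\<close> of the weight combine to the power \<open>(n-3)/2\<close>. The
exponents \<open>j = 0\<close> and \<open>j = -1\<close> give the two moments in the bound on a.\<close>
lemma radial_weight_moment: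
  fixes f p F' :: "real \<Rightarrow> real" and j :: real
  assumes N: "countable N" and F': "\<And>x. 0 < x \<Longrightarrow> x \<notin> N \<Longrightarrow> F' x = f x"
    and [measurable]: "radial_weight p f \<in> borel_measurable borel"
  shows "(\<integral>\<^sup>+t. ennreal (radial_weight p f t * t powr j) \<partial>radial_measure TYPE('a::euclidean_space))
    = ennreal (measure lborel (cball (0::'a) 1) * (DIM('a) / 2)) * radial_moment p F' ((real DIM('a) - 3) / 2 + j)"
proof -
  have "(\<integral>\<^sup>+t\<in>{0<..}. ennreal (t powr ((real DIM('a) - 2) / 2)) * ennreal (radial_weight p f t * t powr j) \<partial>lborel)
    = radial_moment p F' ((real DIM('a) - 3) / 2 + j)"
    unfolding radial_moment_def
  proof (rule nn_integral_cong_AE)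
    show "AE t in lborel. ennreal (t powr ((real DIM('a) - 2) / 2)) * ennreal (radial_weight p f t * t powr j) * indicator {0<..} t
       = ennreal (t powr ((real DIM('a) - 3) / 2 + j) * p t * F' (sqrt t / 2)) * indicator {0<..} t"
      using AE_sqrt_avoids[OF N]
    proof eventually_elim
      case (elim t)
      show ?case
      proof (cases "0 < t")
        case True
        then have F: "F' (sqrt t / 2) = f (sqrt t / 2)" using elim by (intro F') auto
        have "t powr ((real DIM('a) - 3) / 2 + j) = t powr ((real DIM('a) - 2) / 2) / sqrt t * t powr j"
          using True by (simp add: powr_add powr_half_sqrt[symmetric] powr_diff[symmetric] diff_divide_distrib)
        then have "t powr ((real DIM('a) - 2) / 2) * (radial_weight p f t * t powr j)
            = t powr ((real DIM('a) - 3) / 2 + j) * p t * F' (sqrt t / 2)"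
          using True unfolding F radial_weight_def by simp
        then show ?thesis using True by (simp flip: ennreal_mult')
      qed simp
    qed
  qed
  then show ?thesis by (subst nn_integral_radial_measure) auto
qed

theorem corollary5p2:
  fixes p\<^sub>X q\<^sub>Y r F' :: "real \<Rightarrow> real" and a p :: real and k :: "'n::finite"
  defines "p \<equiv> real CARD('n)"
    and "F' \<equiv> marginal_density q\<^sub>Y k"
  assumes dim: "CARD('n) \<ge> 4"
    and dens_X: "lebesgue_density (\<lambda>x :: real^'n. p\<^sub>X ((norm x)\<^sup>2))"
    and dens_Y: "lebesgue_density (\<lambda>y :: real^'n. q\<^sub>Y ((norm y)\<^sup>2))"
    and unimodal_Y: "unimodal (\<lambda>y :: real^'n. q\<^sub>Y ((norm y)\<^sup>2))"
    and i: "\<forall>t>0. 0 \<le> r t \<and> r t \<le> 1" "\<exists>t>0. r t \<noteq> 0"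
    and ii: "\<forall>s t. 0 < s \<and> s \<le> t \<longrightarrow> r s \<le> r t"
    and iii: "\<forall>s t. 0 < s \<and> s \<le> t \<longrightarrow> r t / t \<le> r s / s"
    and iv: "\<forall>\<mu> :: real^'n.
       0 < (\<integral>\<^sup>+x. ennreal (F' (norm (x - \<mu>) / 2) / norm (x - \<mu>)) \<partial>spherical_law p\<^sub>X \<mu>) \<and>
       (\<integral>\<^sup>+x. ennreal (F' (norm (x - \<mu>) / 2) / norm (x - \<mu>)) \<partial>spherical_law p\<^sub>X \<mu>) < \<infinity>"
    and v: "0 < a"
       "ennreal a \<le> ennreal (2 * (p - 2) / p) *
          (radial_moment p\<^sub>X F' ((p - 3) / 2) / radial_moment p\<^sub>X F' ((p - 5) / 2))"
  shows "dominates p\<^sub>X q\<^sub>Y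
           (plug_in q\<^sub>Y (baranchik a r)) (plug_in q\<^sub>Y (\<lambda>x :: real^'n. x))"
proof -
  interpret Y: unimodal_law q\<^sub>Y k by unfold_locales (fact dens_Y, fact unimodal_Y)
  obtain f N where N: "countable N" and f [measurable]: "f \<in> borel_measurable borel"
    and f0: "\<And>x. 0 \<le> f x"
    and sup: "\<And>x y. 0 < x \<Longrightarrow> 0 \<le> y \<Longrightarrow> coord_cdf q\<^sub>Y k y \<le> coord_cdf q\<^sub>Y k x + f x * (y - x)"
    and F'f: "\<And>x. 0 < x \<Longrightarrow> x \<notin> N \<Longrightarrow> F' x = f x"
    unfolding F'_def by (rule Y.marginal_density_supergradient) blast
  let ?n = "real CARD('n)"
  let ?w = "radial_weight p\<^sub>X f"
  define \<tau> where "\<tau> = radial_measure TYPE(real^'n)"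
  define C where "C = measure lborel (cball (0 :: real^'n) 1) * (CARD('n) / 2)"
  have C: "0 < C" using unit_cball(2)[where 'a="real^'n"] by (simp add: C_def)
  have w_meas [measurable]: "?w \<in> borel_measurable borel"
    by (rule radial_weight_measurable[OF dens_X f])
  let ?M3 = "radial_moment p\<^sub>X F' ((p - 3) / 2)" and ?M5 = "radial_moment p\<^sub>X F' ((p - 5) / 2)"
  have sets_\<tau>: "sets \<tau> = sets borel" by (simp add: \<tau>_def radial_measure_def)
  have AE\<tau>: "AE t in \<tau>. 0 < t"
    unfolding \<tau>_def radial_measure_def by (subst AE_density) (auto split: split_indicator)
  have mom3: "(\<integral>\<^sup>+t. ennreal (?w t) \<partial>\<tau>) = ennreal C * ?M3"
  proof -
    have "(\<integral>\<^sup>+t. ennreal (?w t) \<partial>\<tau>) = (\<integral>\<^sup>+t. ennreal (?w t * t powr 0) \<partial>\<tau>)"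
    proof (rule nn_integral_cong_AE)
      show "AE t in \<tau>. ennreal (?w t) = ennreal (?w t * t powr 0)" using AE\<tau> by eventually_elim simp
    qed
    then show ?thesis
      using radial_weight_moment[OF N F'f w_meas, of 0, where 'a="real^'n"] by (simp add: \<tau>_def C_def p_def)
  qed
  have mom5: "(\<integral>\<^sup>+t. ennreal (?w t / t) \<partial>\<tau>) = ennreal C * ?M5"
  proof -
    have "(\<integral>\<^sup>+t. ennreal (?w t / t) \<partial>\<tau>) = (\<integral>\<^sup>+t. ennreal (?w t * t powr (-1)) \<partial>\<tau>)"
    proof (rule nn_integral_cong_AE)
      show "AE t in \<tau>. ennreal (?w t / t) = ennreal (?w t * t powr (-1))"
        using AE\<tau> by eventually_elim (simp add: powr_minus_divide)
    qed
    moreover have eq: "(real DIM(real^'n) - 3) / 2 + (-1) = (p - 5) / 2" by (simp add: p_def field_simps)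
    have "(\<integral>\<^sup>+t. ennreal (?w t * t powr (-1)) \<partial>\<tau>) = ennreal C * ?M5"
      using radial_weight_moment[OF N F'f w_meas, of "-1", where 'a="real^'n"]
      unfolding eq by (simp add: \<tau>_def C_def)
    ultimately show ?thesis by simp
  qed
  \<comment> \<open>At \<open>\<mu> = 0\<close> the moment condition states that the total mass of the weight is positive and finite.\<close>
  have total: "(\<integral>\<^sup>+x. ennreal (F' (norm (x - 0) / 2) / norm (x - 0)) \<partial>spherical_law p\<^sub>X (0 :: real^'n)) = (\<integral>\<^sup>+t. ennreal (?w t) \<partial>\<tau>)"
  proof -
    note [measurable] = spherical_measurable[OF dens_X]
    have ae: "AE x in lborel. norm (x - 0 :: real^'n) / 2 \<notin> N \<and> x \<noteq> 0"
      using AE_norm_avoids[OF N, of "0 :: real^'n"] AE_lborel_singleton[of "0 :: real^'n"] by eventually_elim simp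
    have "AE x in spherical_law p\<^sub>X (0 :: real^'n). norm (x - 0) / 2 \<notin> N \<and> x \<noteq> 0"
      unfolding spherical_law_def by (subst AE_density) (use ae in \<open>auto elim: eventually_mono\<close>)
    then have "(\<integral>\<^sup>+x. ennreal (F' (norm (x - 0) / 2) / norm (x - 0)) \<partial>spherical_law p\<^sub>X (0 :: real^'n))
      = (\<integral>\<^sup>+x. ennreal (f (norm x / 2) / norm x) \<partial>spherical_law p\<^sub>X (0 :: real^'n))"
    proof (intro nn_integral_cong_AE, eventually_elim)
      case (elim x)
      then show ?case by (simp add: F'f)
    qed
    also have "\<dots> = (\<integral>\<^sup>+z. ennreal (p\<^sub>X ((norm z)\<^sup>2)) * ennreal (f (norm z / 2) / norm z) \<partial>(lborel :: (real^'n) measure))"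
      by (subst nn_integral_spherical_law[OF dens_X]) auto
    also have "\<dots> = (\<integral>\<^sup>+z. (\<lambda>(t, u). ennreal (?w t)) ((norm z)\<^sup>2, cosine (axis k 1 :: real^'n) z) \<partial>lborel)"
    proof (rule nn_integral_cong)
      fix z :: "real^'n"
      show "ennreal (p\<^sub>X ((norm z)\<^sup>2)) * ennreal (f (norm z / 2) / norm z)
        = (\<lambda>(t, u). ennreal (?w t)) ((norm z)\<^sup>2, cosine (axis k 1 :: real^'n) z)"
        using radial_profile(2)[OF dens_X, of "(norm z)\<^sup>2"]
        by (cases "z = 0") (auto simp: radial_weight_def simp flip: ennreal_mult')
    qed
    also have "\<dots> = (\<integral>\<^sup>+y. (\<lambda>(t, u). ennreal (?w t)) y
        \<partial>distr lborel (borel \<Otimes>\<^sub>M borel) (\<lambda>z :: real^'n. ((norm z)\<^sup>2, cosine (axis k 1) z)))"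
      by (rule nn_integral_distr[symmetric]) auto
    also have "\<dots> = (\<integral>\<^sup>+y. (\<lambda>(t, u). ennreal (?w t)) y \<partial>(\<tau> \<Otimes>\<^sub>M cosine_measure (axis k 1 :: real^'n)))"
      using dim by (subst polar_decomposition) (auto simp: \<tau>_def)
    also have "\<dots> = (\<integral>\<^sup>+t. ennreal (?w t) \<partial>\<tau>)"
    proof -
      interpret L: prob_space "cosine_measure (axis k 1 :: real^'n)" by (rule prob_cosine_measure)
      note [measurable_cong] = sets_\<tau>
      show ?thesis by (subst L.nn_integral_fst[symmetric]) (auto simp: L.emeasure_space_1)
    qed
    finally show ?thesis .
  qed
  have M3: "0 < ?M3" "?M3 < \<infinity>"
    using iv[rule_format, of 0] C unfolding total mom3
    by (auto simp: ennreal_zero_less_mult_iff ennreal_mult_less_top)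
  \<comment> \<open>If the moment in the denominator were infinite, the bound on a would be 0.\<close>
  have M5: "?M5 < \<infinity>"
  proof (rule ccontr)
    assume "\<not> ?M5 < \<infinity>"
    then have "?M5 = \<infinity>" by (simp add: less_top[symmetric])
    then show False using v by simp
  qed
  \<comment> \<open>r' extends r from the positive reals to a monotone function on the line.\<close>
  define r' where "r' = (\<lambda>t. if 0 < t then r t else 0)"
  have r'_mono: "r' s \<le> r' t" if "s \<le> t" for s t using that i(1) ii by (auto simp: r'_def)
  \<comment> \<open>A zero of r at t forces \<open>r \<le> 0\<close> before t by monotonicity and after t because r(t)/t does not increase.\<close>
  have r_pos: "0 < r t" if t: "0 < t" for t
  proof (rule ccontr)
    assume "\<not> 0 < r t"
    then have rt: "r t = 0" using i(1) t by force
    obtain s where s: "0 < s" "r s \<noteq> 0" using i(2) by blast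
    have "r s = 0"
    proof (cases "s \<le> t")
      case True
      then show ?thesis using ii s i(1) rt by (metis order_antisym)
    next
      case False
      then have "r s / s \<le> 0" using iii t rt by (metis div_0 linorder_le_cases)
      then show ?thesis using s i(1) by (simp add: divide_le_0_iff order_antisym)
    qed
    then show False using s by simp
  qed
  interpret P: plug_in_comparison q\<^sub>Y k p\<^sub>X f r' a \<tau> "density \<tau> (\<lambda>t. ennreal (?w t))"
  proof unfold_locales
    show "r' \<in> borel_measurable borel" by (rule borel_measurable_mono) (simp add: mono_def r'_mono)
    show "r' t / t \<le> r' s / s" if "0 < s" "s \<le> t" for s t using that iii by (simp add: r'_def)
    show "(\<integral>\<^sup>+t. ennreal (?w t) \<partial>\<tau>) < \<infinity>" unfolding mom3 using M3 by (simp add: ennreal_mult_less_top)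
    show "(\<integral>\<^sup>+t. ennreal (?w t / t) \<partial>\<tau>) < \<infinity>" unfolding mom5 using M5 by (simp add: ennreal_mult_less_top)
    have "ennreal a * ?M5 \<le> ennreal (2 * (?n - 2) / ?n) * ?M3"
    proof (cases "?M5 = 0")
      case False
      have "ennreal a * ?M5 \<le> ennreal (2 * (p - 2) / p) * (?M3 / ?M5) * ?M5"
        using v(2) by (rule mult_right_mono) simp
      also have "\<dots> = ennreal (2 * (p - 2) / p) * (?M3 * (?M5 / ?M5))"
        by (simp only: mult.assoc ennreal_divide_times)
      also have "?M5 / ?M5 = 1" using False M5 by (intro ennreal_divide_self) auto
      finally show ?thesis by (simp add: p_def)
    qed simp
    then have "ennreal C * (ennreal a * ?M5) \<le> ennreal C * (ennreal (2 * (?n - 2) / ?n) * ?M3)"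
      by (rule mult_left_mono) simp
    then show "ennreal a * (\<integral>\<^sup>+t. ennreal (?w t / t) \<partial>\<tau>)
      \<le> ennreal (2 * (?n - 2) / ?n) * (\<integral>\<^sup>+t. ennreal (?w t) \<partial>\<tau>)"
      unfolding mom3 mom5 by (simp only: mult.left_commute)
  qed (use dim dens_X f0 sup i(1) r'_mono v(1) in \<open>auto simp: \<tau>_def r'_def\<close>)
  have "baranchik a r' = (baranchik a r :: real^'n \<Rightarrow> real^'n)"
    by (auto simp: baranchik_def r'_def fun_eq_iff)
  moreover have "dominates p\<^sub>X q\<^sub>Y (plug_in q\<^sub>Y (baranchik a r')) (plug_in q\<^sub>Y (\<lambda>x :: real^'n. x))"
    by (rule P.baranchik_dominates) (use r_pos C M3 mom3 in \<open>auto simp: r'_def ennreal_zero_less_mult_iff\<close>)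
  ultimately show ?thesis by simp
qed

end
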